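(* Assume $\mu>0$, $K>0$, $L>0$, and that the holding cost function $h:[0,\infty)\to[0,\infty)$ satisfies the assumption stated in the context. Let $0\le d^*<D^*<U^*<u^*$, along with constants $A^*,B^*$, be the unique constants for which there are $\alpha\ge0$, $x_1\in[0,a]$ and $x_2>a$ with $U^*<x_2<u^*$ such that $g=g_{A^*,B^*}$ is decreasing on $(0,x_1)$, increasing on $(x_1,x_2)$, decreasing on $(x_2,\infty)$, and $$\int_{d^*}^{D^*}[g(x)+k]\,dx=-K,\quad \int_{U^*}^{u^*}[g(x)-\ell]\,dx=L,\quad g(d^* )=-k-\alpha,\quad g(D^* )=-k,\quad g(U^* )=g(u^* )=\ell,\quad \alpha d^*=0 .$$ Then the control band policy $\varphi^*=\{d^*,D^*,U^*,u^*\}$ is optimal among all feasible policies to minimize the long-run average cost when inventory backlog is not allowed; that is, $\mathrm{AC}(x,\varphi^* )\le\mathrm{AC}(x,\varphi)$ for every initial level $x\in[0,\infty)$ and every feasible policy $\varphi$ (feasibility including the constraint $Z(t)\ge0$ for all $t\ge0$).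
   Context: $\mu>0$, $\sigma>0$, $K>0$, $L>0$, $k>0$, $\ell>0$ are constants and $\lambda=2\mu/\sigma^2$. $W$ is an $\{\mathcal F_t\}$-standard Brownian motion on a filtered probability space and $X(t)=x+\mu t+\sigma W(t)$. Assumption on $h:[0,\infty)\to[0,\infty)$: $h$ is continuous and convex; there is $a\in[0,\infty)$ such that $h$ is $C^2$ on $[0,\infty)\setminus\{a\}$ and $h(a)=0$; $h'(x)<0$ for $0\le x<a$ and $h'(x)>0$ for $x>a$. (Conditions on $h(x)$ with $x<0$ are dropped; $a=0$ is allowed, and then $x_1=0$ and $(0,x_1)$ is empty.) For $A,B\in\mathbb R$, $x\ge0$, $g_{A,B}(x)=A-Be^{-\lambda(x-a)}-\frac{\lambda}{\mu}\int_a^x h(y)e^{-\lambda(x-y)}\,dy$. It is a known fact, usable here, that constants with the listed properties exist and are unique. Policies: a policy $\varphi=(Y_1,Y_2)$ is a pair of $\{\mathcal F_t\}$-adapted processes with nondecreasing right-continuous paths having left limits, with convention $Y_i(0-)=0$. The inventory process is $Z(t)=X(t)+Y_1(t)-Y_2(t)$, $Z(0-)=x$. A time $t\ge0$ is an increasing point of $Y_i$ if $Y_i(s)-Y_i(t-)>0$ for each $s>t$; $N_i(t)$ is the cardinality of the set of increasing points of $Y_i$ in $[0,t]$. A policy is feasible if $Z(t)\ge0$ for all $t\ge0$, and $\mathbb E_x[Y_i(t)]<\infty$ and $\mathbb E_x[N_i(t)]<\infty$ for $i=1,2$ and all $t\ge0$. The long-run average cost is $$\mathrm{AC}(x,\varphi)=\limsup_{t\to\infty}\frac1t\,\mathbb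 E_x\Big[\int_0^t h(Z(s))\,ds+KN_1(t)+LN_2(t)+kY_1(t)+\ell Y_2(t)\Big],$$ where $\mathbb E_x$ is expectation given $Z(0-)=x$. Control band policy $\{d,D,U,u\}$, $0\le d<D<U<u$ (pure-jump policy): at time $T_0=0$ the inventory is adjusted by $\xi_0=D-x$ if $x\le d$, $\xi_0=0$ if $d<x<u$, $\xi_0=U-x$ if $x\ge u$. For $n\ge1$, $T_n=\inf\{t>T_{n-1}:Z(t-)\in\{d,u\}\}$, and at time $T_n$ the inventory is adjusted by $D-d$ if $Z(T_n-)=d$ and by $U-u$ if $Z(T_n-)=u$. Positive adjustments are jumps of $Y_1$, absolute values of negative adjustments are jumps of $Y_2$. *)

theory Defs
  imports "HOL-Probability.Probability"
begin

text \<open>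
  Processes are functions \<open>real \<Rightarrow> 'a \<Rightarrow> real\<close> of time and scenario; only times \<open>t \<ge> 0\<close> matter.  The
  library locale \<open>filtration\<close> is used with index type \<open>real\<close>; a filtration indexed by \<open>[0, \<infinity>)\<close>
  is extended to negative times by \<open>F t = F 0\<close>, so this loses no generality.  No usual
  conditions are imposed on the filtration; paths of \<open>W\<close> are continuous for every scenario.
\<close>

locale brownian_motion = prob_space M + filtration "space M" F
  for M :: "'a measure" and F :: "real \<Rightarrow> 'a measure" +
  fixes W :: "real \<Rightarrow> 'a \<Rightarrow> real"
  assumes subalgebra_F: "0 \<le> t \<Longrightarrow> subalgebra M (F t)"
    and adapted_W: "0 \<le> t \<Longrightarrow> W t \<in> borel_measurable (F t)"
    and W_0: "\<omega> \<in> space M \<Longrightarrow> W 0 \<omega> = 0"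
    and continuous_W: "\<omega> \<in> space M \<Longrightarrow> continuous_on {0..} (\<lambda>t. W t \<omega>)"
    and normal_increments: "0 \<le> s \<Longrightarrow> s < t \<Longrightarrow>
      distributed M lborel (\<lambda>\<omega>. W t \<omega> - W s \<omega>) (normal_density 0 (sqrt (t - s)))"
    and indep_increments: "0 \<le> s \<Longrightarrow> s < t \<Longrightarrow>
      indep_set (sets (F s))
        (sets (vimage_algebra (space M) (\<lambda>\<omega>. W t \<omega> - W s \<omega>) borel))"

definition brownian_netput ::
    "real \<Rightarrow> real \<Rightarrow> (real \<Rightarrow> 'a \<Rightarrow> real) \<Rightarrow> real \<Rightarrow> real \<Rightarrow> 'a \<Rightarrow> real" where
  "brownian_netput \<mu> \<sigma> W x t \<omega> = x + \<mu> * t + \<sigma> * W t \<omega>"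


section \<open>Holding cost\<close>

text \<open>\<open>h\<close> lives on \<open>[0, \<infinity>)\<close>; its values at negative arguments are unconstrained.  Derivatives are
  taken within \<open>[0, \<infinity>)\<close>, hence one-sided at \<open>0\<close>.\<close>

definition holding_cost :: "(real \<Rightarrow> real) \<Rightarrow> real \<Rightarrow> bool" where
  "holding_cost h a \<longleftrightarrow>
     (\<forall>x\<ge>0. 0 \<le> h x) \<and> continuous_on {0..} h \<and> convex_on {0..} h \<and>
     0 \<le> a \<and> h a = 0 \<and>
     (\<exists>h' h''.
        (\<forall>x\<in>{0..} - {a}.
            (h has_real_derivative h' x) (at x within {0..}) \<and>
            (h' has_real_derivative h'' x) (at x within {0..})) \<and>
        continuous_on ({0..} - {a}) h'' \<and>
        (\<forall>x. 0 \<le> x \<and> x < a \<longrightarrow> h' x < 0) \<and>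
        (\<forall>x>a. 0 < h' x))"


section \<open>Policies, feasibility and long-run average cost\<close>

text \<open>The convention \<open>Y(0-) = 0\<close> makes \<open>0 \<le> Y 0\<close> part of monotonicity.\<close>

definition control_process ::
    "'a measure \<Rightarrow> (real \<Rightarrow> 'a measure) \<Rightarrow> (real \<Rightarrow> 'a \<Rightarrow> real) \<Rightarrow> bool" where
  "control_process M F Y \<longleftrightarrow>
     (\<forall>t\<ge>0. Y t \<in> borel_measurable (F t)) \<and>
     (\<forall>\<omega>\<in>space M.
        0 \<le> Y 0 \<omega> \<and>
        mono_on {0..} (\<lambda>t. Y t \<omega>) \<and>
        (\<forall>t\<ge>0. continuous (at_right t) (\<lambda>s. Y s \<omega>)) \<and>
        (\<forall>t>0. \<exists>l. ((\<lambda>s. Y s \<omega>) \<longlongrightarrow> l) (at_left t)))"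

definition inventory ::
    "(real \<Rightarrow> 'a \<Rightarrow> real) \<Rightarrow> (real \<Rightarrow> 'a \<Rightarrow> real) \<Rightarrow> (real \<Rightarrow> 'a \<Rightarrow> real) \<Rightarrow> real \<Rightarrow> 'a \<Rightarrow> real" where
  "inventory X Y1 Y2 t \<omega> = X t \<omega> + Y1 t \<omega> - Y2 t \<omega>"

definition left_limit :: "(real \<Rightarrow> real) \<Rightarrow> real \<Rightarrow> real" where
  "left_limit y t = (if t = 0 then 0 else Lim (at_left t) y)"

definition increasing_point :: "(real \<Rightarrow> real) \<Rightarrow> real \<Rightarrow> bool" where
  "increasing_point y t \<longleftrightarrow> 0 \<le> t \<and> (\<forall>s>t. y s - left_limit y t > 0)"

text \<open>The cardinality is \<open>\<infinity>\<close> for infinite sets, hence counting measure rather than \<open>card\<close>.\<close>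

definition adjustment_count :: "(real \<Rightarrow> 'a \<Rightarrow> real) \<Rightarrow> real \<Rightarrow> 'a \<Rightarrow> ennreal" where
  "adjustment_count Y t \<omega> =
     emeasure (count_space UNIV) {s \<in> {0..t}. increasing_point (\<lambda>r. Y r \<omega>) s}"

definition feasible_policy ::
    "'a measure \<Rightarrow> (real \<Rightarrow> 'a measure) \<Rightarrow> (real \<Rightarrow> 'a \<Rightarrow> real) \<Rightarrow>
     (real \<Rightarrow> 'a \<Rightarrow> real) \<Rightarrow> (real \<Rightarrow> 'a \<Rightarrow> real) \<Rightarrow> bool" where
  "feasible_policy M F X Y1 Y2 \<longleftrightarrow>
     control_process M F Y1 \<and> control_process M F Y2 \<and>
     (\<forall>\<omega>\<in>space M. \<forall>t\<ge>0. 0 \<le> inventory X Y1 Y2 t \<omega>) \<and>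
     (\<forall>t\<ge>0. \<forall>Y\<in>{Y1, Y2}.
        (\<integral>\<^sup>+\<omega>. ennreal (Y t \<omega>) \<partial>M) < \<infinity> \<and>
        (\<integral>\<^sup>+\<omega>. adjustment_count Y t \<omega> \<partial>M) < \<infinity>)"

text \<open>All costs are nonnegative for feasible policies, so expectations and the limes superior are
  taken in \<open>[0, \<infinity>]\<close>.  The initial level is the value \<open>X 0\<close> of the uncontrolled process.\<close>

definition average_cost ::
    "'a measure \<Rightarrow> (real \<Rightarrow> real) \<Rightarrow> real \<Rightarrow> real \<Rightarrow> real \<Rightarrow> real \<Rightarrow> (real \<Rightarrow> 'a \<Rightarrow> real) \<Rightarrow>
     (real \<Rightarrow> 'a \<Rightarrow> real) \<Rightarrow> (real \<Rightarrow> 'a \<Rightarrow> real) \<Rightarrow> ennreal" where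
  "average_cost M h K L k l X Y1 Y2 =
     Limsup at_top (\<lambda>t::real.
       (\<integral>\<^sup>+\<omega>.
          (\<integral>\<^sup>+s\<in>{0..t}. ennreal (h (inventory X Y1 Y2 s \<omega>)) \<partial>lborel)
          + ennreal K * adjustment_count Y1 t \<omega> + ennreal L * adjustment_count Y2 t \<omega>
          + ennreal k * ennreal (Y1 t \<omega>) + ennreal l * ennreal (Y2 t \<omega>) \<partial>M)
       / ennreal t)"


section \<open>Control band policies\<close>

text \<open>
  For a single path \<open>X\<close> of the uncontrolled process (so \<open>X 0\<close> is the initial level \<open>Z(0-)\<close>),
  \<open>band_step d D U u X n = (T n, \<xi> n, c n)\<close>: time and signed size of the \<open>n\<close>-th adjustment, and
  \<open>c n = \<xi> 0 + \<dots> + \<xi> n\<close>.  Since \<open>X\<close> is continuous and nothing is adjusted strictly between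
  \<open>T n\<close> and \<open>T (n + 1)\<close>, one has \<open>Z(t-) = X t + c n\<close> for \<open>T n < t \<le> T (n + 1)\<close>, so that the
  infimum below is \<open>inf {t > T n. Z(t-) \<in> {d, u}}\<close>.  It is \<open>\<infinity>\<close> if the set is empty; all later times
  are then \<open>\<infinity>\<close> too and the accompanying \<open>\<xi>\<close> are irrelevant.
\<close>

primrec band_step ::
    "real \<Rightarrow> real \<Rightarrow> real \<Rightarrow> real \<Rightarrow> (real \<Rightarrow> real) \<Rightarrow> nat \<Rightarrow> ereal \<times> real \<times> real" where
  "band_step d D U u X 0 =
     (let \<xi> = (if X 0 \<le> d then D - X 0 else if X 0 < u then 0 else U - X 0)
      in (0, \<xi>, \<xi>))"
| "band_step d D U u X (Suc n) =
     (case band_step d D U u X n of (T, _, c) \<Rightarrow>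
        let T' = Inf {ereal t | t. T < ereal t \<and> X t + c \<in> {d, u}};
            z = X (real_of_ereal T') + c;
            \<xi> = (if z = d then D - d else if z = u then U - u else 0)
        in (T', \<xi>, c + \<xi>))"

definition band_time ::
    "real \<Rightarrow> real \<Rightarrow> real \<Rightarrow> real \<Rightarrow> (real \<Rightarrow> real) \<Rightarrow> nat \<Rightarrow> ereal" where
  "band_time d D U u X n = fst (band_step d D U u X n)"

definition band_jump ::
    "real \<Rightarrow> real \<Rightarrow> real \<Rightarrow> real \<Rightarrow> (real \<Rightarrow> real) \<Rightarrow> nat \<Rightarrow> real" where
  "band_jump d D U u X n = fst (snd (band_step d D U u X n))"

text \<open>For \<open>d < D < U < u\<close> and a continuous path, only finitely many adjustments occur up to time
  \<open>t\<close>, so the sums below are genuine.\<close>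

definition band_up ::
    "real \<Rightarrow> real \<Rightarrow> real \<Rightarrow> real \<Rightarrow> (real \<Rightarrow> 'a \<Rightarrow> real) \<Rightarrow> real \<Rightarrow> 'a \<Rightarrow> real" where
  "band_up d D U u X t \<omega> =
     (\<Sum>n | band_time d D U u (\<lambda>s. X s \<omega>) n \<le> ereal t.
        max 0 (band_jump d D U u (\<lambda>s. X s \<omega>) n))"

definition band_down ::
    "real \<Rightarrow> real \<Rightarrow> real \<Rightarrow> real \<Rightarrow> (real \<Rightarrow> 'a \<Rightarrow> real) \<Rightarrow> real \<Rightarrow> 'a \<Rightarrow> real" where
  "band_down d D U u X t \<omega> =
     (\<Sum>n | band_time d D U u (\<lambda>s. X s \<omega>) n \<le> ereal t.
        max 0 (- band_jump d D U u (\<lambda>s. X s \<omega>) n))"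


section \<open>The free-boundary conditions\<close>

text \<open>The interval integral is oriented, as needed for \<open>x < a\<close>.\<close>

definition g_fun ::
    "real \<Rightarrow> real \<Rightarrow> (real \<Rightarrow> real) \<Rightarrow> real \<Rightarrow> real \<Rightarrow> real \<Rightarrow> real \<Rightarrow> real" where
  "g_fun \<mu> \<sigma> h a A B x =
     (let r = 2 * \<mu> / \<sigma>\<^sup>2 in
      A - B * exp (- r * (x - a)) - r / \<mu> * (LBINT y=a..x. h y * exp (- r * (x - y))))"

definition band_conditions ::
    "(real \<Rightarrow> real) \<Rightarrow> real \<Rightarrow> real \<Rightarrow> real \<Rightarrow> real \<Rightarrow> real \<Rightarrow>
     real \<Rightarrow> real \<Rightarrow> real \<Rightarrow> real \<Rightarrow> bool" where
  "band_conditions g a K L k l d D U u \<longleftrightarrow>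
     0 \<le> d \<and> d < D \<and> D < U \<and> U < u \<and>
     (\<exists>\<alpha> x1 x2.
        0 \<le> \<alpha> \<and> 0 \<le> x1 \<and> x1 \<le> a \<and> a < x2 \<and> U < x2 \<and> x2 < u \<and>
        antimono_on {0<..<x1} g \<and> mono_on {x1<..<x2} g \<and> antimono_on {x2<..} g \<and>
        (LBINT x=d..D. g x + k) = - K \<and>
        (LBINT x=U..u. g x - l) = L \<and>
        g d = - k - \<alpha> \<and> g D = - k \<and> g U = l \<and> g u = l \<and>
        \<alpha> * d = 0)"

end

theory Submission
  imports Defs
begin

text \<open>
  The optimal average cost is \<open>\<gamma> = \<mu> * A\<close>.  On \<open>[d, u]\<close> the function \<open>g\<close> solves
  \<open>\<sigma>\<^sup>2 / 2 * g' + \<mu> * g + h = \<gamma>\<close>, so an antiderivative \<open>f\<close> of \<open>g\<close> is a relative value function: along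
  the controlled inventory \<open>Z\<close>, the expectation of \<open>f (Z t)\<close> plus the cost up to time \<open>t\<close> grows exactly
  like \<open>\<gamma> * t\<close> as long as every adjustment costs exactly the drop of \<open>f\<close>, which is what the two
  integral conditions say about the jumps \<open>d \<rightarrow> D\<close> and \<open>u \<rightarrow> U\<close>.

  \<^emph>\<open>Lower bound.\<close>  For an arbitrary feasible policy it is enough to have a bounded \<open>f\<close> with
  \<open>\<sigma>\<^sup>2 / 2 * f'' + \<mu> * f' + h \<ge> \<gamma>\<close> on \<open>[0, \<infinity>)\<close> for which no adjustment costs less than the drop of \<open>f\<close>.
  Then the cost up to time \<open>t\<close> has expectation at least \<open>\<gamma> * t - 2 * sup \<bar>f\<bar>\<close>.  Such an \<open>f\<close>
  (\<open>lower_test_function\<close>) has derivative \<open>g\<close> on \<open>[d, u]\<close>, the constant \<open>-k\<close> below \<open>d\<close> and the constant \<open>l\<close>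
  above \<open>u\<close>, except that far out, where the convex function \<open>h\<close> exceeds every bound, the derivative is
  brought down from \<open>l\<close> to \<open>0\<close>.  This last modification makes \<open>f\<close> bounded, so that policies with
  large inventories need no separate treatment.

  \<^emph>\<open>Upper bound.\<close>  For the band policy all inequalities become equalities, with a bounded \<open>f\<close> of class
  \<open>C\<^sup>2\<close> that agrees with the antiderivative of \<open>g\<close> on \<open>[d, u]\<close> (\<open>upper_test_function\<close>), and the expected cost
  up to time \<open>t\<close> is at most \<open>\<gamma> * t\<close> plus a constant (\<open>band_cost_bound\<close>).

  \<^emph>\<open>Dynkin's formula without stochastic integrals.\<close>  Time is divided into \<open>N\<close> equal steps
  (\<open>dynkin_lower_bound\<close>).  Within a step all control is postponed to the end of the step, so that only
  the increment of the Brownian motion acts; a second-order Taylor bound, independence of the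
  increment from the past and the moments of the normal distribution give the expected change of \<open>f\<close>
  up to \<open>o(1 / N)\<close>, and the sums over the steps converge to time integrals because paths are right
  continuous.  The Taylor bound holds for test functions whose second derivative jumps, which is needed
  because the second derivative of the lower test function jumps at \<open>d\<close> and \<open>u\<close>.  Postponing control can make the
  inventory negative inside a step; therefore the policy is first started from a level raised by
  \<open>e > 0\<close>, and a step below \<open>-e\<close> is so improbable that its total contribution vanishes as
  \<open>N \<rightarrow> \<infinity>\<close> (\<open>cost_lower_bound\<close>).

  \<^emph>\<open>The band policy is feasible.\<close>  A path makes finitely many adjustments in bounded time, since each of
  them is preceded by a displacement of fixed size.  The adjustment times are stopping times of the
  given filtration because the event of reaching one boundary before the other can be expressed with
  rational times only (\<open>hits_lower_first_iff\<close>).  That the number of adjustments is integrable follows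
  from Dynkin's formula itself: for the policy that stops adjusting after \<open>m\<close> adjustments
  the formula bounds the expected adjustment cost independently of \<open>m\<close>, and Fatou's lemma applies.
\<close>

section \<open>Second-order minorants\<close>

text \<open>With \<open>y\<close> an increment of Brownian motion over a time step \<open>v\<close>, the error \<open>\<eta> * y\<^sup>2\<close> has expectation of
  order \<open>\<eta> * v\<close> and the error \<open>C * y ^ 4\<close> of order \<open>v\<^sup>2\<close>; summed over a grid of mesh \<open>v\<close> the former can be made
  small by the choice of \<open>\<eta>\<close>, after which the latter vanishes with \<open>v\<close>.\<close>

definition second_order_minorant ::
    "real set \<Rightarrow> (real \<Rightarrow> real) \<Rightarrow> (real \<Rightarrow> real) \<Rightarrow> (real \<Rightarrow> real) \<Rightarrow> bool" where
  "second_order_minorant S f G q \<longleftrightarrow>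
     (\<forall>\<eta>>0. \<exists>C\<ge>0. \<forall>z\<in>S. \<forall>y.
        f z + G z * y + q z * y\<^sup>2 / 2 - \<eta> * y\<^sup>2 - C * y ^ 4 \<le> f (z + y))"

text \<open>The function \<open>f\<close> need not be twice differentiable: it suffices that the derivative \<open>G\<close> increases at least as fast
  as an antiderivative \<open>Q\<close> of \<open>q\<close>, so \<open>G\<close> may have corners at which its slope jumps.
  Then \<open>f\<close> minus the quadratic polynomial with slope \<open>G z\<close> at \<open>z\<close> and second derivative \<open>q z - 2 * \<eta>\<close> has
  its minimum over \<open>[z - r, z + r]\<close> at \<open>z\<close>.\<close>

lemma taylor_lower_bound:
  fixes f G q Q :: "real \<Rightarrow> real"
  assumes near: "\<And>w. \<bar>w - z\<bar> \<le> r \<Longrightarrow> w \<in> T"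
    and f: "\<And>w. w \<in> T \<Longrightarrow> (f has_real_derivative G w) (at w)"
    and Q: "\<And>w. w \<in> T \<Longrightarrow> (Q has_real_derivative q w) (at w)"
    and mono: "mono_on T (\<lambda>w. G w - Q w)"
    and osc: "\<And>w. \<bar>w - z\<bar> \<le> r \<Longrightarrow> q w \<ge> q z - 2 * \<eta>"
    and y: "\<bar>y\<bar> \<le> r"
  shows "f z + G z * y + q z * y\<^sup>2 / 2 - \<eta> * y\<^sup>2 \<le> f (z + y)"
proof -
  define p where "p = q z - 2 * \<eta>"
  define \<phi> where "\<phi> = (\<lambda>w. f w - G z * (w - z) - p * (w - z)\<^sup>2 / 2)"
  have slope: "G b - G a \<ge> p * (b - a)" if "a \<le> b" "\<bar>a - z\<bar> \<le> r" "\<bar>b - z\<bar> \<le> r" for a b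
  proof -
    have "Q a - p * a \<le> Q b - p * b"
    proof (rule DERIV_nonneg_imp_nondecreasing[OF that(1)])
      fix w assume "a \<le> w" "w \<le> b"
      then have "\<bar>w - z\<bar> \<le> r" using that by linarith
      then show "\<exists>y. ((\<lambda>a. Q a - p * a) has_real_derivative y) (at w) \<and> 0 \<le> y"
        using osc[of w] near[of w]
        by (intro exI[of _ "q w - p"]) (auto intro!: derivative_eq_intros Q simp: p_def)
    qed
    moreover have "G a - Q a \<le> G b - Q b"
      using mono near that by (auto simp: mono_on_def)
    ultimately show ?thesis by (simp add: algebra_simps)
  qed
  have d\<phi>: "(\<phi> has_real_derivative (G w - G z - p * (w - z))) (at w)" if "\<bar>w - z\<bar> \<le> r" for w
    unfolding \<phi>_def using near[OF that]
    by (auto intro!: derivative_eq_intros f simp: power2_eq_square field_simps)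
  have "\<phi> z \<le> \<phi> (z + y)"
  proof (cases "0 \<le> y")
    case True
    show ?thesis
    proof (rule DERIV_nonneg_imp_nondecreasing[where f = \<phi>])
      show "z \<le> z + y" using True by simp
      fix w assume w: "z \<le> w" "w \<le> z + y"
      then show "\<exists>y. (\<phi> has_real_derivative y) (at w) \<and> 0 \<le> y"
        using d\<phi>[of w] slope[of z w] y True
        by (intro exI[of _ "G w - G z - p * (w - z)"]) (auto simp: abs_le_iff)
    qed
  next
    case False
    show ?thesis
    proof (rule DERIV_nonpos_imp_nonincreasing[where f = \<phi>])
      show "z + y \<le> z" using False by simp
      fix w assume w: "z + y \<le> w" "w \<le> z"
      then show "\<exists>y. (\<phi> has_real_derivative y) (at w) \<and> y \<le> 0"
        using d\<phi>[of w] slope[of w z] y False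
        by (intro exI[of _ "G w - G z - p * (w - z)"]) (auto simp: abs_le_iff algebra_simps)
    qed
  qed
  moreover have "\<phi> z = f z" "\<phi> (z + y) = f (z + y) - G z * y - p * y\<^sup>2 / 2"
    by (simp_all add: \<phi>_def)
  moreover have "p * y\<^sup>2 / 2 = q z * y\<^sup>2 / 2 - \<eta> * y\<^sup>2"
    by (simp add: p_def left_diff_distrib diff_divide_distrib)
  ultimately show ?thesis by linarith
qed

text \<open>Small \<open>y\<close> are covered by Taylor's formula and the uniform continuity of \<open>q\<close>.  For \<open>\<bar>y\<bar> > r\<close> every term is
  bounded by a multiple of \<open>y ^ 4\<close>, whatever the behaviour of \<open>f\<close> there.\<close>

lemma second_order_minorantI:
  fixes f G q Q :: "real \<Rightarrow> real"
  assumes e: "0 < e" and near: "\<And>z w. z \<in> S \<Longrightarrow> \<bar>w - z\<bar> \<le> e \<Longrightarrow> w \<in> T"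
    and f: "\<And>w. w \<in> T \<Longrightarrow> (f has_real_derivative G w) (at w)"
    and Q: "\<And>w. w \<in> T \<Longrightarrow> (Q has_real_derivative q w) (at w)"
    and mono: "mono_on T (\<lambda>w. G w - Q w)"
    and uc: "uniformly_continuous_on UNIV q"
    and bd: "\<And>x. \<bar>f x\<bar> \<le> b" "\<And>x. \<bar>G x\<bar> \<le> b" "\<And>x. \<bar>q x\<bar> \<le> b"
  shows "second_order_minorant S f G q"
  unfolding second_order_minorant_def
proof (intro allI impI)
  fix \<eta> :: real assume \<eta>: "0 < \<eta>"
  then obtain r0 where r0: "0 < r0" "\<And>w z. \<bar>w - z\<bar> < r0 \<Longrightarrow> \<bar>q w - q z\<bar> < 2 * \<eta>"
    using uc unfolding uniformly_continuous_on_def dist_real_def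
    by (metis UNIV_I mult_pos_pos zero_less_numeral)
  define r where "r = min e (r0 / 2)"
  have r: "0 < r" "r \<le> e" "r < r0" using e r0(1) by (auto simp: r_def)
  have b0: "0 \<le> b" using bd(1)[of 0] by linarith
  \<comment> \<open>one summand for each of the three groups of terms, so that \<open>C * y ^ 4\<close> dominates their sum for \<open>\<bar>y\<bar> \<ge> r\<close>\<close>
  define C where "C = 2 * b / r ^ 4 + b / r ^ 3 + b / (2 * r\<^sup>2)"
  have C0: "0 \<le> C" using b0 r by (simp add: C_def)
  show "\<exists>C\<ge>0. \<forall>z\<in>S. \<forall>y. f z + G z * y + q z * y\<^sup>2 / 2 - \<eta> * y\<^sup>2 - C * y ^ 4 \<le> f (z + y)"
  proof (intro exI[of _ C] conjI ballI allI C0)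
    fix z y assume z: "z \<in> S"
    show "f z + G z * y + q z * y\<^sup>2 / 2 - \<eta> * y\<^sup>2 - C * y ^ 4 \<le> f (z + y)"
    proof (cases "\<bar>y\<bar> \<le> r")
      case True
      have "f z + G z * y + q z * y\<^sup>2 / 2 - \<eta> * y\<^sup>2 \<le> f (z + y)"
      proof (rule taylor_lower_bound[where r = r and T = T and Q = Q])
        fix w assume w: "\<bar>w - z\<bar> \<le> r"
        then show "w \<in> T" using near z r by force
        show "q w \<ge> q z - 2 * \<eta>" using r0(2)[of w z] w r by linarith
      qed (use f Q mono True in auto)
      moreover have "0 \<le> C * y ^ 4" using C0 by simp
      ultimately show ?thesis by linarith
    next
      case False
      define v where "v = \<bar>y\<bar> / r"
      have v: "1 \<le> v" using False r by (simp add: v_def)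
      have y4: "y ^ 4 = r ^ 4 * v ^ 4" "y\<^sup>2 = r\<^sup>2 * v\<^sup>2" "\<bar>y\<bar> = r * v"
        using r by (simp_all add: v_def power_divide power_even_abs)
      have "1 \<le> v ^ 4" "v \<le> v ^ 4" "v\<^sup>2 \<le> v ^ 4"
        using v power_increasing[of 0 4 v] power_increasing[of 1 4 v] power_increasing[of 2 4 v] by auto
      then have v4: "2 * b * 1 \<le> 2 * b * v ^ 4" "b * r * v \<le> b * r * v ^ 4"
        "b * r\<^sup>2 / 2 * v\<^sup>2 \<le> b * r\<^sup>2 / 2 * v ^ 4"
        using b0 r by (intro mult_left_mono; simp)+
      have "C * y ^ 4 = 2 * b * v ^ 4 + b * r * v ^ 4 + b * r\<^sup>2 / 2 * v ^ 4"
      proof -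
        have "2 * b / r ^ 4 * y ^ 4 = 2 * b * v ^ 4" using r unfolding y4 by simp
        moreover have "b / r ^ 3 * y ^ 4 = b * r * v ^ 4"
        proof -
          have r4: "r ^ 4 = r ^ 3 * r" by (simp add: power3_eq_cube power4_eq_xxxx)
          show ?thesis using r unfolding y4(1) r4 by simp
        qed
        moreover have "b / (2 * r\<^sup>2) * y ^ 4 = b * r\<^sup>2 / 2 * v ^ 4"
        proof -
          have r4: "r ^ 4 = r\<^sup>2 * r\<^sup>2" by (simp flip: power_add)
          have "b / (2 * r\<^sup>2) * (r\<^sup>2 * r\<^sup>2 * v ^ 4) = (r\<^sup>2 / r\<^sup>2) * (b * r\<^sup>2 / 2 * v ^ 4)"
            by (simp only: times_divide_eq_left times_divide_eq_right divide_divide_eq_left mult_ac)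
          then show ?thesis using r unfolding y4(1) r4 by simp
        qed
        ultimately show ?thesis unfolding C_def by (simp add: distrib_right)
      qed
      moreover have "G z * y \<le> b * \<bar>y\<bar>"
      proof -
        have "G z * y \<le> \<bar>G z * y\<bar>" by (rule abs_ge_self)
        also have "\<dots> \<le> b * \<bar>y\<bar>" unfolding abs_mult by (intro mult_right_mono bd) simp
        finally show ?thesis .
      qed
      moreover have "q z * y\<^sup>2 / 2 \<le> b * y\<^sup>2 / 2"
        using bd(3)[of z] by (intro divide_right_mono mult_right_mono) simp_all
      moreover have "0 \<le> \<eta> * y\<^sup>2" using \<eta> by simp
      moreover have "b * \<bar>y\<bar> = b * r * v" "b * y\<^sup>2 / 2 = b * r\<^sup>2 / 2 * v\<^sup>2"
        unfolding y4 by simp_all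
      moreover have "\<bar>f z\<bar> \<le> b" "\<bar>f (z + y)\<bar> \<le> b" by (fact bd)+
      ultimately show ?thesis
        using v4 by linarith
    qed
  qed
qed

section \<open>Riemann sums of right-continuous functions\<close>

text \<open>Sampling at right endpoints approaches every time from the right, so right continuity alone gives
  pointwise convergence of the step functions.\<close>

lemma right_riemann_sum:
  fixes \<phi> :: "real \<Rightarrow> real"
  assumes t: "0 < t" and bd: "\<And>s. 0 \<le> s \<Longrightarrow> \<bar>\<phi> s\<bar> \<le> b"
    and rc: "\<And>s. 0 \<le> s \<Longrightarrow> continuous (at_right s) \<phi>"
  shows "set_integrable lborel {0<..t} \<phi>" (is ?int)
    and "(\<lambda>N. t / real N * (\<Sum>i=1..N. \<phi> (t * real i / real N))) \<longlonglongrightarrow> (LINT s:{0<..t}|lborel. \<phi> s)" (is ?lim)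
proof -
  define step where "step = (\<lambda>N s. \<Sum>i=1..N. \<phi> (t * real i / real N) *
      indicator {t * (real i - 1) / real N<..t * real i / real N} s)"
  define \<psi> where "\<psi> = (\<lambda>s. indicator {0<..t} s *\<^sub>R \<phi> s)"
  have b0: "0 \<le> b" using bd[of 0] by simp
  have cell: "step N s = \<phi> (t * real i / real N)"
    if "1 \<le> i" "i \<le> N" "t * (real i - 1) / real N < s" "s \<le> t * real i / real N" for N s i
  proof -
    have "N > 0" using that by simp
    have other: "s \<notin> {t * (real j - 1) / real N<..t * real j / real N}" if "j \<noteq> i" "1 \<le> j" for j
    proof (cases "j < i")
      case True
      then have "t * real j / real N \<le> t * (real i - 1) / real N"
        using t by (intro divide_right_mono mult_left_mono) auto
      then show ?thesis using \<open>t * (real i - 1) / real N < s\<close>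
        unfolding greaterThanAtMost_iff by linarith
    next
      case False
      then have "t * real i / real N \<le> t * (real j - 1) / real N"
        using t \<open>j \<noteq> i\<close> by (intro divide_right_mono mult_left_mono) auto
      then show ?thesis using \<open>s \<le> t * real i / real N\<close>
        unfolding greaterThanAtMost_iff by linarith
    qed
    have "step N s = (\<Sum>j\<in>{i}. \<phi> (t * real j / real N) *
      indicator {t * (real j - 1) / real N<..t * real j / real N} s)"
      unfolding step_def
    proof (intro sum.mono_neutral_right ballI)
      fix j assume "j \<in> {1..N} - {i}"
      then have "s \<notin> {t * (real j - 1) / real N<..t * real j / real N}"
        by (intro other) simp_all
      then show "\<phi> (t * real j / real N) *
          indicator {t * (real j - 1) / real N<..t * real j / real N} s = 0"
        by (simp only: indicator_simps mult_zero_right not_False_eq_True)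
    qed (use that in simp_all)
    then show ?thesis using that by (simp add: indicator_def)
  qed
  have find: "\<exists>i. 1 \<le> i \<and> i \<le> N \<and> t * (real i - 1) / real N < s \<and> s \<le> t * real i / real N"
    if "0 < s" "s \<le> t" "N > 0" for N s
  proof -
    define i where "i = nat \<lceil>s * real N / t\<rceil>"
    have pos: "0 < s * real N / t" using that t by simp
    have "s * real N / t \<le> real N" using that t by (simp add: field_simps)
    then have "i \<le> N" unfolding i_def by linarith
    have "1 \<le> i" using pos unfolding i_def by linarith
    have "real i - 1 < s * real N / t" "s * real N / t \<le> real i"
      using pos \<open>1 \<le> i\<close> unfolding i_def by linarith+
    then show ?thesis using \<open>1 \<le> i\<close> \<open>i \<le> N\<close> t that
      by (intro exI[of _ i]) (auto simp: field_simps)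
  qed
  have outside: "step N s = 0" if "s \<notin> {0<..t}" for N s
    unfolding step_def
  proof (intro sum.neutral ballI)
    fix i assume i: "i \<in> {1..N}"
    have "0 \<le> t * (real i - 1) / real N" using t i by simp
    moreover have "t * real i / real N \<le> t" using t i by (auto simp: field_simps)
    ultimately have "s \<notin> {t * (real i - 1) / real N<..t * real i / real N}" using that
      unfolding greaterThanAtMost_iff by linarith
    then show "\<phi> (t * real i / real N) *
      indicator {t * (real i - 1) / real N<..t * real i / real N} s = 0" by simp
  qed
  have lim: "(\<lambda>N. step N s) \<longlonglongrightarrow> \<psi> s" for s
  proof (cases "s \<in> {0<..t}")
    case False
    then show ?thesis using outside by (simp add: \<psi>_def)
  next
    case True
    then have s: "0 < s" "s \<le> t" by auto
    show ?thesis
    proof (rule LIMSEQ_I)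
      fix e :: real assume "0 < e"
      have "(\<phi> \<longlongrightarrow> \<phi> s) (at_right s)"
        using rc[of s] s by (simp add: continuous_within)
      then have "eventually (\<lambda>w. dist (\<phi> w) (\<phi> s) < e) (at_right s)"
        using \<open>0 < e\<close> by (rule tendstoD)
      then obtain c where c: "s < c" "\<And>w. s < w \<Longrightarrow> w < c \<Longrightarrow> \<bar>\<phi> w - \<phi> s\<bar> < e"
        unfolding eventually_at_right_field by (auto simp: dist_real_def)
      obtain n0 :: nat where "t / (c - s) < real n0" using reals_Archimedean2 by blast
      moreover have "0 < t / (c - s)" using c(1) t by simp
      ultimately have "t < real n0 * (c - s)" "0 < real n0"
        using c(1) by (simp add: pos_divide_less_eq, linarith)
      then have n0: "t / real n0 < c - s" "n0 > 0" by (simp_all add: pos_divide_less_eq mult.commute)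
      show "\<exists>no. \<forall>n\<ge>no. norm (step n s - \<psi> s) < e"
      proof (intro exI[of _ n0] allI impI)
        fix n assume n: "n0 \<le> n"
        then have "n > 0" using n0 by simp
        from find[OF s this] obtain i where
          i: "1 \<le> i" "i \<le> n" "t * (real i - 1) / real n < s" "s \<le> t * real i / real n" by blast
        have "t * real i / real n = t * (real i - 1) / real n + t / real n"
          using i by (simp add: right_diff_distrib diff_divide_distrib)
        also have "t / real n \<le> t / real n0" using n n0 t by (intro divide_left_mono) simp_all
        finally have "t * real i / real n < c" using i n0 by linarith
        then have "\<bar>\<phi> (t * real i / real n) - \<phi> s\<bar> < e"
          using c(2)[of "t * real i / real n"] i(4) \<open>0 < e\<close>
          by (cases "t * real i / real n = s") (simp, linarith)
        then show "norm (step n s - \<psi> s) < e"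
          using cell[OF i] True by (simp add: \<psi>_def)
      qed
    qed
  qed
  have meas_step: "step N \<in> borel_measurable lborel" for N
    unfolding step_def by measurable
  have meas: "\<psi> \<in> borel_measurable lborel"
    by (rule borel_measurable_LIMSEQ_real[OF _ meas_step]) (rule lim)
  have bd_step: "\<bar>step N s\<bar> \<le> b * indicator {0<..t} s" for N s
  proof (cases "s \<in> {0<..t} \<and> N > 0")
    case False
    then consider "N = 0" | "s \<notin> {0<..t}" by auto
    then show ?thesis
    proof cases
      case 1
      have "step N s = 0" unfolding step_def 1 by (rule sum.neutral) auto
      then show ?thesis using b0 by simp
    next
      case 2
      then show ?thesis using outside[OF 2, of N] by simp
    qed
  next
    case True
    then obtain i where i: "1 \<le> i" "i \<le> N" "t * (real i - 1) / real N < s" "s \<le> t * real i / real N"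
      using find[of s N] by auto
    have "\<bar>step N s\<bar> \<le> b" unfolding cell[OF i] using t by (intro bd) simp
    then show ?thesis using True by simp
  qed
  have intb: "integrable lborel (\<lambda>s. b * indicator {0<..t} s)"
    using t by (intro integrable_mult_right integrable_real_indicator) simp_all
  have AE_lim: "AE s in lborel. (\<lambda>N. step N s) \<longlonglongrightarrow> \<psi> s"
    by (rule AE_I2) (rule lim)
  have AE_bd: "AE s in lborel. norm (step N s) \<le> b * indicator {0<..t} s" for N
    by (rule AE_I2) (simp only: real_norm_def bd_step)
  have "integrable lborel \<psi>"
    by (rule integrable_dominated_convergence[OF meas meas_step intb AE_lim AE_bd])
  moreover have "(\<lambda>N. integral\<^sup>L lborel (step N)) \<longlonglongrightarrow> integral\<^sup>L lborel \<psi>"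
    by (rule integral_dominated_convergence[OF meas meas_step intb AE_lim AE_bd])
  moreover have "integral\<^sup>L lborel (step N) = t / real N * (\<Sum>i=1..N. \<phi> (t * real i / real N))" for N
  proof -
    have "integral\<^sup>L lborel (step N) = (\<Sum>i=1..N. \<phi> (t * real i / real N) *
        measure lborel {t * (real i - 1) / real N<..t * real i / real N})"
      unfolding step_def
    proof (subst Bochner_Integration.integral_sum)
      fix i assume "i \<in> {1..N}"
      show "integrable lborel (\<lambda>s. \<phi> (t * real i / real N) *
          indicator {t * (real i - 1) / real N<..t * real i / real N} s)"
        by (intro integrable_mult_right integrable_real_indicator)
          (use emeasure_bounded_finite[OF bounded_Ioc] in simp_all)
    qed simp
    also have "\<dots> = (\<Sum>i=1..N. t / real N * \<phi> (t * real i / real N))"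
    proof (intro sum.cong refl)
      fix i assume i: "i \<in> {1..N}"
      have "t * real i / real N = t * (real i - 1) / real N + t / real N"
        using i by (simp add: right_diff_distrib diff_divide_distrib)
      moreover have "0 \<le> t / real N" using t by simp
      ultimately have "measure lborel {t * (real i - 1) / real N<..t * real i / real N} = t / real N"
        by (subst measure_lborel_Ioc) auto
      then show "\<phi> (t * real i / real N) *
        measure lborel {t * (real i - 1) / real N<..t * real i / real N} = t / real N * \<phi> (t * real i / real N)"
        by simp
    qed
    finally show ?thesis by (simp add: sum_distrib_left)
  qed
  ultimately show ?int ?lim
    unfolding set_integrable_def set_lebesgue_integral_def \<psi>_def by simp_all
qed

section \<open>Brownian increments and a discrete Dynkin inequality\<close>

lemma generator_bounded:
  fixes \<mu> \<sigma> b v w :: real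
  assumes "\<bar>v\<bar> \<le> b" "\<bar>w\<bar> \<le> b"
  shows "\<bar>\<mu> * v + \<sigma>\<^sup>2 / 2 * w\<bar> \<le> \<bar>\<mu>\<bar> * b + \<sigma>\<^sup>2 / 2 * b"
proof -
  have "\<bar>\<mu> * v + \<sigma>\<^sup>2 / 2 * w\<bar> \<le> \<bar>\<mu>\<bar> * \<bar>v\<bar> + \<sigma>\<^sup>2 / 2 * \<bar>w\<bar>"
    by (rule order_trans[OF abs_triangle_ineq]) (simp add: abs_mult)
  also have "\<dots> \<le> \<bar>\<mu>\<bar> * b + \<sigma>\<^sup>2 / 2 * b" by (intro add_mono mult_left_mono assms) auto
  finally show ?thesis .
qed

definition increment ::
    "real \<Rightarrow> real \<Rightarrow> (real \<Rightarrow> 'a \<Rightarrow> real) \<Rightarrow> real \<Rightarrow> real \<Rightarrow> 'a \<Rightarrow> real" where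
  "increment \<mu> \<sigma> W s t \<omega> = \<mu> * (t - s) + \<sigma> * (W t \<omega> - W s \<omega>)"

context brownian_motion
begin

lemma measurable_F_M: "0 \<le> t \<Longrightarrow> X \<in> measurable (F t) N \<Longrightarrow> X \<in> measurable M N"
  using measurable_from_subalg[OF subalgebra_F] by blast

lemma measurable_F_mono:
  assumes "s \<le> t" "X \<in> measurable (F s) N"
  shows "X \<in> measurable (F t) N"
  using measurable_mono[OF order_refl refl sets_F_mono[OF assms(1)]] assms(2) space_F by auto

lemma W_measurable [measurable]: "0 \<le> t \<Longrightarrow> W t \<in> borel_measurable M"
  using adapted_W measurable_F_M by blast

lemma increment_measurable [measurable]:
  "0 \<le> s \<Longrightarrow> 0 \<le> t \<Longrightarrow> increment \<mu> \<sigma> W s t \<in> borel_measurable M"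
  unfolding increment_def[abs_def] by measurable

lemma increment_moments:
  assumes "0 \<le> s" "s < t"
  defines "w \<equiv> \<lambda>\<omega>. W t \<omega> - W s \<omega>"
  shows "integrable M (\<lambda>\<omega>. w \<omega> ^ j)"
    and "(\<integral>\<omega>. w \<omega> \<partial>M) = 0" and "(\<integral>\<omega>. w \<omega> ^ 2 \<partial>M) = t - s"
    and "(\<integral>\<omega>. w \<omega> ^ 3 \<partial>M) = 0" and "(\<integral>\<omega>. w \<omega> ^ 4 \<partial>M) = 3 * (t - s)\<^sup>2"
proof -
  have D: "distributed M lborel w (normal_density 0 (sqrt (t - s)))"
    unfolding w_def using normal_increments assms by blast
  have pos: "0 < sqrt (t - s)" using assms by simp
  have E: "(\<integral>\<omega>. w \<omega> ^ j \<partial>M) = (\<integral>x. normal_density 0 (sqrt (t - s)) x * x ^ j \<partial>lborel)" for j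
    using distributed_integral[OF D, of "\<lambda>x. x ^ j"] by simp
  show "integrable M (\<lambda>\<omega>. w \<omega> ^ j)"
    using distributed_integrable[OF D, of "\<lambda>x. x ^ j"] integrable_normal_moment[OF pos, of 0 j]
    by simp
  show "(\<integral>\<omega>. w \<omega> \<partial>M) = 0"
    using E[of 1] integral_normal_moment_odd[OF pos, of 0 0] by simp
  show "(\<integral>\<omega>. w \<omega> ^ 2 \<partial>M) = t - s"
    using E[of 2] integral_normal_moment_even[OF pos, of 0 1] assms by simp
  show "(\<integral>\<omega>. w \<omega> ^ 3 \<partial>M) = 0"
    using E[of 3] integral_normal_moment_odd[OF pos, of 0 1] by (simp add: numeral_3_eq_3)
  show "(\<integral>\<omega>. w \<omega> ^ 4 \<partial>M) = 3 * (t - s)\<^sup>2"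
    using E[of 4] integral_normal_moment_even[OF pos, of 0 2] assms
    by (simp add: fact_numeral power_divide)
qed

lemma indep_past_increment:
  assumes "0 \<le> s" "s < t" "Z \<in> borel_measurable (F s)"
  shows "indep_var borel Z borel (\<lambda>\<omega>. W t \<omega> - W s \<omega>)"
proof -
  let ?w = "\<lambda>\<omega>. W t \<omega> - W s \<omega>"
  have Z: "{Z -` A \<inter> space M | A. A \<in> sets borel} \<subseteq> sets (F s)"
    using measurable_sets[OF assms(3)] space_F by fastforce
  have "sigma_sets (space M) {Z -` A \<inter> space M | A. A \<in> sets borel} \<subseteq> sets (F s)"
    using sets.sigma_sets_subset[OF Z] space_F by simp
  moreover have "sigma_sets (space M) {?w -` A \<inter> space M | A. A \<in> sets borel} =
      sets (vimage_algebra (space M) ?w borel)"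
    by (simp add: sets_vimage_algebra)
  moreover have "random_variable borel Z" using assms measurable_F_M by blast
  moreover have "random_variable borel ?w"
    using assms by (intro borel_measurable_diff W_measurable) auto
  ultimately show ?thesis
    using indep_increments[OF assms(1,2)]
    unfolding indep_var_eq indep_sets2_eq by blast
qed

lemma integrable_bounded:
  fixes Y :: "'a \<Rightarrow> real"
  assumes "Y \<in> borel_measurable M" "\<And>\<omega>. \<bar>Y \<omega>\<bar> \<le> b"
  shows "integrable M Y"
  using assms by (intro integrable_const_bound[where B = b]) auto

text \<open>All that is used of independence: a bounded quantity known at time \<open>s\<close> is uncorrelated with every power of
  the later increment.\<close>

lemma expectation_past_times_increment:
  fixes Z :: "'a \<Rightarrow> real"
  assumes st: "0 \<le> s" "s < t" and Z: "Z \<in> borel_measurable (F s)" and bd: "\<And>\<omega>. \<bar>Z \<omega>\<bar> \<le> b"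
  shows "integrable M (\<lambda>\<omega>. Z \<omega> * (W t \<omega> - W s \<omega>) ^ j)"
    and "(\<integral>\<omega>. Z \<omega> * (W t \<omega> - W s \<omega>) ^ j \<partial>M) = (\<integral>\<omega>. Z \<omega> \<partial>M) * (\<integral>\<omega>. (W t \<omega> - W s \<omega>) ^ j \<partial>M)"
proof -
  have ind: "indep_var borel Z borel (\<lambda>\<omega>. (W t \<omega> - W s \<omega>) ^ j)"
    using indep_var_compose[OF indep_past_increment[OF st Z], of "\<lambda>x. x" borel "\<lambda>x. x ^ j" borel]
    by (simp add: comp_def)
  have int: "integrable M Z"
    using integrable_bounded[OF measurable_F_M[OF st(1) Z] bd] .
  note int2 = increment_moments(1)[OF st, of j]
  show "integrable M (\<lambda>\<omega>. Z \<omega> * (W t \<omega> - W s \<omega>) ^ j)"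
    by (rule indep_var_integrable[OF ind int int2])
  show "(\<integral>\<omega>. Z \<omega> * (W t \<omega> - W s \<omega>) ^ j \<partial>M) = (\<integral>\<omega>. Z \<omega> \<partial>M) * (\<integral>\<omega>. (W t \<omega> - W s \<omega>) ^ j \<partial>M)"
    by (rule indep_var_lebesgue_integral[OF ind int int2])
qed

lemma expectation_increment_powers:
  fixes Z :: "'a \<Rightarrow> real" and \<mu> \<sigma> :: real
  assumes st: "0 \<le> s" "s < t" and Z: "Z \<in> borel_measurable (F s)" and bd: "\<And>\<omega>. \<bar>Z \<omega>\<bar> \<le> b"
  defines "\<Delta> \<equiv> increment \<mu> \<sigma> W s t" and "v \<equiv> t - s"
  shows "has_bochner_integral M (\<lambda>\<omega>. Z \<omega> * \<Delta> \<omega>) ((\<integral>\<omega>. Z \<omega> \<partial>M) * (\<mu> * v))"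
    and "has_bochner_integral M (\<lambda>\<omega>. Z \<omega> * (\<Delta> \<omega>)\<^sup>2) ((\<integral>\<omega>. Z \<omega> \<partial>M) * (\<sigma>\<^sup>2 * v + \<mu>\<^sup>2 * v\<^sup>2))"
    and "has_bochner_integral M (\<lambda>\<omega>. (\<Delta> \<omega>) ^ 4)
           (\<mu> ^ 4 * v ^ 4 + 6 * \<mu>\<^sup>2 * \<sigma>\<^sup>2 * v ^ 3 + 3 * \<sigma> ^ 4 * v\<^sup>2)"
proof -
  let ?w = "\<lambda>\<omega>. W t \<omega> - W s \<omega>"
  have H: "has_bochner_integral M (\<lambda>\<omega>. Z \<omega> * ?w \<omega> ^ j) ((\<integral>\<omega>. Z \<omega> \<partial>M) * (\<integral>\<omega>. ?w \<omega> ^ j \<partial>M))" for j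
    unfolding has_bochner_integral_iff
    using expectation_past_times_increment[OF st Z bd] by simp
  have H1: "has_bochner_integral M (\<lambda>\<omega>. ?w \<omega> ^ j) (\<integral>\<omega>. ?w \<omega> ^ j \<partial>M)" for j
    unfolding has_bochner_integral_iff using increment_moments(1)[OF st] by simp
  note mom = increment_moments(2-)[OF st]
  have "has_bochner_integral M (\<lambda>\<omega>. (\<mu> * v) * (Z \<omega> * ?w \<omega> ^ 0) + \<sigma> * (Z \<omega> * ?w \<omega> ^ 1))
      ((\<mu> * v) * ((\<integral>\<omega>. Z \<omega> \<partial>M) * (\<integral>\<omega>. ?w \<omega> ^ 0 \<partial>M)) + \<sigma> * ((\<integral>\<omega>. Z \<omega> \<partial>M) * (\<integral>\<omega>. ?w \<omega> ^ 1 \<partial>M)))"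
    by (intro has_bochner_integral_add has_bochner_integral_mult_right H)
  then show "has_bochner_integral M (\<lambda>\<omega>. Z \<omega> * \<Delta> \<omega>) ((\<integral>\<omega>. Z \<omega> \<partial>M) * (\<mu> * v))"
    by (rule has_bochner_integral_cong[THEN iffD1, rotated -1])
      (simp_all add: mom prob_space \<Delta>_def increment_def v_def algebra_simps)
  have "has_bochner_integral M (\<lambda>\<omega>. (\<mu>\<^sup>2 * v\<^sup>2) * (Z \<omega> * ?w \<omega> ^ 0) + (2 * \<mu> * \<sigma> * v) * (Z \<omega> * ?w \<omega> ^ 1)
        + \<sigma>\<^sup>2 * (Z \<omega> * ?w \<omega> ^ 2))
      ((\<mu>\<^sup>2 * v\<^sup>2) * ((\<integral>\<omega>. Z \<omega> \<partial>M) * (\<integral>\<omega>. ?w \<omega> ^ 0 \<partial>M))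
        + (2 * \<mu> * \<sigma> * v) * ((\<integral>\<omega>. Z \<omega> \<partial>M) * (\<integral>\<omega>. ?w \<omega> ^ 1 \<partial>M))
        + \<sigma>\<^sup>2 * ((\<integral>\<omega>. Z \<omega> \<partial>M) * (\<integral>\<omega>. ?w \<omega> ^ 2 \<partial>M)))"
    by (intro has_bochner_integral_add has_bochner_integral_mult_right H)
  moreover have "Z \<omega> * (\<Delta> \<omega>)\<^sup>2 = (\<mu>\<^sup>2 * v\<^sup>2) * (Z \<omega> * ?w \<omega> ^ 0)
      + (2 * \<mu> * \<sigma> * v) * (Z \<omega> * ?w \<omega> ^ 1) + \<sigma>\<^sup>2 * (Z \<omega> * ?w \<omega> ^ 2)" for \<omega>
    unfolding \<Delta>_def increment_def v_def by algebra
  moreover have "(\<mu>\<^sup>2 * v\<^sup>2) * ((\<integral>\<omega>. Z \<omega> \<partial>M) * (\<integral>\<omega>. ?w \<omega> ^ 0 \<partial>M))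
        + (2 * \<mu> * \<sigma> * v) * ((\<integral>\<omega>. Z \<omega> \<partial>M) * (\<integral>\<omega>. ?w \<omega> ^ 1 \<partial>M))
        + \<sigma>\<^sup>2 * ((\<integral>\<omega>. Z \<omega> \<partial>M) * (\<integral>\<omega>. ?w \<omega> ^ 2 \<partial>M))
      = (\<integral>\<omega>. Z \<omega> \<partial>M) * (\<sigma>\<^sup>2 * v + \<mu>\<^sup>2 * v\<^sup>2)"
    by (simp add: mom prob_space v_def[symmetric] algebra_simps)
  ultimately show "has_bochner_integral M (\<lambda>\<omega>. Z \<omega> * (\<Delta> \<omega>)\<^sup>2) ((\<integral>\<omega>. Z \<omega> \<partial>M) * (\<sigma>\<^sup>2 * v + \<mu>\<^sup>2 * v\<^sup>2))"
    by (simp only:)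
  have "has_bochner_integral M (\<lambda>\<omega>. (\<mu> * v) ^ 4 * ?w \<omega> ^ 0 + (4 * (\<mu> * v) ^ 3 * \<sigma>) * ?w \<omega> ^ 1
        + (6 * (\<mu> * v)\<^sup>2 * \<sigma>\<^sup>2) * ?w \<omega> ^ 2 + (4 * (\<mu> * v) * \<sigma> ^ 3) * ?w \<omega> ^ 3 + \<sigma> ^ 4 * ?w \<omega> ^ 4)
      ((\<mu> * v) ^ 4 * (\<integral>\<omega>. ?w \<omega> ^ 0 \<partial>M) + (4 * (\<mu> * v) ^ 3 * \<sigma>) * (\<integral>\<omega>. ?w \<omega> ^ 1 \<partial>M)
        + (6 * (\<mu> * v)\<^sup>2 * \<sigma>\<^sup>2) * (\<integral>\<omega>. ?w \<omega> ^ 2 \<partial>M) + (4 * (\<mu> * v) * \<sigma> ^ 3) * (\<integral>\<omega>. ?w \<omega> ^ 3 \<partial>M)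
        + \<sigma> ^ 4 * (\<integral>\<omega>. ?w \<omega> ^ 4 \<partial>M))"
    by (intro has_bochner_integral_add has_bochner_integral_mult_right H1)
  moreover have "\<Delta> \<omega> ^ 4 = (\<mu> * v) ^ 4 * ?w \<omega> ^ 0 + (4 * (\<mu> * v) ^ 3 * \<sigma>) * ?w \<omega> ^ 1
        + (6 * (\<mu> * v)\<^sup>2 * \<sigma>\<^sup>2) * ?w \<omega> ^ 2 + (4 * (\<mu> * v) * \<sigma> ^ 3) * ?w \<omega> ^ 3 + \<sigma> ^ 4 * ?w \<omega> ^ 4" for \<omega>
    unfolding \<Delta>_def increment_def v_def by algebra
  moreover have "(\<mu> * v) ^ 4 * (\<integral>\<omega>. ?w \<omega> ^ 0 \<partial>M) + (4 * (\<mu> * v) ^ 3 * \<sigma>) * (\<integral>\<omega>. ?w \<omega> ^ 1 \<partial>M)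
        + (6 * (\<mu> * v)\<^sup>2 * \<sigma>\<^sup>2) * (\<integral>\<omega>. ?w \<omega> ^ 2 \<partial>M) + (4 * (\<mu> * v) * \<sigma> ^ 3) * (\<integral>\<omega>. ?w \<omega> ^ 3 \<partial>M)
        + \<sigma> ^ 4 * (\<integral>\<omega>. ?w \<omega> ^ 4 \<partial>M) = \<mu> ^ 4 * v ^ 4 + 6 * \<mu>\<^sup>2 * \<sigma>\<^sup>2 * v ^ 3 + 3 * \<sigma> ^ 4 * v\<^sup>2"
  proof -
    have "(\<integral>\<omega>. ?w \<omega> ^ 0 \<partial>M) = 1" "(\<integral>\<omega>. ?w \<omega> ^ 1 \<partial>M) = 0" by (simp_all add: mom prob_space)
    then show ?thesis unfolding mom v_def[symmetric] by algebra
  qed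
  ultimately show "has_bochner_integral M (\<lambda>\<omega>. (\<Delta> \<omega>) ^ 4)
           (\<mu> ^ 4 * v ^ 4 + 6 * \<mu>\<^sup>2 * \<sigma>\<^sup>2 * v ^ 3 + 3 * \<sigma> ^ 4 * v\<^sup>2)"
    by simp
qed

lemma increment_fourth_moment_le:
  assumes "0 \<le> s" "s < t" "t - s \<le> 1"
  shows "integrable M (\<lambda>\<omega>. increment \<mu> \<sigma> W s t \<omega> ^ 4)"
    and "(\<integral>\<omega>. increment \<mu> \<sigma> W s t \<omega> ^ 4 \<partial>M) \<le> (\<mu> ^ 4 + 6 * \<mu>\<^sup>2 * \<sigma>\<^sup>2 + 3 * \<sigma> ^ 4) * (t - s)\<^sup>2"
proof -
  define v where "v = t - s"
  have B: "has_bochner_integral M (\<lambda>\<omega>. increment \<mu> \<sigma> W s t \<omega> ^ 4)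
      (\<mu> ^ 4 * v ^ 4 + 6 * \<mu>\<^sup>2 * \<sigma>\<^sup>2 * v ^ 3 + 3 * \<sigma> ^ 4 * v\<^sup>2)"
    unfolding v_def
    by (rule expectation_increment_powers(3)[where Z = "\<lambda>_. 0" and b = 0]) (use assms in auto)
  show "integrable M (\<lambda>\<omega>. increment \<mu> \<sigma> W s t \<omega> ^ 4)"
    using B by (simp add: has_bochner_integral_iff)
  have "\<mu> ^ 4 * v ^ 4 \<le> \<mu> ^ 4 * v\<^sup>2" "6 * \<mu>\<^sup>2 * \<sigma>\<^sup>2 * v ^ 3 \<le> 6 * \<mu>\<^sup>2 * \<sigma>\<^sup>2 * v\<^sup>2"
    using assms by (auto intro!: mult_left_mono power_decreasing simp: v_def)
  then show "(\<integral>\<omega>. increment \<mu> \<sigma> W s t \<omega> ^ 4 \<partial>M) \<le> (\<mu> ^ 4 + 6 * \<mu>\<^sup>2 * \<sigma>\<^sup>2 + 3 * \<sigma> ^ 4) * (t - s)\<^sup>2"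
    using B unfolding v_def[symmetric] by (simp add: has_bochner_integral_iff distrib_right)
qed

text \<open>Insert the increment into the minorant and take expectations term by term.  The constant \<open>R\<close>
  collects the contribution of the squared drift and of the fourth moment.\<close>

lemma one_step_lower_bound:
  fixes f G q :: "real \<Rightarrow> real" and \<mu> \<sigma> :: real
  assumes st: "0 \<le> s" "s < t" "t - s \<le> 1" and Z: "Z \<in> borel_measurable (F s)"
    and cont: "continuous_on UNIV f" "continuous_on UNIV G" "continuous_on UNIV q"
    and bd: "\<And>x. \<bar>f x\<bar> \<le> b" "\<And>x. \<bar>G x\<bar> \<le> b" "\<And>x. \<bar>q x\<bar> \<le> b"
    and minor: "\<And>\<omega> y. \<omega> \<in> space M \<Longrightarrow>
       f (Z \<omega>) + G (Z \<omega>) * y + q (Z \<omega>) * y\<^sup>2 / 2 - \<eta> * y\<^sup>2 - C * y ^ 4 \<le> f (Z \<omega> + y)"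
    and C: "0 \<le> C" "0 \<le> \<eta>"
  defines "R \<equiv> (b / 2 + \<eta>) * \<mu>\<^sup>2 + C * (\<mu> ^ 4 + 6 * \<mu>\<^sup>2 * \<sigma>\<^sup>2 + 3 * \<sigma> ^ 4)"
  shows "(\<integral>\<omega>. f (Z \<omega>) \<partial>M) + (t - s) * (\<integral>\<omega>. \<mu> * G (Z \<omega>) + \<sigma>\<^sup>2 / 2 * q (Z \<omega>) \<partial>M)
      - \<eta> * \<sigma>\<^sup>2 * (t - s) - R * (t - s)\<^sup>2
    \<le> (\<integral>\<omega>. f (Z \<omega> + increment \<mu> \<sigma> W s t \<omega>) \<partial>M)"
proof -
  define \<Delta> where "\<Delta> = increment \<mu> \<sigma> W s t"
  define v where "v = t - s"
  have [measurable]: "f \<in> borel_measurable borel" "G \<in> borel_measurable borel" "q \<in> borel_measurable borel"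
    using cont by (auto intro: borel_measurable_continuous_onI)
  have [measurable]: "Z \<in> borel_measurable M" using Z st measurable_F_M by blast
  note [measurable] = Z
  have [measurable]: "\<Delta> \<in> borel_measurable M"
    unfolding \<Delta>_def using st by (intro increment_measurable) auto
  have int: "integrable M (\<lambda>\<omega>. f (Z \<omega>))" "integrable M (\<lambda>\<omega>. G (Z \<omega>))" "integrable M (\<lambda>\<omega>. q (Z \<omega>))"
      "integrable M (\<lambda>\<omega>. f (Z \<omega> + \<Delta> \<omega>))"
    by (rule integrable_bounded[where b = b]; use bd in measurable)+
  have H1: "has_bochner_integral M (\<lambda>\<omega>. G (Z \<omega>) * \<Delta> \<omega>) ((\<integral>\<omega>. G (Z \<omega>) \<partial>M) * (\<mu> * v))"
    unfolding \<Delta>_def v_def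
    by (rule expectation_increment_powers(1)[where b = b]) (use st bd in measurable)
  have H2: "has_bochner_integral M (\<lambda>\<omega>. (q (Z \<omega>) / 2 - \<eta>) * (\<Delta> \<omega>)\<^sup>2)
      ((\<integral>\<omega>. q (Z \<omega>) / 2 - \<eta> \<partial>M) * (\<sigma>\<^sup>2 * v + \<mu>\<^sup>2 * v\<^sup>2))"
    unfolding \<Delta>_def v_def
  proof (rule expectation_increment_powers(2)[where b = "b / 2 + \<eta>"])
    show "\<bar>q (Z \<omega>) / 2 - \<eta>\<bar> \<le> b / 2 + \<eta>" for \<omega> using bd(3)[of "Z \<omega>"] C by linarith
  qed (use st in measurable)
  note H3 = increment_fourth_moment_le[OF st, of \<mu> \<sigma>, folded \<Delta>_def v_def]
  have Eq: "(\<integral>\<omega>. q (Z \<omega>) / 2 - \<eta> \<partial>M) = (\<integral>\<omega>. q (Z \<omega>) \<partial>M) / 2 - \<eta>"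
    using int by (simp add: prob_space)
  have qb: "- b \<le> (\<integral>\<omega>. q (Z \<omega>) \<partial>M)"
  proof -
    have "(\<integral>\<omega>. - b \<partial>M) \<le> (\<integral>\<omega>. q (Z \<omega>) \<partial>M)"
      by (intro integral_mono int) (use bd(3) in \<open>simp_all add: abs_le_iff minus_le_iff\<close>)
    then show ?thesis by (simp add: prob_space)
  qed
  have "(\<integral>\<omega>. f (Z \<omega>) + G (Z \<omega>) * \<Delta> \<omega> + (q (Z \<omega>) / 2 - \<eta>) * (\<Delta> \<omega>)\<^sup>2 - C * \<Delta> \<omega> ^ 4 \<partial>M)
      \<le> (\<integral>\<omega>. f (Z \<omega> + \<Delta> \<omega>) \<partial>M)"
  proof (rule integral_mono)
    show "integrable M (\<lambda>\<omega>. f (Z \<omega>) + G (Z \<omega>) * \<Delta> \<omega> + (q (Z \<omega>) / 2 - \<eta>) * (\<Delta> \<omega>)\<^sup>2 - C * \<Delta> \<omega> ^ 4)"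
      using int(1) H1 H2 H3(1) by (auto simp: has_bochner_integral_iff)
    fix \<omega> assume "\<omega> \<in> space M"
    from minor[OF this, of "\<Delta> \<omega>"]
    show "f (Z \<omega>) + G (Z \<omega>) * \<Delta> \<omega> + (q (Z \<omega>) / 2 - \<eta>) * (\<Delta> \<omega>)\<^sup>2 - C * \<Delta> \<omega> ^ 4 \<le> f (Z \<omega> + \<Delta> \<omega>)"
      by (simp add: left_diff_distrib)
  qed (fact int)
  also have "(\<integral>\<omega>. f (Z \<omega>) + G (Z \<omega>) * \<Delta> \<omega> + (q (Z \<omega>) / 2 - \<eta>) * (\<Delta> \<omega>)\<^sup>2 - C * \<Delta> \<omega> ^ 4 \<partial>M)
      = (\<integral>\<omega>. f (Z \<omega>) \<partial>M) + (\<integral>\<omega>. G (Z \<omega>) \<partial>M) * (\<mu> * v)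
        + ((\<integral>\<omega>. q (Z \<omega>) \<partial>M) / 2 - \<eta>) * (\<sigma>\<^sup>2 * v + \<mu>\<^sup>2 * v\<^sup>2) - C * (\<integral>\<omega>. \<Delta> \<omega> ^ 4 \<partial>M)"
    using int(1) H1 H2 H3(1) by (simp add: has_bochner_integral_iff Eq)
  finally have main: "(\<integral>\<omega>. f (Z \<omega>) \<partial>M) + (\<integral>\<omega>. G (Z \<omega>) \<partial>M) * (\<mu> * v)
        + ((\<integral>\<omega>. q (Z \<omega>) \<partial>M) / 2 - \<eta>) * (\<sigma>\<^sup>2 * v + \<mu>\<^sup>2 * v\<^sup>2) - C * (\<integral>\<omega>. \<Delta> \<omega> ^ 4 \<partial>M)
      \<le> (\<integral>\<omega>. f (Z \<omega> + \<Delta> \<omega>) \<partial>M)" .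
  have "C * (\<integral>\<omega>. \<Delta> \<omega> ^ 4 \<partial>M) \<le> C * ((\<mu> ^ 4 + 6 * \<mu>\<^sup>2 * \<sigma>\<^sup>2 + 3 * \<sigma> ^ 4) * v\<^sup>2)"
    by (intro mult_left_mono H3(2) C)
  moreover have "- (b / 2 + \<eta>) * (\<mu>\<^sup>2 * v\<^sup>2) \<le> ((\<integral>\<omega>. q (Z \<omega>) \<partial>M) / 2 - \<eta>) * (\<mu>\<^sup>2 * v\<^sup>2)"
    using qb by (intro mult_right_mono) auto
  moreover have "(\<integral>\<omega>. \<mu> * G (Z \<omega>) + \<sigma>\<^sup>2 / 2 * q (Z \<omega>) \<partial>M)
      = \<mu> * (\<integral>\<omega>. G (Z \<omega>) \<partial>M) + \<sigma>\<^sup>2 / 2 * (\<integral>\<omega>. q (Z \<omega>) \<partial>M)"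
    using int by simp
  ultimately show ?thesis
    using main unfolding R_def \<Delta>_def[symmetric] v_def[symmetric]
    by (simp add: algebra_simps)
qed

text \<open>Riemann sums are measurable in the scenario and uniformly bounded, which yields at once the
  measurability of the time integral and the convergence of the expectations.\<close>

lemma time_integral_right_continuous:
  fixes \<phi> :: "real \<Rightarrow> real" and Z :: "real \<Rightarrow> 'a \<Rightarrow> real"
  assumes t: "0 < t" and cont: "continuous_on UNIV \<phi>" and bd: "\<And>x. \<bar>\<phi> x\<bar> \<le> b"
    and Z: "\<And>s. 0 \<le> s \<Longrightarrow> Z s \<in> borel_measurable M"
    and rc: "\<And>s \<omega>. 0 \<le> s \<Longrightarrow> \<omega> \<in> space M \<Longrightarrow> continuous (at_right s) (\<lambda>s. Z s \<omega>)"
  defines "I \<equiv> \<lambda>\<omega>. LINT s:{0<..t}|lborel. \<phi> (Z s \<omega>)"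
  shows "I \<in> borel_measurable M"
    and "\<omega> \<in> space M \<Longrightarrow> \<bar>I \<omega>\<bar> \<le> b * t"
    and "\<omega> \<in> space M \<Longrightarrow> set_integrable lborel {0<..t} (\<lambda>s. \<phi> (Z s \<omega>))"
    and "(\<lambda>N. t / real N * (\<Sum>i=1..N. \<integral>\<omega>. \<phi> (Z (t * real i / real N) \<omega>) \<partial>M)) \<longlonglongrightarrow> (\<integral>\<omega>. I \<omega> \<partial>M)"
proof -
  define S where "S = (\<lambda>N \<omega>. t / real N * (\<Sum>i=1..N. \<phi> (Z (t * real i / real N) \<omega>)))"
  have b0: "0 \<le> b" using bd[of 0] by linarith
  have [measurable]: "\<phi> \<in> borel_measurable borel"
    using cont by (rule borel_measurable_continuous_onI)
  have Zm: "(\<lambda>\<omega>. \<phi> (Z s \<omega>)) \<in> borel_measurable M" if "0 \<le> s" for s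
    using Z[OF that] by measurable
  have rc': "continuous (at_right s) (\<lambda>s. \<phi> (Z s \<omega>))" if "0 \<le> s" "\<omega> \<in> space M" for s \<omega>
  proof -
    have "isCont \<phi> (Z s \<omega>)" using cont by (simp add: continuous_on_eq_continuous_at)
    then show ?thesis
      using rc[OF that] by (rule continuous_within_compose3)
  qed
  note R = right_riemann_sum[OF t, where \<phi> = "\<lambda>s. \<phi> (Z s \<omega>)" and b = b for \<omega>]
  have lim: "(\<lambda>N. S N \<omega>) \<longlonglongrightarrow> I \<omega>" if "\<omega> \<in> space M" for \<omega>
    unfolding S_def I_def using R(2)[of \<omega>] bd rc' that by blast
  have Sm: "S N \<in> borel_measurable M" for N
    unfolding S_def using t
    by (intro borel_measurable_times borel_measurable_const borel_measurable_sum Zm) simp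
  have Sb: "\<bar>S N \<omega>\<bar> \<le> b * t" for N \<omega>
  proof (cases "N = 0")
    case False
    have "\<bar>\<Sum>i=1..N. \<phi> (Z (t * real i / real N) \<omega>)\<bar> \<le> (\<Sum>i=1..N. b)"
      by (rule order_trans[OF sum_abs sum_mono]) (rule bd)
    then have "\<bar>S N \<omega>\<bar> \<le> t / real N * (real N * b)"
      unfolding S_def abs_mult using t by (intro mult_mono) auto
    then show ?thesis using False by (simp add: mult.commute)
  qed (use b0 t in \<open>simp add: S_def\<close>)
  show Im: "I \<in> borel_measurable M"
    by (rule borel_measurable_LIMSEQ_real[OF lim Sm])
  show "\<bar>I \<omega>\<bar> \<le> b * t" if "\<omega> \<in> space M"
    by (rule LIMSEQ_le_const2[OF tendsto_rabs[OF lim[OF that]]]) (use Sb in blast)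
  show "set_integrable lborel {0<..t} (\<lambda>s. \<phi> (Z s \<omega>))" if "\<omega> \<in> space M"
    using R(1)[of \<omega>] bd rc' that by blast
  have "(\<lambda>N. integral\<^sup>L M (S N)) \<longlonglongrightarrow> integral\<^sup>L M I"
  proof (rule integral_dominated_convergence[where w = "\<lambda>_. b * t"])
    show "AE \<omega> in M. (\<lambda>N. S N \<omega>) \<longlonglongrightarrow> I \<omega>" using lim by (rule AE_I2)
    show "AE \<omega> in M. norm (S N \<omega>) \<le> b * t" for N
      by (rule AE_I2) (simp only: real_norm_def Sb)
  qed (use Im Sm in auto)
  moreover have "integral\<^sup>L M (S N) = t / real N * (\<Sum>i=1..N. \<integral>\<omega>. \<phi> (Z (t * real i / real N) \<omega>) \<partial>M)" for N
  proof -
    have "integrable M (\<lambda>\<omega>. \<phi> (Z (t * real i / real N) \<omega>))" for i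
      using t by (intro integrable_bounded[where b = b] Zm bd) simp
    then show ?thesis unfolding S_def by (simp add: Bochner_Integration.integral_sum)
  qed
  ultimately show "(\<lambda>N. t / real N * (\<Sum>i=1..N. \<integral>\<omega>. \<phi> (Z (t * real i / real N) \<omega>) \<partial>M)) \<longlonglongrightarrow> (\<integral>\<omega>. I \<omega> \<partial>M)"
    by simp
qed

text \<open>A one-sided form of Dynkin's formula for an arbitrary adapted right-continuous process.  Nothing is assumed
  about how the process moves: every deviation from the uncontrolled movement over a grid cell is left in the
  sum on the left, to be estimated from the policy later on.\<close>

lemma dynkin_lower_bound:
  fixes f G q :: "real \<Rightarrow> real" and \<mu> \<sigma> :: real and Z :: "real \<Rightarrow> 'a \<Rightarrow> real"
  assumes t: "0 < t"
    and cont: "continuous_on UNIV f" "continuous_on UNIV G" "continuous_on UNIV q"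
    and bd: "\<And>x. \<bar>f x\<bar> \<le> b" "\<And>x. \<bar>G x\<bar> \<le> b" "\<And>x. \<bar>q x\<bar> \<le> b"
    and minor: "second_order_minorant S f G q"
    and adapted: "\<And>s. 0 \<le> s \<Longrightarrow> Z s \<in> borel_measurable (F s)"
    and range: "\<And>s \<omega>. 0 \<le> s \<Longrightarrow> \<omega> \<in> space M \<Longrightarrow> Z s \<omega> \<in> S"
    and rc: "\<And>s \<omega>. 0 \<le> s \<Longrightarrow> \<omega> \<in> space M \<Longrightarrow> continuous (at_right s) (\<lambda>s. Z s \<omega>)"
    and e: "0 < e"
  defines "I \<equiv> \<lambda>\<omega>. LINT s:{0<..t}|lborel. \<mu> * G (Z s \<omega>) + \<sigma>\<^sup>2 / 2 * q (Z s \<omega>)"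
    and "\<tau> \<equiv> \<lambda>N i. t * real i / real N"
  shows "eventually (\<lambda>N. (\<integral>\<omega>. f (Z 0 \<omega>) \<partial>M) + (\<integral>\<omega>. I \<omega> \<partial>M) - e
      + (\<Sum>i<N. \<integral>\<omega>. f (Z (\<tau> N (Suc i)) \<omega>)
          - f (Z (\<tau> N i) \<omega> + increment \<mu> \<sigma> W (\<tau> N i) (\<tau> N (Suc i)) \<omega>) \<partial>M)
      \<le> (\<integral>\<omega>. f (Z t \<omega>) \<partial>M)) sequentially"
proof -
  define \<Gamma> where "\<Gamma> = (\<lambda>x. \<mu> * G x + \<sigma>\<^sup>2 / 2 * q x)"
  define \<beta> where "\<beta> = \<bar>\<mu>\<bar> * b + \<sigma>\<^sup>2 / 2 * b"
  \<comment> \<open>the quadratic errors sum up to \<open>\<eta> * \<sigma>\<^sup>2 * t\<close>; they get a quarter of \<open>e\<close>\<close>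
  define \<eta> where "\<eta> = e / (4 * (\<sigma>\<^sup>2 * t + 1))"
  have pos1: "0 < \<sigma>\<^sup>2 * t + 1" using t by (simp add: add_nonneg_pos)
  then have \<eta>: "0 < \<eta>" using e by (simp add: \<eta>_def)
  have "\<eta> * (\<sigma>\<^sup>2 * t) \<le> \<eta> * (\<sigma>\<^sup>2 * t + 1)" using \<eta> by simp
  also have "\<dots> = e / 4"
  proof -
    have "e / (4 * c) * c = e / 4" if "0 < c" for c :: real using that by simp
    from this[OF pos1] show ?thesis unfolding \<eta>_def .
  qed
  finally have \<eta>t: "\<eta> * \<sigma>\<^sup>2 * t \<le> e / 4" by simp
  obtain C where C: "0 \<le> C" "\<And>z y. z \<in> S \<Longrightarrow>
      f z + G z * y + q z * y\<^sup>2 / 2 - \<eta> * y\<^sup>2 - C * y ^ 4 \<le> f (z + y)"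
    using minor \<eta> unfolding second_order_minorant_def by meson
  define R where "R = (b / 2 + \<eta>) * \<mu>\<^sup>2 + C * (\<mu> ^ 4 + 6 * \<mu>\<^sup>2 * \<sigma>\<^sup>2 + 3 * \<sigma> ^ 4)"
  have contG: "continuous_on UNIV \<Gamma>" unfolding \<Gamma>_def using cont by (intro continuous_intros)
  have bdG: "\<bar>\<Gamma> x\<bar> \<le> \<beta>" for x
    unfolding \<Gamma>_def \<beta>_def by (rule generator_bounded) (rule bd)+
  have Zm: "Z s \<in> borel_measurable M" if "0 \<le> s" for s
    using adapted[OF that] measurable_F_M that by blast
  note ti = time_integral_right_continuous[OF t contG bdG Zm rc]
  have lim: "(\<lambda>N. t / real N * (\<Sum>i=1..N. \<integral>\<omega>. \<Gamma> (Z (\<tau> N i) \<omega>) \<partial>M)) \<longlonglongrightarrow> (\<integral>\<omega>. I \<omega> \<partial>M)"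
    using ti(4) unfolding I_def \<Gamma>_def \<tau>_def by simp
  have "eventually (\<lambda>N. \<bar>t / real N * (\<Sum>i=1..N. \<integral>\<omega>. \<Gamma> (Z (\<tau> N i) \<omega>) \<partial>M) - (\<integral>\<omega>. I \<omega> \<partial>M)\<bar> < e / 4) sequentially"
    using tendstoD[OF lim, of "e / 4"] e by (simp add: dist_real_def)
  moreover have "eventually (\<lambda>N. c / real N < a) sequentially" if "0 < a" for a c :: real
    using order_tendstoD(2)[OF lim_const_over_n that] .
  from this[of 1 t] this[of "e / 4" "R * t\<^sup>2"] this[of "e / 4" "2 * \<beta> * t"]
  have "eventually (\<lambda>N. t / real N < 1) sequentially"
    "eventually (\<lambda>N. R * t\<^sup>2 / real N < e / 4) sequentially"
    "eventually (\<lambda>N. 2 * \<beta> * t / real N < e / 4) sequentially" using e by auto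
  moreover have "eventually (\<lambda>N. 0 < N) sequentially" by (rule eventually_gt_at_top)
  ultimately show ?thesis
  proof eventually_elim
    case (elim N)
    define \<delta> where "\<delta> = t / real N"
    have \<tau>_step: "\<tau> N (Suc i) - \<tau> N i = \<delta>" "0 \<le> \<tau> N i" "\<tau> N i < \<tau> N (Suc i)" for i
      using elim(5) t by (auto simp: \<tau>_def \<delta>_def field_simps)
    have \<tau>0: "\<tau> N 0 = 0" "\<tau> N N = t" using elim(5) by (auto simp: \<tau>_def)
    define \<Delta> where "\<Delta> = (\<lambda>i. increment \<mu> \<sigma> W (\<tau> N i) (\<tau> N (Suc i)))"
    have [measurable]: "f \<in> borel_measurable borel" "\<Gamma> \<in> borel_measurable borel"
      using cont contG by (auto intro: borel_measurable_continuous_onI)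
    note [measurable] = Zm[OF \<tau>_step(2)] increment_measurable[OF \<tau>_step(2) \<tau>_step(2)]
    have int: "integrable M (\<lambda>\<omega>. f (Z (\<tau> N i) \<omega>))" "integrable M (\<lambda>\<omega>. f (Z (\<tau> N i) \<omega> + \<Delta> i \<omega>))" for i
      unfolding \<Delta>_def by (rule integrable_bounded[where b = b]; use bd in measurable)+
    have step: "(\<integral>\<omega>. f (Z (\<tau> N i) \<omega>) \<partial>M) + \<delta> * (\<integral>\<omega>. \<Gamma> (Z (\<tau> N i) \<omega>) \<partial>M)
      - \<eta> * \<sigma>\<^sup>2 * \<delta> - R * \<delta>\<^sup>2 \<le> (\<integral>\<omega>. f (Z (\<tau> N i) \<omega> + \<Delta> i \<omega>) \<partial>M)" for i
      unfolding \<Delta>_def R_def \<Gamma>_def \<tau>_step(1)[of i, symmetric]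
    proof (rule one_step_lower_bound[where G = G and q = q])
      show "\<tau> N (Suc i) - \<tau> N i \<le> 1" using \<tau>_step(1) elim(2) by (simp add: \<delta>_def)
      fix \<omega> y assume "\<omega> \<in> space M"
      then show "f (Z (\<tau> N i) \<omega>) + G (Z (\<tau> N i) \<omega>) * y + q (Z (\<tau> N i) \<omega>) * y\<^sup>2 / 2
          - \<eta> * y\<^sup>2 - C * y ^ 4 \<le> f (Z (\<tau> N i) \<omega> + y)"
        using C(2) range \<tau>_step by blast
    qed (use \<tau>_step adapted cont bd C \<eta> in auto)
    have "(\<integral>\<omega>. f (Z t \<omega>) \<partial>M) - (\<integral>\<omega>. f (Z 0 \<omega>) \<partial>M)
      = (\<Sum>i<N. (\<integral>\<omega>. f (Z (\<tau> N (Suc i)) \<omega>) \<partial>M) - (\<integral>\<omega>. f (Z (\<tau> N i) \<omega>) \<partial>M))"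
      using sum_lessThan_telescope[of "\<lambda>i. \<integral>\<omega>. f (Z (\<tau> N i) \<omega>) \<partial>M" N] \<tau>0 by simp
    also have "\<dots> \<ge> (\<Sum>i<N. (\<integral>\<omega>. f (Z (\<tau> N (Suc i)) \<omega>) - f (Z (\<tau> N i) \<omega> + \<Delta> i \<omega>) \<partial>M)
        + (\<delta> * (\<integral>\<omega>. \<Gamma> (Z (\<tau> N i) \<omega>) \<partial>M) - (\<eta> * \<sigma>\<^sup>2 * \<delta> + R * \<delta>\<^sup>2)))"
    proof (rule sum_mono)
      fix i
      have "(\<integral>\<omega>. f (Z (\<tau> N (Suc i)) \<omega>) - f (Z (\<tau> N i) \<omega> + \<Delta> i \<omega>) \<partial>M)
        = (\<integral>\<omega>. f (Z (\<tau> N (Suc i)) \<omega>) \<partial>M) - (\<integral>\<omega>. f (Z (\<tau> N i) \<omega> + \<Delta> i \<omega>) \<partial>M)"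
        using int by simp
      then show "(\<integral>\<omega>. f (Z (\<tau> N (Suc i)) \<omega>) - f (Z (\<tau> N i) \<omega> + \<Delta> i \<omega>) \<partial>M)
        + (\<delta> * (\<integral>\<omega>. \<Gamma> (Z (\<tau> N i) \<omega>) \<partial>M) - (\<eta> * \<sigma>\<^sup>2 * \<delta> + R * \<delta>\<^sup>2))
        \<le> (\<integral>\<omega>. f (Z (\<tau> N (Suc i)) \<omega>) \<partial>M) - (\<integral>\<omega>. f (Z (\<tau> N i) \<omega>) \<partial>M)"
        using step[of i] by linarith
    qed
    finally have A: "(\<Sum>i<N. \<integral>\<omega>. f (Z (\<tau> N (Suc i)) \<omega>) - f (Z (\<tau> N i) \<omega> + \<Delta> i \<omega>) \<partial>M)
        + (\<delta> * (\<Sum>i<N. \<integral>\<omega>. \<Gamma> (Z (\<tau> N i) \<omega>) \<partial>M) - real N * (\<eta> * \<sigma>\<^sup>2 * \<delta> + R * \<delta>\<^sup>2))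
      \<le> (\<integral>\<omega>. f (Z t \<omega>) \<partial>M) - (\<integral>\<omega>. f (Z 0 \<omega>) \<partial>M)"
      by (simp add: sum.distrib sum_subtractf sum_distrib_left)
    have B: "real N * (\<eta> * \<sigma>\<^sup>2 * \<delta> + R * \<delta>\<^sup>2) = \<eta> * \<sigma>\<^sup>2 * t + R * t\<^sup>2 / real N"
      using elim(5) by (simp add: \<delta>_def field_simps power2_eq_square)
    \<comment> \<open>The Taylor bound samples left endpoints, the Riemann sums right ones.\<close>
    have sum_shift: "(\<Sum>i=1..N. u i) = (\<Sum>i<N. u i) + (u N - u 0)" for u :: "nat \<Rightarrow> real"
      by (induction N) (simp_all add: lessThan_Suc)
    have Eb: "\<bar>\<integral>\<omega>. \<Gamma> (Z s \<omega>) \<partial>M\<bar> \<le> \<beta>" if "0 \<le> s" for s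
    proof -
      have "integrable M (\<lambda>\<omega>. \<Gamma> (Z s \<omega>))"
        by (rule integrable_bounded[where b = \<beta>]) (use Zm[OF that] bdG in measurable)
      then have "\<bar>\<integral>\<omega>. \<Gamma> (Z s \<omega>) \<partial>M\<bar> \<le> (\<integral>\<omega>. \<beta> \<partial>M)"
        by (intro order_trans[OF integral_abs_bound integral_mono] bdG integrable_abs) auto
      then show ?thesis by (simp add: prob_space)
    qed
    have "\<delta> * ((\<integral>\<omega>. \<Gamma> (Z (\<tau> N N) \<omega>) \<partial>M) - (\<integral>\<omega>. \<Gamma> (Z (\<tau> N 0) \<omega>) \<partial>M)) \<le> \<delta> * (2 * \<beta>)"
      using Eb[OF \<tau>_step(2), of N] Eb[OF \<tau>_step(2), of 0] t elim(5)
      by (intro mult_left_mono) (auto simp: \<delta>_def)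
    then have D: "\<delta> * (\<Sum>i=1..N. \<integral>\<omega>. \<Gamma> (Z (\<tau> N i) \<omega>) \<partial>M) - e / 4
        \<le> \<delta> * (\<Sum>i<N. \<integral>\<omega>. \<Gamma> (Z (\<tau> N i) \<omega>) \<partial>M)"
    proof -
      have "\<delta> * (2 * \<beta>) = 2 * \<beta> * t / real N" by (simp add: \<delta>_def)
      then show ?thesis
        using elim(4) \<open>_ \<le> \<delta> * (2 * \<beta>)\<close> unfolding sum_shift distrib_left by linarith
    qed
    show ?case
      using A[unfolded \<Delta>_def] B D elim(1,3) \<eta>t unfolding \<delta>_def[symmetric] by linarith
  qed
qed

end

section \<open>Costs of an arbitrary policy\<close>

text \<open>Right continuity at \<open>a\<close> gives a point \<open>c > a\<close> at which \<open>y\<close> has not yet reached \<open>y b\<close>; the last time at which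
  \<open>y\<close> takes the value \<open>y c\<close> is an increasing point.  Starting from \<open>c\<close> excludes \<open>a\<close> itself.\<close>

lemma increasing_point_between:
  assumes mono: "mono_on {0..} y" and a: "0 \<le> a" "a < b" "y a < y b"
    and rc: "continuous (at_right a) y"
    and ll: "\<And>t. 0 < t \<Longrightarrow> \<exists>l. (y \<longlongrightarrow> l) (at_left t)"
  shows "\<exists>s\<in>{a<..b}. increasing_point y s"
proof -
  have "(y \<longlongrightarrow> y a) (at_right a)" using rc by (simp add: continuous_within)
  from order_tendstoD(2)[OF this a(3)] have "eventually (\<lambda>s. y s < y b) (at_right a)" .
  then obtain c0 where c0: "a < c0" "\<And>s. a < s \<Longrightarrow> s < c0 \<Longrightarrow> y s < y b"
    unfolding eventually_at_right_field by blast
  define c where "c = (a + min b c0) / 2"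
  have c: "a < c" "c < b" "y c < y b" using c0 a(2) by (auto simp: c_def field_simps intro: c0(2))
  define P where "P = {s\<in>{c..b}. y s = y c}"
  define s where "s = Sup P"
  have "c \<in> P" using c by (simp add: P_def)
  have bdd: "bdd_above P" by (rule bdd_aboveI[of _ b]) (simp add: P_def)
  have s: "c \<le> s" "s \<le> b"
    unfolding s_def using \<open>c \<in> P\<close>
    by (rule cSup_upper[OF _ bdd], intro cSup_least) (auto simp: P_def)
  have before: "y r \<le> y c" if r: "0 \<le> r" "r < s" for r
  proof -
    obtain p where "p \<in> P" "r < p" 
      using r(2) \<open>c \<in> P\<close> less_cSup_iff[OF _ bdd, of r] unfolding s_def by blast
    then show ?thesis using mono_onD[OF mono, of r p] r by (auto simp: P_def)
  qed
  have after: "y c < y r" if "s < r" for r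
  proof (cases "r \<le> b")
    case True
    have "y c \<le> y r" using mono_onD[OF mono, of c r] that s c a by simp
    moreover have "r \<notin> P" using that cSup_upper[OF _ bdd, of r] unfolding s_def by linarith
    ultimately show ?thesis using True that s by (auto simp: P_def)
  next
    case False
    then have "y b \<le> y r" using mono_onD[OF mono, of b r] a by simp
    then show ?thesis using c by simp
  qed
  have s0: "0 < s" using s c a by linarith
  obtain l where l: "(y \<longlongrightarrow> l) (at_left s)" using ll[OF s0] by blast
  then have "left_limit y s = l" using s0 by (simp add: left_limit_def tendsto_Lim)
  moreover have "l \<le> y c"
  proof (rule tendsto_upperbound[OF l])
    show "eventually (\<lambda>r. y r \<le> y c) (at_left s)"
      unfolding eventually_at_left_field using before s0 by (intro exI[of _ 0]) auto
  qed simp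
  ultimately have "increasing_point y s"
    using after s0 by (force simp: increasing_point_def)
  then show ?thesis using s c by auto
qed

text \<open>The cells \<open>(\<tau> i, \<tau> (Suc i)]\<close> are disjoint and do not contain \<open>0\<close>, so distinct growing cells, and a
  positive initial value, account for distinct increasing points.  The left side, unlike the
  right one, is visibly measurable in the scenario.\<close>

lemma strict_increments_le_increasing_points:
  fixes y :: "real \<Rightarrow> real" and \<tau> :: "nat \<Rightarrow> real"
  assumes mono: "mono_on {0..} y"
    and rc: "\<And>t. 0 \<le> t \<Longrightarrow> continuous (at_right t) y"
    and ll: "\<And>t. 0 < t \<Longrightarrow> \<exists>l. (y \<longlongrightarrow> l) (at_left t)"
    and \<tau>: "\<tau> 0 = 0" "\<And>i. i < N \<Longrightarrow> \<tau> i < \<tau> (Suc i)" "\<tau> N = t"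
  shows "of_nat (card {i. i < N \<and> y (\<tau> i) < y (\<tau> (Suc i))} + of_bool (0 < y 0))
    \<le> emeasure (count_space UNIV) {s \<in> {0..t}. increasing_point y s}"
proof -
  define I where "I = {i. i < N \<and> y (\<tau> i) < y (\<tau> (Suc i))}"
  define P where "P = {s \<in> {0..t}. increasing_point y s}"
  have \<tau>mono: "\<tau> i \<le> \<tau> j" if "i \<le> j" "j \<le> N" for i j
    using that
  proof (induction j rule: dec_induct)
    case (step n)
    then show ?case using \<tau>(2)[of n] by simp
  qed simp
  have \<tau>0: "0 \<le> \<tau> i" if "i \<le> N" for i using \<tau>mono[of 0 i] that \<tau>(1) by simp
  have "\<exists>s. s \<in> {\<tau> i<..\<tau> (Suc i)} \<and> increasing_point y s" if "i \<in> I" for i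
  proof -
    have "i < N" "y (\<tau> i) < y (\<tau> (Suc i))" using that by (simp_all add: I_def)
    then show ?thesis
      using increasing_point_between[OF mono \<tau>0 \<tau>(2) _ rc[OF \<tau>0] ll, of i] by fastforce
  qed
  then obtain p where p: "\<And>i. i \<in> I \<Longrightarrow> p i \<in> {\<tau> i<..\<tau> (Suc i)} \<and> increasing_point y (p i)"
    by metis
  have inj: "inj_on p I"
  proof (rule inj_onI, rule ccontr)
    have *: False if "i \<in> I" "j \<in> I" "p i = p j" "i < j" for i j
    proof -
      have "j < N" using that(2) by (simp add: I_def)
      then show False using p[OF that(1)] p[OF that(2)] \<tau>mono[of "Suc i" j] that(3,4) by simp
    qed
    fix i j assume "i \<in> I" "j \<in> I" "p i = p j" "i \<noteq> j"
    then show False using *[of i j] *[of j i] by linarith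
  qed
  have ppos: "0 < p i" "p i \<le> t" if "i \<in> I" for i
  proof -
    have "i < N" using that by (simp add: I_def)
    then show "0 < p i" "p i \<le> t"
      using p[OF that] \<tau>0[of i] \<tau>mono[of "Suc i" N] \<tau>(3) by simp_all
  qed
  have zero: "increasing_point y 0" if "0 < y 0"
  proof -
    have "y 0 \<le> y s" if "0 < s" for s using mono_onD[OF mono, of 0 s] that by simp
    then show ?thesis using that by (fastforce simp: increasing_point_def left_limit_def)
  qed
  define Q where "Q = p ` I \<union> (if 0 < y 0 then {0} else {})"
  have finI: "finite I" by (simp add: I_def)
  have sub: "Q \<subseteq> P"
  proof -
    have "p i \<in> P" if "i \<in> I" for i using p[OF that] ppos[OF that] by (simp add: P_def)
    moreover have "0 \<in> P" if "0 < y 0" using zero[OF that] \<tau>0[of N] \<tau>(3) by (simp add: P_def)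
    ultimately show ?thesis by (auto simp: Q_def)
  qed
  have "card Q = card I + of_bool (0 < y 0)"
  proof (cases "0 < y 0")
    case True
    have "0 \<notin> p ` I" using ppos(1) by (metis imageE less_irrefl)
    then show ?thesis using True finI card_image[OF inj] by (simp add: Q_def)
  next
    case False
    then show ?thesis using card_image[OF inj] by (simp add: Q_def)
  qed
  moreover have "finite Q" using finI by (simp add: Q_def)
  ultimately have "of_nat (card I + of_bool (0 < y 0)) = emeasure (count_space UNIV) Q"
    by (simp add: emeasure_count_space)
  also have "\<dots> \<le> emeasure (count_space UNIV) P"
    using sub by (intro emeasure_mono) auto
  finally show ?thesis unfolding I_def P_def .
qed

definition adjustment_cost :: "real \<Rightarrow> real \<Rightarrow> real \<Rightarrow> real \<Rightarrow> real \<Rightarrow> real \<Rightarrow> real" where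
  "adjustment_cost K L k l p r = K * of_bool (0 < p) + L * of_bool (0 < r) + k * p + l * r"

text \<open>The bound \<open>c\<close> may be negative, in which case \<open>ennreal c = 0\<close>.\<close>

lemma ennreal_le_of_all_slack:
  assumes "\<And>e. 0 < e \<Longrightarrow> ennreal (c - e) \<le> v"
  shows "ennreal c \<le> v"
proof (cases v)
  case (real r)
  have "c \<le> r"
  proof (rule field_le_epsilon)
    fix e :: real assume "0 < e"
    then have "ennreal (c - e) \<le> ennreal r" using assms real by blast
    then show "c \<le> r + e" using real by (auto simp: ennreal_le_iff2)
  qed
  then show ?thesis using real by (simp add: ennreal_leI)
qed simp

context brownian_motion
begin

lemma control_process_integrable:
  assumes "control_process M F Y" "0 \<le> t" "(\<integral>\<^sup>+\<omega>. ennreal (Y t \<omega>) \<partial>M) < \<infinity>"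
  shows "integrable M (Y t)"
proof (rule integrableI_nonneg)
  show "Y t \<in> borel_measurable M"
    using assms measurable_F_M by (auto simp: control_process_def)
  show "AE \<omega> in M. 0 \<le> Y t \<omega>"
  proof (rule AE_I2)
    fix \<omega> assume "\<omega> \<in> space M"
    then have "0 \<le> Y 0 \<omega>" "mono_on {0..} (\<lambda>s. Y s \<omega>)"
      using assms(1) by (auto simp: control_process_def)
    moreover from mono_onD[OF this(2), of 0 t] have "Y 0 \<omega> \<le> Y t \<omega>" using assms(2) by simp
    ultimately have "0 \<le> Y 0 \<omega>" "Y 0 \<omega> \<le> Y t \<omega>" by blast+
    then show "0 \<le> Y t \<omega>" by simp
  qed
qed (use assms in auto)

lemma netput_continuous:
  assumes "\<omega> \<in> space M"
  shows "continuous_on {0..} (\<lambda>s. brownian_netput \<mu> \<sigma> W x s \<omega>)"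
  unfolding brownian_netput_def using continuous_W[OF assms] by (intro continuous_intros)

lemma netput_right_continuous:
  assumes "\<omega> \<in> space M" "0 \<le> s"
  shows "continuous (at_right s) (\<lambda>s. brownian_netput \<mu> \<sigma> W x s \<omega>)"
proof -
  have "continuous (at s within {0..}) (\<lambda>s. brownian_netput \<mu> \<sigma> W x s \<omega>)"
    using netput_continuous[OF assms(1)] assms(2) by (simp add: continuous_on_eq_continuous_within)
  then show ?thesis by (rule continuous_within_subset) (use assms(2) in auto)
qed

lemma netput_adapted: "0 \<le> s \<Longrightarrow> brownian_netput \<mu> \<sigma> W x s \<in> borel_measurable (F s)"
  unfolding brownian_netput_def[abs_def] using adapted_W[of s] by measurable

text \<open>Verification for an arbitrary policy whose inventory is at least \<open>e\<close>.  On each grid cell the control is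
  moved to the end of the cell, where the inventory would be \<open>Z (\<theta> i) \<omega> + \<Delta> i \<omega>\<close>.  If this is nonnegative, the two
  jump inequalities pay for the control.  Otherwise the increment exceeds \<open>e\<close> in size, and boundedness of \<open>f\<close> gives an error at most
  \<open>2 * b / e ^ 4 * \<Delta> i \<omega> ^ 4\<close>, whose sum has expectation of order \<open>1 / N\<close>.\<close>

lemma cost_lower_bound:
  fixes f G q H :: "real \<Rightarrow> real" and \<mu> \<sigma> :: real and V1 V2 :: "real \<Rightarrow> 'a \<Rightarrow> real"
  assumes t: "0 < t" and e: "0 < e" and cost: "0 \<le> K" "0 \<le> L" "0 \<le> k" "0 \<le> l" and x: "0 \<le> x"
    and V: "control_process M F V1" "control_process M F V2"
    and EV: "(\<integral>\<^sup>+\<omega>. ennreal (V1 t \<omega>) \<partial>M) < \<infinity>" "(\<integral>\<^sup>+\<omega>. ennreal (V2 t \<omega>) \<partial>M) < \<infinity>"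
    and cont: "continuous_on UNIV f" "continuous_on UNIV G" "continuous_on UNIV q" "continuous_on UNIV H"
    and bd: "\<And>x. \<bar>f x\<bar> \<le> b" "\<And>x. \<bar>G x\<bar> \<le> b" "\<And>x. \<bar>q x\<bar> \<le> b" "\<And>x. \<bar>H x\<bar> \<le> b"
    and H0: "\<And>x. 0 \<le> H x"
    and minor: "second_order_minorant {e..} f G q"
    and up: "\<And>z p. 0 \<le> z \<Longrightarrow> 0 < p \<Longrightarrow> f z - K - k * p \<le> f (z + p)"
    and down: "\<And>z p. 0 \<le> z - p \<Longrightarrow> 0 < p \<Longrightarrow> f z - L - l * p \<le> f (z - p)"
    and gen: "\<And>z. e \<le> z \<Longrightarrow> \<gamma> - H z \<le> \<mu> * G z + \<sigma>\<^sup>2 / 2 * q z"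
  defines "Z \<equiv> inventory (brownian_netput \<mu> \<sigma> W x) V1 V2"
  assumes above: "\<And>s \<omega>. 0 \<le> s \<Longrightarrow> \<omega> \<in> space M \<Longrightarrow> e \<le> Z s \<omega>"
  shows "ennreal (\<gamma> * t - 2 * b) \<le> (\<integral>\<^sup>+\<omega>. ennreal (LINT s:{0<..t}|lborel. H (Z s \<omega>))
     + ennreal K * adjustment_count V1 t \<omega> + ennreal L * adjustment_count V2 t \<omega>
     + ennreal k * ennreal (V1 t \<omega>) + ennreal l * ennreal (V2 t \<omega>) \<partial>M)" (is "_ \<le> ?cost")
proof (rule ennreal_le_of_all_slack)
  fix \<epsilon> :: real assume \<epsilon>: "0 < \<epsilon>"
  define X where "X = brownian_netput \<mu> \<sigma> W x"
  define \<tau> where "\<tau> = (\<lambda>N i. t * real i / real N)"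
  define c where "c = adjustment_cost K L k l"
  have b0: "0 \<le> b" using bd(1)[of 0] by linarith
  have Vad: "V1 s \<in> borel_measurable (F s)" "V2 s \<in> borel_measurable (F s)" if "0 \<le> s" for s
    using V that by (auto simp: control_process_def)
  have Vmono: "mono_on {0..} (\<lambda>s. V1 s \<omega>)" "mono_on {0..} (\<lambda>s. V2 s \<omega>)"
      "0 \<le> V1 0 \<omega>" "0 \<le> V2 0 \<omega>" if "\<omega> \<in> space M" for \<omega>
    using V that by (auto simp: control_process_def)
  have Vrc: "continuous (at_right s) (\<lambda>s. V1 s \<omega>)" "continuous (at_right s) (\<lambda>s. V2 s \<omega>)"
    if "\<omega> \<in> space M" "0 \<le> s" for \<omega> s
    using V that by (auto simp: control_process_def)
  have Z_def': "Z s \<omega> = X s \<omega> + V1 s \<omega> - V2 s \<omega>" for s \<omega>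
    by (simp add: Z_def X_def inventory_def)
  have Zad: "Z s \<in> borel_measurable (F s)" if "0 \<le> s" for s
    using Vad[OF that] netput_adapted[OF that] unfolding Z_def inventory_def[abs_def] by measurable
  have Zm: "Z s \<in> borel_measurable M" if "0 \<le> s" for s
    using Zad[OF that] measurable_F_M that by blast
  have Zrc: "continuous (at_right s) (\<lambda>s. Z s \<omega>)" if "0 \<le> s" "\<omega> \<in> space M" for s \<omega>
    unfolding Z_def inventory_def using Vrc netput_right_continuous that
    by (intro continuous_intros) auto
  have [measurable]: "f \<in> borel_measurable borel" "H \<in> borel_measurable borel"
    using cont by (auto intro: borel_measurable_continuous_onI)
  have jump: "f z - c p r \<le> f (z + p - r)" if "0 \<le> z" "0 \<le> p" "0 \<le> r" "0 \<le> z + p - r" for z p r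
  proof -
    have "f z - (K * of_bool (0 < p) + k * p) \<le> f (z + p)"
      using up[of z p] that by (cases "p = 0") auto
    moreover have "f (z + p) - (L * of_bool (0 < r) + l * r) \<le> f (z + p - r)"
      using down[of "z + p" r] that by (cases "r = 0") auto
    ultimately show ?thesis by (simp add: c_def adjustment_cost_def)
  qed
  have c0: "0 \<le> c p r" if "0 \<le> p" "0 \<le> r" for p r
    using that cost by (simp add: c_def adjustment_cost_def)
  note IH = time_integral_right_continuous[OF t cont(4) bd(4) Zm Zrc]
  define \<Gamma> where "\<Gamma> = (\<lambda>x. \<mu> * G x + \<sigma>\<^sup>2 / 2 * q x)"
  define \<beta> where "\<beta> = \<bar>\<mu>\<bar> * b + \<sigma>\<^sup>2 / 2 * b"
  have contG: "continuous_on UNIV \<Gamma>" unfolding \<Gamma>_def using cont by (intro continuous_intros)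
  have bdG: "\<bar>\<Gamma> x\<bar> \<le> \<beta>" for x
    unfolding \<Gamma>_def \<beta>_def by (rule generator_bounded) (rule bd)+
  note IG = time_integral_right_continuous[OF t contG bdG Zm Zrc]
  define IH where "IH = (\<lambda>\<omega>. LINT s:{0<..t}|lborel. H (Z s \<omega>))"
  define I\<Gamma> where "I\<Gamma> = (\<lambda>\<omega>. LINT s:{0<..t}|lborel. \<Gamma> (Z s \<omega>))"
  have IHm[measurable]: "IH \<in> borel_measurable M" and I\<Gamma>m[measurable]: "I\<Gamma> \<in> borel_measurable M"
    unfolding IH_def I\<Gamma>_def by (rule IH(1), assumption+, rule IG(1), assumption+)
  have IHint: "integrable M IH" and I\<Gamma>int: "integrable M I\<Gamma>"
  proof -
    show "integrable M IH"
      by (rule integrable_const_bound[where B = "b * t"]) (use IH(2) IHm in \<open>auto simp: IH_def\<close>)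
    show "integrable M I\<Gamma>"
      by (rule integrable_const_bound[where B = "\<beta> * t"]) (use IG(2) I\<Gamma>m in \<open>auto simp: I\<Gamma>_def\<close>)
  qed
  have Hset: "set_integrable lborel {0<..t} (\<lambda>s. H (Z s \<omega>))" if "\<omega> \<in> space M" for \<omega>
    using IH(3) that by blast
  have \<Gamma>set: "set_integrable lborel {0<..t} (\<lambda>s. \<Gamma> (Z s \<omega>))" if "\<omega> \<in> space M" for \<omega>
    using IG(3) that by blast
  have IH0: "0 \<le> IH \<omega>" for \<omega>
    unfolding IH_def set_lebesgue_integral_def by (intro integral_nonneg_AE) (auto simp: H0)
  have EI: "\<gamma> * t - (\<integral>\<omega>. IH \<omega> \<partial>M) \<le> (\<integral>\<omega>. I\<Gamma> \<omega> \<partial>M)"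
  proof -
    have "(\<integral>\<omega>. \<gamma> * t - IH \<omega> \<partial>M) \<le> (\<integral>\<omega>. I\<Gamma> \<omega> \<partial>M)"
    proof (rule integral_mono)
      fix \<omega> assume \<omega>: "\<omega> \<in> space M"
      have sc: "set_integrable lborel {0<..t} (\<lambda>_. \<gamma>)"
        using t by (simp add: set_integrable_def)
      have "\<gamma> * t - IH \<omega> = (LINT s:{0<..t}|lborel. \<gamma> - H (Z s \<omega>))"
        unfolding IH_def set_integral_diff(2)[OF sc Hset[OF \<omega>]]
        using t by (simp add: set_lebesgue_integral_def)
      also have "\<dots> \<le> I\<Gamma> \<omega>"
        unfolding I\<Gamma>_def
      proof (rule set_integral_mono)
        fix s assume "s \<in> {0<..t}"
        then show "\<gamma> - H (Z s \<omega>) \<le> \<Gamma> (Z s \<omega>)"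
          unfolding \<Gamma>_def using \<omega> by (intro gen above) auto
      qed (use set_integral_diff(1)[OF sc Hset[OF \<omega>]] \<Gamma>set[OF \<omega>] in auto)
      finally show "\<gamma> * t - IH \<omega> \<le> I\<Gamma> \<omega>" .
    qed (use IHint I\<Gamma>int in auto)
    then show ?thesis using IHint by (simp add: prob_space)
  qed
  define m4 where "m4 = \<mu> ^ 4 + 6 * \<mu>\<^sup>2 * \<sigma>\<^sup>2 + 3 * \<sigma> ^ 4"
  define C where "C = 2 * b / e ^ 4"
  have C0: "0 \<le> C" using b0 e by (simp add: C_def)
  have ev: "eventually (\<lambda>N. a / real N < d) sequentially" if "0 < d" for a d :: real
    using order_tendstoD(2)[OF lim_const_over_n that] .
  have "eventually (\<lambda>N. (\<integral>\<omega>. f (Z 0 \<omega>) \<partial>M) + (\<integral>\<omega>. I\<Gamma> \<omega> \<partial>M) - \<epsilon> / 2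
      + (\<Sum>i<N. \<integral>\<omega>. f (Z (\<tau> N (Suc i)) \<omega>)
          - f (Z (\<tau> N i) \<omega> + increment \<mu> \<sigma> W (\<tau> N i) (\<tau> N (Suc i)) \<omega>) \<partial>M)
      \<le> (\<integral>\<omega>. f (Z t \<omega>) \<partial>M)) sequentially"
    unfolding I\<Gamma>_def \<Gamma>_def \<tau>_def
    by (rule dynkin_lower_bound[OF t cont(1-3) bd(1-3) minor Zad _ Zrc])
      (use above \<epsilon> in auto)
  moreover have "eventually (\<lambda>N. t / real N < 1) sequentially"
    "eventually (\<lambda>N. C * m4 * t\<^sup>2 / real N < \<epsilon> / 2) sequentially"
    using ev[of 1 t] ev[of "\<epsilon> / 2" "C * m4 * t\<^sup>2"] \<epsilon> by auto
  ultimately have "eventually (\<lambda>N. 0 < N \<and> t / real N < 1 \<and> C * m4 * t\<^sup>2 / real N < \<epsilon> / 2 \<and>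
      (\<integral>\<omega>. f (Z 0 \<omega>) \<partial>M) + (\<integral>\<omega>. I\<Gamma> \<omega> \<partial>M) - \<epsilon> / 2
      + (\<Sum>i<N. \<integral>\<omega>. f (Z (\<tau> N (Suc i)) \<omega>)
          - f (Z (\<tau> N i) \<omega> + increment \<mu> \<sigma> W (\<tau> N i) (\<tau> N (Suc i)) \<omega>) \<partial>M)
      \<le> (\<integral>\<omega>. f (Z t \<omega>) \<partial>M)) sequentially"
    by (intro eventually_conj eventually_gt_at_top)
  then obtain N where N: "0 < N" "t / real N < 1" "C * m4 * t\<^sup>2 / real N < \<epsilon> / 2"
    and dyn: "(\<integral>\<omega>. f (Z 0 \<omega>) \<partial>M) + (\<integral>\<omega>. I\<Gamma> \<omega> \<partial>M) - \<epsilon> / 2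
      + (\<Sum>i<N. \<integral>\<omega>. f (Z (\<tau> N (Suc i)) \<omega>)
          - f (Z (\<tau> N i) \<omega> + increment \<mu> \<sigma> W (\<tau> N i) (\<tau> N (Suc i)) \<omega>) \<partial>M)
      \<le> (\<integral>\<omega>. f (Z t \<omega>) \<partial>M)"
    using eventually_happens'[OF sequentially_bot] by blast
  define \<theta> where "\<theta> = \<tau> N"
  have \<theta>: "\<theta> (Suc i) - \<theta> i = t / real N" "0 \<le> \<theta> i" "\<theta> i < \<theta> (Suc i)" for i
    using N(1) t by (auto simp: \<theta>_def \<tau>_def field_simps)
  have \<theta>0: "\<theta> 0 = 0" "\<theta> N = t" using N(1) by (auto simp: \<theta>_def \<tau>_def)
  have \<theta>t: "\<theta> i \<le> t" if "i \<le> N" for i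
    using that N(1) t by (simp add: \<theta>_def \<tau>_def field_simps)
  define \<Delta> where "\<Delta> = (\<lambda>i. increment \<mu> \<sigma> W (\<theta> i) (\<theta> (Suc i)))"
  define p where "p = (\<lambda>i \<omega>. V1 (\<theta> (Suc i)) \<omega> - V1 (\<theta> i) \<omega>)"
  define r where "r = (\<lambda>i \<omega>. V2 (\<theta> (Suc i)) \<omega> - V2 (\<theta> i) \<omega>)"
  have pr0: "0 \<le> p i \<omega>" "0 \<le> r i \<omega>" if "\<omega> \<in> space M" for i \<omega>
    using mono_onD[OF Vmono(1)[OF that], of "\<theta> i" "\<theta> (Suc i)"]
      mono_onD[OF Vmono(2)[OF that], of "\<theta> i" "\<theta> (Suc i)"] \<theta>(2,3)[of i] \<theta>(2)[of "Suc i"]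
    by (simp_all add: p_def r_def)
  have Zstep: "Z (\<theta> (Suc i)) \<omega> = Z (\<theta> i) \<omega> + \<Delta> i \<omega> + p i \<omega> - r i \<omega>" for i \<omega>
    by (simp add: Z_def' X_def brownian_netput_def \<Delta>_def increment_def p_def r_def algebra_simps)
  define D where "D = (\<lambda>\<omega>. c (V1 0 \<omega>) (V2 0 \<omega>) + (\<Sum>i<N. c (p i \<omega>) (r i \<omega>)))"
  have Vint: "integrable M (V1 s)" "integrable M (V2 s)" if "0 \<le> s" "s \<le> t" for s
  proof -
    have "(\<integral>\<^sup>+\<omega>. ennreal (V1 s \<omega>) \<partial>M) \<le> (\<integral>\<^sup>+\<omega>. ennreal (V1 t \<omega>) \<partial>M)"
      by (intro nn_integral_mono ennreal_leI mono_onD[OF Vmono(1)]) (use that in auto)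
    then show "integrable M (V1 s)"
      using control_process_integrable[OF V(1) that(1)] EV(1) le_less_trans by blast
    have "(\<integral>\<^sup>+\<omega>. ennreal (V2 s \<omega>) \<partial>M) \<le> (\<integral>\<^sup>+\<omega>. ennreal (V2 t \<omega>) \<partial>M)"
      by (intro nn_integral_mono ennreal_leI mono_onD[OF Vmono(2)]) (use that in auto)
    then show "integrable M (V2 s)"
      using control_process_integrable[OF V(2) that(1)] EV(2) le_less_trans by blast
  qed
  have cint: "integrable M (\<lambda>\<omega>. c (u \<omega>) (v \<omega>))" if uv: "integrable M u" "integrable M v" for u v
  proof -
    note [measurable] = borel_measurable_integrable[OF uv(1)] borel_measurable_integrable[OF uv(2)]
    have "integrable M (\<lambda>\<omega>. of_bool (0 < u \<omega>) :: real)" "integrable M (\<lambda>\<omega>. of_bool (0 < v \<omega>) :: real)"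
      by (rule integrable_bounded[where b = 1]; simp)+
    then show ?thesis unfolding c_def adjustment_cost_def using uv
      by (intro Bochner_Integration.integrable_add integrable_mult_right)
  qed
  have cpint: "integrable M (\<lambda>\<omega>. c (p i \<omega>) (r i \<omega>))" if "i < N" for i
    unfolding p_def r_def
    by (intro cint Bochner_Integration.integrable_diff Vint \<theta> \<theta>t) (use that in auto)
  have c00: "integrable M (\<lambda>\<omega>. c (V1 0 \<omega>) (V2 0 \<omega>))"
    using t by (intro cint Vint) auto
  have Dint: "integrable M D" unfolding D_def
    by (intro Bochner_Integration.integrable_add c00 Bochner_Integration.integrable_sum cpint) simp
  have fint: "integrable M (\<lambda>\<omega>. f (Z s \<omega>))" if "0 \<le> s" for s
    by (rule integrable_bounded[where b = b]) (use Zm[OF that] bd in measurable)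
  have E0: "f x - (\<integral>\<omega>. c (V1 0 \<omega>) (V2 0 \<omega>) \<partial>M) \<le> (\<integral>\<omega>. f (Z 0 \<omega>) \<partial>M)"
  proof -
    have "(\<integral>\<omega>. f x - c (V1 0 \<omega>) (V2 0 \<omega>) \<partial>M) \<le> (\<integral>\<omega>. f (Z 0 \<omega>) \<partial>M)"
    proof (rule integral_mono)
      fix \<omega> assume \<omega>: "\<omega> \<in> space M"
      have "Z 0 \<omega> = x + V1 0 \<omega> - V2 0 \<omega>"
        using W_0[OF \<omega>] by (simp add: Z_def' X_def brownian_netput_def)
      then show "f x - c (V1 0 \<omega>) (V2 0 \<omega>) \<le> f (Z 0 \<omega>)"
        using jump[OF x Vmono(3,4)[OF \<omega>]] above[OF order_refl \<omega>] e by simp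
    qed (use c00 fint in auto)
    then show ?thesis using c00 by (simp add: prob_space)
  qed
  have Estep: "- (\<integral>\<omega>. c (p i \<omega>) (r i \<omega>) \<partial>M) - C * m4 * (t / real N)\<^sup>2
      \<le> (\<integral>\<omega>. f (Z (\<theta> (Suc i)) \<omega>) - f (Z (\<theta> i) \<omega> + \<Delta> i \<omega>) \<partial>M)" if i: "i < N" for i
  proof -
    have [measurable]: "\<Delta> i \<in> borel_measurable M"
      unfolding \<Delta>_def by (intro increment_measurable \<theta>)
    have fi: "integrable M (\<lambda>\<omega>. f (Z (\<theta> i) \<omega> + \<Delta> i \<omega>))"
      by (rule integrable_bounded[where b = b]) (use Zm[OF \<theta>(2)] bd in measurable)
    have D4: "integrable M (\<lambda>\<omega>. \<Delta> i \<omega> ^ 4)" "(\<integral>\<omega>. \<Delta> i \<omega> ^ 4 \<partial>M) \<le> m4 * (t / real N)\<^sup>2"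
      unfolding \<Delta>_def m4_def \<theta>(1)[of i, symmetric]
      by (rule increment_fourth_moment_le; use \<theta>[of i] N(2) in simp)+
    have "(\<integral>\<omega>. - c (p i \<omega>) (r i \<omega>) - C * \<Delta> i \<omega> ^ 4 \<partial>M)
        \<le> (\<integral>\<omega>. f (Z (\<theta> (Suc i)) \<omega>) - f (Z (\<theta> i) \<omega> + \<Delta> i \<omega>) \<partial>M)"
    proof (rule integral_mono)
      fix \<omega> assume \<omega>: "\<omega> \<in> space M"
      have zs: "e \<le> Z (\<theta> i) \<omega>" "e \<le> Z (\<theta> (Suc i)) \<omega>" using above[OF \<theta>(2) \<omega>] by auto
      show "- c (p i \<omega>) (r i \<omega>) - C * \<Delta> i \<omega> ^ 4 \<le> f (Z (\<theta> (Suc i)) \<omega>) - f (Z (\<theta> i) \<omega> + \<Delta> i \<omega>)"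
      proof (cases "0 \<le> Z (\<theta> i) \<omega> + \<Delta> i \<omega>")
        case True
        have "0 \<le> C * \<Delta> i \<omega> ^ 4" using C0 by simp
        then show ?thesis
          using jump[OF True pr0(1)[OF \<omega>, of i] pr0(2)[OF \<omega>, of i]] zs e unfolding Zstep by linarith
      next
        case False
        then have "e \<le> \<bar>\<Delta> i \<omega>\<bar>" using zs by linarith
        then have "e ^ 4 \<le> \<bar>\<Delta> i \<omega>\<bar> ^ 4" using e by (intro power_mono) auto
        then have "C * e ^ 4 \<le> C * \<Delta> i \<omega> ^ 4" using C0 by (intro mult_left_mono) (auto simp: power_even_abs)
        moreover have "C * e ^ 4 = 2 * b" using e by (simp add: C_def)
        ultimately show ?thesis
          using bd(1)[of "Z (\<theta> (Suc i)) \<omega>"] bd(1)[of "Z (\<theta> i) \<omega> + \<Delta> i \<omega>"]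
            c0[OF pr0(1)[OF \<omega>, of i] pr0(2)[OF \<omega>, of i]] by linarith
      qed
    qed (use cpint[OF i] D4 fi fint[OF \<theta>(2)] in auto)
    moreover have "C * (\<integral>\<omega>. \<Delta> i \<omega> ^ 4 \<partial>M) \<le> C * m4 * (t / real N)\<^sup>2"
      using mult_left_mono[OF D4(2) C0] by (simp add: mult.assoc)
    ultimately show ?thesis using cpint[OF i] D4 by simp
  qed
  have "(\<Sum>i<N. - (\<integral>\<omega>. c (p i \<omega>) (r i \<omega>) \<partial>M) - C * m4 * (t / real N)\<^sup>2)
      \<le> (\<Sum>i<N. \<integral>\<omega>. f (Z (\<theta> (Suc i)) \<omega>) - f (Z (\<theta> i) \<omega> + \<Delta> i \<omega>) \<partial>M)"
    by (rule sum_mono) (use Estep in auto)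
  moreover have "(\<Sum>i<N. - (\<integral>\<omega>. c (p i \<omega>) (r i \<omega>) \<partial>M) - C * m4 * (t / real N)\<^sup>2)
      = - (\<Sum>i<N. \<integral>\<omega>. c (p i \<omega>) (r i \<omega>) \<partial>M) - C * m4 * t\<^sup>2 / real N"
    using N(1) by (simp add: sum_subtractf sum_negf power2_eq_square)
  moreover have "(\<integral>\<omega>. D \<omega> \<partial>M) = (\<integral>\<omega>. c (V1 0 \<omega>) (V2 0 \<omega>) \<partial>M) + (\<Sum>i<N. \<integral>\<omega>. c (p i \<omega>) (r i \<omega>) \<partial>M)"
    unfolding D_def using cpint
    by (subst Bochner_Integration.integral_add[OF c00 Bochner_Integration.integrable_sum])
      (simp_all add: Bochner_Integration.integral_sum)
  moreover have "(\<integral>\<omega>. f (Z t \<omega>) \<partial>M) \<le> b"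
  proof -
    have "(\<integral>\<omega>. f (Z t \<omega>) \<partial>M) \<le> (\<integral>\<omega>. b \<partial>M)"
      using t by (intro integral_mono fint) (use bd(1) abs_le_D1 in auto)
    then show ?thesis by (simp add: prob_space)
  qed
  moreover have "- b \<le> f x" using bd(1)[of x] by linarith
  ultimately have "\<gamma> * t - 2 * b - \<epsilon> \<le> (\<integral>\<omega>. IH \<omega> \<partial>M) + (\<integral>\<omega>. D \<omega> \<partial>M)"
    using dyn[folded \<theta>_def, folded \<Delta>_def] EI E0 N(3) unfolding \<Delta>_def by linarith
  also have "\<dots> = (\<integral>\<omega>. IH \<omega> + D \<omega> \<partial>M)" using IHint Dint by simp
  finally have "ennreal (\<gamma> * t - 2 * b - \<epsilon>) \<le> ennreal (\<integral>\<omega>. IH \<omega> + D \<omega> \<partial>M)"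
    by (rule ennreal_leI)
  also have "\<dots> = (\<integral>\<^sup>+\<omega>. ennreal (IH \<omega> + D \<omega>) \<partial>M)"
  proof (rule nn_integral_eq_integral[symmetric])
    show "AE \<omega> in M. 0 \<le> IH \<omega> + D \<omega>"
      unfolding D_def using IH0 pr0 Vmono c0 by (intro AE_I2 add_nonneg_nonneg sum_nonneg) auto
  qed (use IHint Dint in auto)
  also have "\<dots> \<le> ?cost"
  proof (rule nn_integral_mono)
    fix \<omega> assume \<omega>: "\<omega> \<in> space M"
    define n1 where "n1 = card {i. i < N \<and> V1 (\<theta> i) \<omega> < V1 (\<theta> (Suc i)) \<omega>} + of_bool (0 < V1 0 \<omega>)"
    define n2 where "n2 = card {i. i < N \<and> V2 (\<theta> i) \<omega> < V2 (\<theta> (Suc i)) \<omega>} + of_bool (0 < V2 0 \<omega>)"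
    have cnt: "of_nat n1 \<le> adjustment_count V1 t \<omega>" "of_nat n2 \<le> adjustment_count V2 t \<omega>"
      unfolding n1_def n2_def adjustment_count_def
      using V \<omega> Vmono[OF \<omega>] \<theta> \<theta>0
      by (intro strict_increments_le_increasing_points; auto simp: control_process_def)+
    have card: "(\<Sum>i<N. of_bool (Q i) :: real) = real (card {i. i < N \<and> Q i})" for Q
    proof -
      have "{..<N} \<inter> {i. Q i} = {i. i < N \<and> Q i}" by auto
      then show ?thesis by (simp add: sum_of_bool_eq)
    qed
    have tele: "(\<Sum>i<N. p i \<omega>) = V1 t \<omega> - V1 0 \<omega>" "(\<Sum>i<N. r i \<omega>) = V2 t \<omega> - V2 0 \<omega>"
      using sum_lessThan_telescope[of "\<lambda>i. V1 (\<theta> i) \<omega>" N] sum_lessThan_telescope[of "\<lambda>i. V2 (\<theta> i) \<omega>" N] \<theta>0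
      by (simp_all add: p_def r_def)
    have cards: "(\<Sum>i<N. of_bool (0 < p i \<omega>)) = real (card {i. i < N \<and> V1 (\<theta> i) \<omega> < V1 (\<theta> (Suc i)) \<omega>})"
      "(\<Sum>i<N. of_bool (0 < r i \<omega>)) = real (card {i. i < N \<and> V2 (\<theta> i) \<omega> < V2 (\<theta> (Suc i)) \<omega>})"
      unfolding card p_def r_def by simp_all
    have "(\<Sum>i<N. c (p i \<omega>) (r i \<omega>)) = K * (\<Sum>i<N. of_bool (0 < p i \<omega>))
        + L * (\<Sum>i<N. of_bool (0 < r i \<omega>)) + k * (\<Sum>i<N. p i \<omega>) + l * (\<Sum>i<N. r i \<omega>)"
      unfolding c_def adjustment_cost_def by (simp only: sum.distrib sum_distrib_left)
    then have "D \<omega> = K * real n1 + L * real n2 + k * V1 t \<omega> + l * V2 t \<omega>"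
      unfolding D_def cards tele n1_def n2_def of_nat_add c_def adjustment_cost_def
      by (simp add: algebra_simps)
    moreover have nn: "0 \<le> V1 t \<omega>" "0 \<le> V2 t \<omega>"
      using Vmono(3,4)[OF \<omega>] t mono_onD[OF Vmono(1)[OF \<omega>], of 0 t]
        mono_onD[OF Vmono(2)[OF \<omega>], of 0 t] by simp_all
    moreover have "0 \<le> K * real n1" "0 \<le> L * real n2" "0 \<le> k * V1 t \<omega>" "0 \<le> l * V2 t \<omega>"
      using nn cost by simp_all
    ultimately have "ennreal (IH \<omega> + D \<omega>) = ennreal (IH \<omega>) + ennreal K * of_nat n1
        + ennreal L * of_nat n2 + ennreal k * ennreal (V1 t \<omega>) + ennreal l * ennreal (V2 t \<omega>)"
      using IH0[of \<omega>] cost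
      by (simp add: ennreal_plus ennreal_mult' ennreal_of_nat_eq_real_of_nat add.assoc)
    also have "\<dots> \<le> ennreal (LINT s:{0<..t}|lborel. H (Z s \<omega>))
     + ennreal K * adjustment_count V1 t \<omega> + ennreal L * adjustment_count V2 t \<omega>
     + ennreal k * ennreal (V1 t \<omega>) + ennreal l * ennreal (V2 t \<omega>)"
      using cnt unfolding IH_def by (intro add_mono mult_left_mono order_refl) auto
    finally show "ennreal (IH \<omega> + D \<omega>) \<le> ennreal (LINT s:{0<..t}|lborel. H (Z s \<omega>))
     + ennreal K * adjustment_count V1 t \<omega> + ennreal L * adjustment_count V2 t \<omega>
     + ennreal k * ennreal (V1 t \<omega>) + ennreal l * ennreal (V2 t \<omega>)" .
  qed
  finally show "ennreal (\<gamma> * t - 2 * b - \<epsilon>) \<le> ?cost" .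
qed

end

section \<open>Antiderivatives, clamped functions and gluing\<close>

lemma real_antiderivative_exists:
  fixes f :: "real \<Rightarrow> real"
  assumes "continuous_on UNIV f"
  shows "\<exists>F. \<forall>x. (F has_real_derivative f x) (at x)"
proof -
  have "\<exists>F. \<forall>x::real. - \<infinity> < ereal x \<longrightarrow> ereal x < \<infinity> \<longrightarrow> (F has_vector_derivative f x) (at x)"
    by (rule einterval_antiderivative) (use assms in \<open>auto simp: continuous_on_eq_continuous_at\<close>)
  then show ?thesis by (auto simp: has_real_derivative_iff_has_vector_derivative)
qed

lemma continuous_on_UNIV_if_DERIV:
  fixes f :: "real \<Rightarrow> real"
  assumes "\<And>x. (f has_real_derivative f' x) (at x)"
  shows "continuous_on UNIV f"
  by (rule continuous_at_imp_continuous_on) (use DERIV_isCont[OF assms] in simp)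

text \<open>A continuous function that is constant on both sides of a compact interval.\<close>

lemma clamped_bounded_uniformly_continuous:
  fixes \<phi> :: "real \<Rightarrow> real"
  assumes le: "lo \<le> hi" and cont: "continuous_on UNIV \<phi>"
    and clamp: "\<And>x. \<phi> x = \<phi> (max lo (min x hi))"
  shows "\<exists>b. \<forall>x. \<bar>\<phi> x\<bar> \<le> b" and "uniformly_continuous_on UNIV \<phi>"
proof -
  have c: "continuous_on {lo..hi} \<phi>" by (rule continuous_on_subset[OF cont subset_UNIV])
  have "bounded (\<phi> ` {lo..hi})"
    by (rule compact_imp_bounded[OF compact_continuous_image[OF c compact_Icc]])
  then obtain b where "\<forall>y\<in>\<phi> ` {lo..hi}. norm y \<le> b" unfolding bounded_iff by (rule exE)
  then have b: "\<bar>\<phi> x\<bar> \<le> b" if "x \<in> {lo..hi}" for x using that by simp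
  have "\<bar>\<phi> x\<bar> \<le> b" for x
    using b[of "max lo (min x hi)"] le unfolding clamp[of x, symmetric] by simp
  then show "\<exists>b. \<forall>x. \<bar>\<phi> x\<bar> \<le> b" by blast
  have u: "uniformly_continuous_on {lo..hi} \<phi>" by (rule compact_uniformly_continuous[OF c compact_Icc])
  show "uniformly_continuous_on UNIV \<phi>"
    unfolding uniformly_continuous_on_def
  proof (intro allI impI)
    fix e :: real assume "0 < e"
    then obtain r where r: "0 < r" "\<And>x y. x \<in> {lo..hi} \<Longrightarrow> y \<in> {lo..hi} \<Longrightarrow> dist y x < r \<Longrightarrow> dist (\<phi> y) (\<phi> x) < e"
      using u unfolding uniformly_continuous_on_def by meson
    have "dist (\<phi> y) (\<phi> x) < e" if "dist y x < r" for x y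
    proof -
      have "dist (max lo (min y hi)) (max lo (min x hi)) < r"
        using that unfolding dist_real_def by linarith
      then have "dist (\<phi> (max lo (min y hi))) (\<phi> (max lo (min x hi))) < e"
        using le by (intro r(2)) simp_all
      then show ?thesis unfolding clamp[symmetric] .
    qed
    then show "\<exists>d>0. \<forall>x\<in>UNIV. \<forall>x'\<in>UNIV. dist x' x < d \<longrightarrow> dist (\<phi> x') (\<phi> x) < e"
      using r(1) by blast
  qed
qed

lemma uniformly_continuous_on_mult_bounded:
  fixes f g :: "real \<Rightarrow> real"
  assumes f: "uniformly_continuous_on UNIV f" and g: "uniformly_continuous_on UNIV g"
    and b: "\<And>x. \<bar>f x\<bar> \<le> b" "\<And>x. \<bar>g x\<bar> \<le> b"
  shows "uniformly_continuous_on UNIV (\<lambda>x. f x * g x)"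
  unfolding uniformly_continuous_on_def
proof (intro allI impI)
  fix e :: real assume e: "0 < e"
  have b0: "0 \<le> b" using b(1)[of 0] by linarith
  define c where "c = e / (2 * (b + 1))"
  have c: "0 < c" using e b0 by (simp add: c_def)
  obtain r1 where r1: "0 < r1" "\<And>x y. dist y x < r1 \<Longrightarrow> dist (f y) (f x) < c"
    using f c unfolding uniformly_continuous_on_def by (meson UNIV_I)
  obtain r2 where r2: "0 < r2" "\<And>x y. dist y x < r2 \<Longrightarrow> dist (g y) (g x) < c"
    using g c unfolding uniformly_continuous_on_def by (meson UNIV_I)
  have "dist (f y * g y) (f x * g x) < e" if "dist y x < min r1 r2" for x y
  proof -
    have "f y * g y - f x * g x = f y * (g y - g x) + (f y - f x) * g x" by (simp add: algebra_simps)
    then have "\<bar>f y * g y - f x * g x\<bar> \<le> \<bar>f y\<bar> * \<bar>g y - g x\<bar> + \<bar>f y - f x\<bar> * \<bar>g x\<bar>"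
      by (metis abs_mult abs_triangle_ineq)
    also have "\<dots> \<le> b * c + c * b"
      using b c b0 r1(2)[of y x] r2(2)[of y x] that
      by (intro add_mono mult_mono) (auto simp: dist_real_def less_imp_le)
    also have "\<dots> < (b + 1) * c + c * (b + 1)" using c by (simp add: algebra_simps)
    also have "\<dots> = c * (2 * (b + 1))" by (simp add: algebra_simps)
    also have "\<dots> = e" using b0 by (simp add: c_def)
    finally show ?thesis by (simp add: dist_real_def)
  qed
  then show "\<exists>d>0. \<forall>x\<in>UNIV. \<forall>x'\<in>UNIV. dist x' x < d \<longrightarrow> dist (f x' * g x') (f x * g x) < e"
    using r1(1) r2(1) by (intro exI[of _ "min r1 r2"]) auto
qed

lemma nondecreasing_glue:
  fixes f :: "real \<Rightarrow> real"
  assumes "\<And>x y. lo \<le> x \<Longrightarrow> x \<le> y \<Longrightarrow> y \<le> p \<Longrightarrow> f x \<le> f y"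
    and "\<And>x y. p \<le> x \<Longrightarrow> x \<le> y \<Longrightarrow> y \<le> hi \<Longrightarrow> f x \<le> f y"
    and "lo \<le> x" "x \<le> y" "y \<le> hi"
  shows "f x \<le> f y"
  using assms(1)[of x y] assms(2)[of x y] assms(1)[of x p] assms(2)[of p y] assms(3-)
  by (cases "y \<le> p"; cases "p \<le> x") auto

lemma DERIV_If_le:
  fixes f1 f2 :: "real \<Rightarrow> real"
  assumes "\<And>x. (f1 has_real_derivative g1 x) (at x)" "\<And>x. (f2 has_real_derivative g2 x) (at x)"
    and "f1 p = f2 p" "g1 p = g2 p"
  shows "((\<lambda>x. if x \<le> p then f1 x else f2 x) has_real_derivative (if x \<le> p then g1 x else g2 x)) (at x)"
proof -
  have "((\<lambda>x. if x \<in> {..p} then f1 x else f2 x) has_vector_derivative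
      (if x \<in> {..p} then g1 x else g2 x)) (at x within UNIV)"
    by (rule has_vector_derivative_If_within_closures[where T = "{p<..}"])
      (use assms in \<open>auto simp: has_real_derivative_iff_has_vector_derivative[symmetric]
        intro: has_field_derivative_at_within\<close>)
  then show ?thesis by (simp add: has_real_derivative_iff_has_vector_derivative)
qed

lemma antimono_on_imp_deriv_nonpos:
  fixes f :: "real \<Rightarrow> real"
  assumes "antimono_on {a<..<b} f" "(f has_real_derivative D) (at x)" "a < x" "x < b"
  shows "D \<le> 0"
proof -
  have "mono_on {a<..<b} (\<lambda>x. - f x)"
    using assms(1) by (auto simp: monotone_on_def)
  moreover have "((\<lambda>x. - f x) has_real_derivative - D) (at x)"
    using assms(2) by (rule DERIV_minus)
  ultimately have "0 \<le> - D"
    by (rule mono_on_imp_deriv_nonneg) (use assms in \<open>simp add: interior_open\<close>)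
  then show ?thesis by simp
qed

section \<open>The free-boundary function\<close>

locale free_boundary =
  fixes \<mu> \<sigma> K L k l a :: real and h :: "real \<Rightarrow> real" and d D U u A B :: real
  assumes pos: "0 < \<mu>" "0 < \<sigma>" "0 < K" "0 < L" "0 < k" "0 < l"
    and hc: "holding_cost h a"
    and bc: "band_conditions (g_fun \<mu> \<sigma> h a A B) a K L k l d D U u"
begin

text \<open>The values of \<open>h\<close> at negative arguments are arbitrary; this extension makes everything below differentiable on
  the whole line, so that one-sided derivatives at \<open>0\<close> need not be discussed.\<close>

definition H0 :: "real \<Rightarrow> real" where "H0 x = h (max 0 x)"

lemma H0_nonneg: "0 \<le> H0 x"
  using hc by (auto simp: holding_cost_def H0_def)

lemma H0_continuous: "continuous_on UNIV H0"
proof -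
  have "continuous_on UNIV (h \<circ> max 0)"
    by (rule continuous_on_compose)
      (use hc in \<open>auto simp: holding_cost_def intro!: continuous_intros intro: continuous_on_subset\<close>)
  then show ?thesis by (simp add: H0_def[abs_def] comp_def)
qed

lemma a_nonneg: "0 \<le> a" and h_a: "h a = 0"
  using hc by (auto simp: holding_cost_def)

lemma holding_cost_derivative:
  obtains h' where "\<And>x. 0 < x \<Longrightarrow> x \<noteq> a \<Longrightarrow> (h has_real_derivative h' x) (at x)"
    "\<And>x. 0 \<le> x \<Longrightarrow> x < a \<Longrightarrow> h' x < 0" "\<And>x. a < x \<Longrightarrow> 0 < h' x"
proof -
  obtain h' where h': "\<And>x. 0 \<le> x \<Longrightarrow> x \<noteq> a \<Longrightarrow> (h has_real_derivative h' x) (at x within {0..})"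
    "\<And>x. 0 \<le> x \<Longrightarrow> x < a \<Longrightarrow> h' x < 0" "\<And>x. a < x \<Longrightarrow> 0 < h' x"
    using hc unfolding holding_cost_def by auto
  have "(h has_real_derivative h' x) (at x)" if "0 < x" "x \<noteq> a" for x
    using h'(1)[of x] that at_within_interior[of x "{0..}"] by simp
  then show ?thesis using that h' by blast
qed

lemma h_continuous: "continuous_on {0..} h"
  using hc by (simp add: holding_cost_def)

lemma h_decreasing: "0 \<le> x \<Longrightarrow> x \<le> y \<Longrightarrow> y \<le> a \<Longrightarrow> h y \<le> h x"
proof -
  assume xy: "0 \<le> x" "x \<le> y" "y \<le> a"
  obtain h' where h': "\<And>x. 0 < x \<Longrightarrow> x \<noteq> a \<Longrightarrow> (h has_real_derivative h' x) (at x)"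
    "\<And>x. 0 \<le> x \<Longrightarrow> x < a \<Longrightarrow> h' x < 0" "\<And>x. a < x \<Longrightarrow> 0 < h' x"
    by (rule holding_cost_derivative) blast
  show ?thesis
  proof (rule DERIV_nonpos_imp_decreasing_open[OF xy(2)])
    fix w assume "x < w" "w < y"
    then show "\<exists>y. (h has_real_derivative y) (at w) \<and> y \<le> 0"
      using h'(1)[of w] h'(2)[of w] xy by (intro exI[of _ "h' w"]) auto
  next
    show "continuous_on {x..y} h"
      by (rule continuous_on_subset[OF h_continuous]) (use xy in auto)
  qed
qed

lemma h_strictly_increasing: "a \<le> x \<Longrightarrow> x < y \<Longrightarrow> h x < h y"
proof -
  assume xy: "a \<le> x" "x < y"
  obtain h' where h': "\<And>x. 0 < x \<Longrightarrow> x \<noteq> a \<Longrightarrow> (h has_real_derivative h' x) (at x)"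
    "\<And>x. 0 \<le> x \<Longrightarrow> x < a \<Longrightarrow> h' x < 0" "\<And>x. a < x \<Longrightarrow> 0 < h' x"
    by (rule holding_cost_derivative) blast
  show ?thesis
  proof (rule DERIV_pos_imp_increasing_open[OF xy(2)])
    fix w assume "x < w" "w < y"
    then show "\<exists>y. (h has_real_derivative y) (at w) \<and> 0 < y"
      using h'(1)[of w] h'(3)[of w] xy a_nonneg by (intro exI[of _ "h' w"]) auto
  next
    show "continuous_on {x..y} h"
      by (rule continuous_on_subset[OF h_continuous]) (use xy a_nonneg in auto)
  qed
qed

lemma h_increasing: "a \<le> x \<Longrightarrow> x \<le> y \<Longrightarrow> h x \<le> h y"
  using h_strictly_increasing[of x y] by (cases "x = y") auto

text \<open>A convex function lies above its chord, continued beyond the points \<open>a\<close> and \<open>a + 1\<close>, where it has the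
  values \<open>0\<close> and \<open>h (a + 1) > 0\<close>.\<close>

lemma h_unbounded: "\<exists>R>c. v \<le> h R"
proof -
  have h1: "0 < h (a + 1)" using h_strictly_increasing[of a "a + 1"] h_a by simp
  define R where "R = max (c + 1) (a + 1 + \<bar>v\<bar> / h (a + 1))"
  have "a + 1 + \<bar>v\<bar> / h (a + 1) \<le> R" "0 \<le> \<bar>v\<bar> / h (a + 1)" using h1 by (simp_all add: R_def)
  then have Ra: "1 \<le> R - a" "\<bar>v\<bar> / h (a + 1) \<le> R - a" by linarith+
  define s where "s = 1 / (R - a)"
  have s: "0 \<le> s" "s \<le> 1" "s * (R - a) = 1" using Ra by (auto simp: s_def)
  have "convex_on {0..} h" using hc by (simp add: holding_cost_def)
  from convex_onD[OF this s(1,2), of a R]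
  have "h ((1 - s) *\<^sub>R a + s *\<^sub>R R) \<le> (1 - s) * h a + s * h R"
    using a_nonneg Ra by simp
  moreover have "(1 - s) *\<^sub>R a + s *\<^sub>R R = a + s * (R - a)" by (simp add: algebra_simps)
  ultimately have "h (a + 1) \<le> s * h R" using s(3) h_a by simp
  then have "(R - a) * h (a + 1) \<le> (R - a) * (s * h R)" using Ra by (intro mult_left_mono) auto
  also have "\<dots> = h R" using s(3) by (metis mult.assoc mult.commute mult.left_neutral)
  finally have "(R - a) * h (a + 1) \<le> h R" .
  moreover have "\<bar>v\<bar> \<le> (R - a) * h (a + 1)" using Ra(2) h1 by (simp add: pos_divide_le_eq)
  moreover have "c < R" by (simp add: R_def less_max_iff_disj)
  ultimately show ?thesis by (intro exI[of _ R]) auto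
qed

definition \<gamma> :: real where "\<gamma> = \<mu> * A"

text \<open>The slope that a function \<open>G\<close> must have for \<open>\<sigma>\<^sup>2 / 2 * G' + \<mu> * G + \<eta> = \<gamma>\<close> to hold.\<close>

definition slope :: "(real \<Rightarrow> real) \<Rightarrow> (real \<Rightarrow> real) \<Rightarrow> real \<Rightarrow> real" where
  "slope \<eta> G x = 2 / \<sigma>\<^sup>2 * (\<gamma> - \<eta> x - \<mu> * G x)"

lemma generator_slope: "\<mu> * G x + \<sigma>\<^sup>2 / 2 * slope \<eta> G x = \<gamma> - \<eta> x"
  using pos by (simp add: slope_def field_simps)

text \<open>The defining formula of \<open>g_fun\<close> is the variation-of-constants solution of a linear first-order
  differential equation.\<close>

lemma g_extension:
  "\<exists>g. (\<forall>x. (g has_real_derivative slope H0 g x) (at x)) \<and> (\<forall>x\<ge>0. g x = g_fun \<mu> \<sigma> h a A B x)"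
proof -
  define r where "r = 2 * \<mu> / \<sigma>\<^sup>2"
  define c where "c = r / \<mu>"
  have "continuous_on UNIV (\<lambda>y. H0 y * exp (r * y))"
    using H0_continuous by (intro continuous_intros)
  then obtain P where P: "\<And>x. (P has_real_derivative H0 x * exp (r * x)) (at x)"
    using real_antiderivative_exists by blast
  define g where "g = (\<lambda>x. A - B * exp (- r * (x - a)) - c * (exp (- r * x) * (P x - P a)))"
  have "(g has_real_derivative slope H0 g x) (at x)" for x
  proof -
    have der: "(g has_real_derivative (r * (B * exp (- r * (x - a)))
        - c * (exp (- r * x) * (H0 x * exp (r * x)) + (- r * exp (- r * x)) * (P x - P a)))) (at x)"
      unfolding g_def by (auto intro!: derivative_eq_intros P simp: algebra_simps)
    have e1: "exp (- r * x) * (H0 x * exp (r * x)) = H0 x"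
    proof -
      have "exp (- r * x) * exp (r * x) = 1" by (simp flip: exp_add)
      then show ?thesis by (metis mult.assoc mult.commute mult.right_neutral)
    qed
    have e2: "r * (B * exp (- r * (x - a))) - c * (H0 x + (- r * exp (- r * x)) * (P x - P a))
       = - r * (g x - A) - c * H0 x"
    proof -
      define E1 E2 where "E1 = exp (- r * (x - a))" and "E2 = exp (- r * x) * (P x - P a)"
      have "g x = A - B * E1 - c * E2" by (simp add: g_def E1_def E2_def)
      then show ?thesis unfolding E1_def[symmetric] mult.assoc E2_def[symmetric] by algebra
    qed
    have e3: "- r * (g x - A) - c * H0 x = slope H0 g x"
    proof -
      have "c = 2 / \<sigma>\<^sup>2" "r = 2 / \<sigma>\<^sup>2 * \<mu>" using pos by (simp_all add: r_def c_def)
      then show ?thesis unfolding slope_def \<gamma>_def by algebra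
    qed
    show ?thesis using der unfolding e1 e2 e3 .
  qed
  moreover have "g x = g_fun \<mu> \<sigma> h a A B x" if x: "0 \<le> x" for x
  proof -
    have "(LBINT y=a..x. h y * exp (- r * (x - y))) = exp (- r * x) * P x - exp (- r * x) * P a"
    proof (rule interval_integral_FTC_finite)
      show "continuous_on {min a x..max a x} (\<lambda>y. h y * exp (- r * (x - y)))"
        using x a_nonneg by (intro continuous_intros continuous_on_subset[OF h_continuous]) auto
      fix y assume "min a x \<le> y" "y \<le> max a x"
      then have "h y = H0 y" using x a_nonneg by (auto simp: H0_def)
      moreover have "((\<lambda>y. exp (- r * x) * P y) has_real_derivative exp (- r * x) * (H0 y * exp (r * y))) (at y)"
        by (intro DERIV_cmult P)
      moreover have "exp (- r * x) * (H0 y * exp (r * y)) = H0 y * exp (- r * (x - y))"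
        by (simp add: algebra_simps exp_diff exp_minus divide_inverse)
      ultimately have "((\<lambda>y. exp (- r * x) * P y) has_real_derivative h y * exp (- r * (x - y))) (at y)"
        by (simp only:)
      then show "((\<lambda>y. exp (- r * x) * P y) has_vector_derivative h y * exp (- r * (x - y)))
          (at y within {min a x..max a x})"
        by (simp add: has_real_derivative_iff_has_vector_derivative has_vector_derivative_at_within)
    qed
    then have I: "(LBINT y=a..x. h y * exp (- r * (x - y))) = exp (- r * x) * (P x - P a)"
      by (simp only: right_diff_distrib)
    show ?thesis
      unfolding g_def g_fun_def Let_def r_def[symmetric] c_def[symmetric] I ..
  qed
  ultimately show ?thesis by blast
qed

definition g :: "real \<Rightarrow> real" where
  "g = (SOME g. (\<forall>x. (g has_real_derivative slope H0 g x) (at x)) \<and> (\<forall>x\<ge>0. g x = g_fun \<mu> \<sigma> h a A B x))"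

abbreviation g' :: "real \<Rightarrow> real" where "g' \<equiv> slope H0 g"

lemma g_DERIV: "(g has_real_derivative g' x) (at x)"
  and g_eq: "0 \<le> x \<Longrightarrow> g_fun \<mu> \<sigma> h a A B x = g x"
  using someI_ex[OF g_extension, folded g_def] by auto

lemma g_continuous: "continuous_on UNIV g"
  using g_DERIV by (rule continuous_on_UNIV_if_DERIV)

lemma g'_continuous: "continuous_on UNIV g'"
  unfolding slope_def[abs_def] using g_continuous H0_continuous by (intro continuous_intros)

definition g_prim :: "real \<Rightarrow> real" where "g_prim = (SOME g_prim. \<forall>x. (g_prim has_real_derivative g x) (at x))"

lemma g_prim_DERIV: "(g_prim has_real_derivative g x) (at x)"
  using someI_ex[OF real_antiderivative_exists[OF g_continuous], folded g_prim_def] by auto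

lemma order: "0 \<le> d" "d < D" "D < U" "U < u"
  using bc by (auto simp: band_conditions_def)

lemma LBINT_g: "0 \<le> x \<Longrightarrow> x \<le> y \<Longrightarrow> (LBINT s=x..y. g_fun \<mu> \<sigma> h a A B s + c) = g_prim y - g_prim x + c * (y - x)"
proof -
  assume xy: "0 \<le> x" "x \<le> y"
  have "(LBINT s=x..y. g_fun \<mu> \<sigma> h a A B s + c) = (g_prim y + c * y) - (g_prim x + c * x)"
  proof (rule interval_integral_FTC_finite)
    have "continuous_on {min x y..max x y} (\<lambda>s. g s + c)"
      by (intro continuous_intros continuous_on_subset[OF g_continuous]) auto
    then show "continuous_on {min x y..max x y} (\<lambda>s. g_fun \<mu> \<sigma> h a A B s + c)"
      by (rule continuous_on_eq) (use xy g_eq in auto)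
    fix s assume "min x y \<le> s" "s \<le> max x y"
    then have "g_fun \<mu> \<sigma> h a A B s = g s" using xy g_eq by auto
    moreover have "((\<lambda>s. g_prim s + c * s) has_real_derivative g s + c) (at s)"
      by (auto intro!: derivative_eq_intros g_prim_DERIV)
    ultimately show "((\<lambda>s. g_prim s + c * s) has_vector_derivative g_fun \<mu> \<sigma> h a A B s + c) (at s within {min x y..max x y})"
      by (simp add: has_real_derivative_iff_has_vector_derivative has_vector_derivative_at_within)
  qed
  then show ?thesis by (simp add: algebra_simps)
qed

text \<open>The sign pattern of \<open>g + k\<close> and \<open>g - l\<close> on \<open>[d, u]\<close>.  The one point that needs an argument is
  \<open>x1 \<le> D\<close>, and \<open>d < x1\<close> if \<open>d > 0\<close>: in the opposite cases monotonicity would give \<open>g \<ge> -k\<close> on \<open>[d, D]\<close>, against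
  the first integral condition.\<close>

lemma shape:
  shows "g d \<le> - k" and "0 < d \<Longrightarrow> g d = - k \<and> g' d \<le> 0 \<and> d \<le> a"
    and "\<And>x. d \<le> x \<Longrightarrow> x \<le> D \<Longrightarrow> g x \<le> - k"
    and "\<And>x. D \<le> x \<Longrightarrow> x \<le> u \<Longrightarrow> - k \<le> g x"
    and "\<And>x. d \<le> x \<Longrightarrow> x \<le> U \<Longrightarrow> g x \<le> l"
    and "\<And>x. U \<le> x \<Longrightarrow> x \<le> u \<Longrightarrow> l \<le> g x"
    and "g u = l" and "g' u \<le> 0" and "a < u"
    and "g_prim D - g_prim d + k * (D - d) = - K" and "g_prim u - g_prim U - l * (u - U) = L"
proof -
  obtain \<alpha> x1 x2 where \<alpha>: "0 \<le> \<alpha>" "\<alpha> * d = 0" and x12: "0 \<le> x1" "x1 \<le> a" "a < x2" "U < x2" "x2 < u"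
    and m1: "antimono_on {0<..<x1} (g_fun \<mu> \<sigma> h a A B)"
    and m2: "mono_on {x1<..<x2} (g_fun \<mu> \<sigma> h a A B)"
    and m3: "antimono_on {x2<..} (g_fun \<mu> \<sigma> h a A B)"
    and I1: "(LBINT x=d..D. g_fun \<mu> \<sigma> h a A B x + k) = - K"
    and I2: "(LBINT x=U..u. g_fun \<mu> \<sigma> h a A B x - l) = L"
    and vals: "g_fun \<mu> \<sigma> h a A B d = - k - \<alpha>" "g_fun \<mu> \<sigma> h a A B D = - k"
      "g_fun \<mu> \<sigma> h a A B U = l" "g_fun \<mu> \<sigma> h a A B u = l"
    using bc unfolding band_conditions_def by blast
  have v: "g d = - k - \<alpha>" "g D = - k" "g U = l" "g u = l"
    using vals order g_eq by auto
  show F1: "g_prim D - g_prim d + k * (D - d) = - K"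
    using I1 LBINT_g[of d D k] order by simp
  show "g_prim u - g_prim U - l * (u - U) = L"
    using I2 LBINT_g[of U u "- l"] order by simp
  have n1: "g' x \<le> 0" if "0 < x" "x < x1" for x
  proof (rule antimono_on_imp_deriv_nonpos[OF _ g_DERIV that])
    show "antimono_on {0<..<x1} g" using m1 by (auto simp: monotone_on_def g_eq)
  qed
  have n2: "0 \<le> g' x" if "x1 < x" "x < x2" for x
  proof (rule mono_on_imp_deriv_nonneg[OF _ g_DERIV])
    show "mono_on {x1<..<x2} g" using m2 x12 by (auto simp: monotone_on_def g_eq)
  qed (use that in \<open>simp add: interior_open\<close>)
  have n3: "g' x \<le> 0" if "x2 < x" for x
  proof (rule antimono_on_imp_deriv_nonpos[OF _ g_DERIV that, of "x + 1"])
    show "antimono_on {x2<..<x + 1} g" using m3 x12 a_nonneg by (auto simp: monotone_on_def g_eq)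
  qed simp
  have g1: "g y \<le> g x" if xy: "0 \<le> x" "x \<le> y" "y \<le> x1" for x y
  proof (rule DERIV_nonpos_imp_decreasing_open[OF xy(2)])
    fix w assume "x < w" "w < y"
    then show "\<exists>y. (g has_real_derivative y) (at w) \<and> y \<le> 0"
      using g_DERIV[of w] n1[of w] xy by (intro exI[of _ "g' w"]) simp
  qed (rule continuous_on_subset[OF g_continuous subset_UNIV])
  have g2: "g x \<le> g y" if xy: "x1 \<le> x" "x \<le> y" "y \<le> x2" for x y
  proof (rule DERIV_nonneg_imp_increasing_open[OF xy(2)])
    fix w assume "x < w" "w < y"
    then show "\<exists>y. (g has_real_derivative y) (at w) \<and> 0 \<le> y"
      using g_DERIV[of w] n2[of w] xy by (intro exI[of _ "g' w"]) simp
  qed (rule continuous_on_subset[OF g_continuous subset_UNIV])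
  have g3: "g y \<le> g x" if xy: "x2 \<le> x" "x \<le> y" for x y
  proof (rule DERIV_nonpos_imp_decreasing_open[OF xy(2)])
    fix w assume "x < w" "w < y"
    then show "\<exists>y. (g has_real_derivative y) (at w) \<and> y \<le> 0"
      using g_DERIV[of w] n3[of w] xy by (intro exI[of _ "g' w"]) simp
  qed (rule continuous_on_subset[OF g_continuous subset_UNIV])
  have notconst: "\<not> (\<forall>x\<in>{d..D}. g x \<ge> - k)"
  proof
    assume *: "\<forall>x\<in>{d..D}. g x \<ge> - k"
    have "g_prim d + k * d \<le> g_prim D + k * D"
    proof (rule DERIV_nonneg_imp_nondecreasing[where f = "\<lambda>x. g_prim x + k * x"])
      show "d \<le> D" using order by simp
      fix x assume "d \<le> x" "x \<le> D"
      then have "- k \<le> g x" using * by simp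
      then have "0 \<le> g x + k" by linarith
      moreover have "((\<lambda>x. g_prim x + k * x) has_real_derivative g x + k) (at x)"
        by (auto intro!: derivative_eq_intros g_prim_DERIV)
      ultimately show "\<exists>y. ((\<lambda>x. g_prim x + k * x) has_real_derivative y) (at x) \<and> 0 \<le> y" by blast
    qed
    then show False using F1 pos by (simp add: algebra_simps)
  qed
  have Dx1: "x1 \<le> D"
  proof (rule ccontr)
    assume "\<not> x1 \<le> D"
    then have "g D \<le> g x" if "x \<in> {d..D}" for x using g1[of x D] that order by auto
    then show False using notconst v by simp
  qed
  show "g d \<le> - k" using v \<alpha> by simp
  show "g d = - k \<and> g' d \<le> 0 \<and> d \<le> a" if d: "0 < d"
  proof -
    have \<alpha>0: "\<alpha> = 0" using \<alpha> d by simp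
    have "d < x1"
    proof (rule ccontr)
      assume "\<not> d < x1"
      then have "g d \<le> g x" if "x \<in> {d..D}" for x using g2[of d x] that order x12 by auto
      then show False using notconst v \<alpha>0 by simp
    qed
    then show ?thesis using v \<alpha>0 n1[OF d] x12 by simp
  qed
  show b: "g x \<le> - k" if "d \<le> x" "x \<le> D" for x
    using g1[of d x] g2[of x D] that v \<alpha> order x12 by (cases "x \<le> x1") auto
  show "- k \<le> g x" if "D \<le> x" "x \<le> u" for x
    using g2[of D x] g3[of x u] that v Dx1 pos by (cases "x \<le> x2") auto
  show "g x \<le> l" if "d \<le> x" "x \<le> U" for x
    using g2[of x U] b[of x] that v Dx1 pos x12 by (cases "x \<le> D") auto
  show "l \<le> g x" if "U \<le> x" "x \<le> u" for x
    using g2[of U x] g3[of x u] that v Dx1 order by (cases "x \<le> x2") auto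
  show "g u = l" by (fact v)
  show "g' u \<le> 0" using n3 x12 by simp
  show "a < u" using x12 by simp
qed

section \<open>The two test functions\<close>

text \<open>Outside \<open>[d, u]\<close> the antiderivative of \<open>g\<close> is continued from the nearest endpoint \<open>c x\<close> by a combination of
  \<open>sin\<close> and \<open>1 - cos\<close> of the distance \<open>s x = x - c x\<close>.  These have Taylor expansions \<open>s\<close> and \<open>s\<^sup>2 / 2\<close> up to
  second order at \<open>0\<close>, so the continuation is of class \<open>C\<^sup>2\<close>, and it is bounded with its derivatives.\<close>

lemma upper_test_function:
  obtains f G q b where
    "\<And>x. (f has_real_derivative G x) (at x)" "\<And>x. (G has_real_derivative q x) (at x)"
    "uniformly_continuous_on UNIV q"
    "\<And>x. \<bar>f x\<bar> \<le> b" "\<And>x. \<bar>G x\<bar> \<le> b" "\<And>x. \<bar>q x\<bar> \<le> b"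
    "\<And>x. d \<le> x \<Longrightarrow> x \<le> u \<Longrightarrow> \<mu> * G x + \<sigma>\<^sup>2 / 2 * q x = \<gamma> - h x"
    "f D - f d = - (K + k * (D - d))" "f U - f u = - (L + l * (u - U))"
proof -
  define c where "c = (\<lambda>x. max d (min x u))"
  define s where "s = (\<lambda>x. x - c x)"
  define f where "f = (\<lambda>x. g_prim (c x) + g (c x) * sin (s x) + g' (c x) * (1 - cos (s x)))"
  define G where "G = (\<lambda>x. g (c x) * cos (s x) + g' (c x) * sin (s x))"
  define q where "q = (\<lambda>x. g' (c x) * cos (s x) - g (c x) * sin (s x))"
  have du: "d \<le> u" using order by simp
  define f1 where "f1 = (\<lambda>p x. g_prim p + g p * sin (x - p) + g' p * (1 - cos (x - p)))"
  define G1 where "G1 = (\<lambda>p x. g p * cos (x - p) + g' p * sin (x - p))"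
  define q1 where "q1 = (\<lambda>p x. g' p * cos (x - p) - g p * sin (x - p))"
  have df1: "(f1 p has_real_derivative G1 p x) (at x)" and dG1: "(G1 p has_real_derivative q1 p x) (at x)" for p x
    unfolding f1_def G1_def q1_def by (auto intro!: derivative_eq_intros)
  have at_p: "f1 p p = g_prim p" "G1 p p = g p" "q1 p p = g' p" for p
    by (simp_all add: f1_def G1_def q1_def)
  have split: "\<Phi> (c x) x = (if x \<le> u then (if x \<le> d then \<Phi> d x else \<Phi> x x) else \<Phi> u x)" for \<Phi> :: "real \<Rightarrow> real \<Rightarrow> real" and x
    using du by (auto simp: c_def max_def min_def)
  have f_eq: "f = (\<lambda>x. if x \<le> u then (if x \<le> d then f1 d x else g_prim x) else f1 u x)"
    using split[of f1] by (auto simp: fun_eq_iff f_def f1_def s_def)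
  have G_eq: "G = (\<lambda>x. if x \<le> u then (if x \<le> d then G1 d x else g x) else G1 u x)"
    using split[of G1] by (auto simp: fun_eq_iff G_def G1_def s_def)
  have q_eq: "q = (\<lambda>x. if x \<le> u then (if x \<le> d then q1 d x else g' x) else q1 u x)"
    using split[of q1] by (auto simp: fun_eq_iff q_def q1_def s_def)
  have "(f has_real_derivative G x) (at x)" for x
    unfolding f_eq G_eq
    by (intro DERIV_If_le df1 g_prim_DERIV) (use du at_p in auto)
  moreover have "(G has_real_derivative q x) (at x)" for x
    unfolding q_eq G_eq
    by (intro DERIV_If_le dG1 g_DERIV) (use du at_p in auto)
  moreover
  have cc: "c (c x) = c x" "continuous_on UNIV c" for x
    unfolding c_def using du by (linarith, intro continuous_intros)
  have bu: "(\<exists>b. \<forall>x. \<bar>\<phi> (c x)\<bar> \<le> b) \<and> uniformly_continuous_on UNIV (\<lambda>x. \<phi> (c x))"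
    if "continuous_on UNIV \<phi>" for \<phi> :: "real \<Rightarrow> real"
  proof -
    have "continuous_on UNIV (\<lambda>x. \<phi> (c x))"
      by (rule continuous_on_compose2[OF that cc(2)]) simp
    then show ?thesis
      using clamped_bounded_uniformly_continuous[OF du, of "\<lambda>x. \<phi> (c x)"] cc(1)
      by (simp add: c_def)
  qed
  obtain bF where bF: "\<And>x. \<bar>g_prim (c x)\<bar> \<le> bF"
    using bu[OF continuous_on_UNIV_if_DERIV[OF g_prim_DERIV]] by blast
  obtain bg where bg: "\<And>x. \<bar>g (c x)\<bar> \<le> bg" and ug: "uniformly_continuous_on UNIV (\<lambda>x. g (c x))"
    using bu[OF g_continuous] by blast
  obtain bg' where bg': "\<And>x. \<bar>g' (c x)\<bar> \<le> bg'" and ug': "uniformly_continuous_on UNIV (\<lambda>x. g' (c x))"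
    using bu[OF g'_continuous] by blast
  define b where "b = \<bar>bF\<bar> + \<bar>bg\<bar> + 2 * \<bar>bg'\<bar> + 1"
  have trig: "\<bar>y * sin z\<bar> \<le> \<bar>y\<bar>" "\<bar>y * cos z\<bar> \<le> \<bar>y\<bar>" "\<bar>y * (1 - cos z)\<bar> \<le> 2 * \<bar>y\<bar>" for y z :: real
  proof -
    show "\<bar>y * sin z\<bar> \<le> \<bar>y\<bar>" "\<bar>y * cos z\<bar> \<le> \<bar>y\<bar>"
      using abs_sin_le_one[of z] abs_cos_le_one[of z] by (simp_all add: abs_mult mult_left_le)
    have "\<bar>1 - cos z\<bar> \<le> 2" using abs_cos_le_one[of z] by linarith
    then show "\<bar>y * (1 - cos z)\<bar> \<le> 2 * \<bar>y\<bar>"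
      using mult_left_mono[of "\<bar>1 - cos z\<bar>" 2 "\<bar>y\<bar>"] by (simp add: abs_mult mult.commute)
  qed
  have "\<bar>f x\<bar> \<le> b" for x
    using trig(1)[of "g (c x)" "s x"] trig(3)[of "g' (c x)" "s x"] bF[of x] bg[of x] bg'[of x]
    unfolding f_def b_def by linarith
  moreover have "\<bar>G x\<bar> \<le> b" for x
    using trig(2)[of "g (c x)" "s x"] trig(1)[of "g' (c x)" "s x"] bF[of x] bg[of x] bg'[of x]
    unfolding G_def b_def by linarith
  moreover have "\<bar>q x\<bar> \<le> b" for x
    using trig(1)[of "g (c x)" "s x"] trig(2)[of "g' (c x)" "s x"] bF[of x] bg[of x] bg'[of x]
    unfolding q_def b_def by linarith
  moreover have "uniformly_continuous_on UNIV q"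
  proof -
    have lip: "uniformly_continuous_on UNIV \<phi>" if "\<And>x y. \<bar>\<phi> x - \<phi> y\<bar> \<le> \<bar>x - y\<bar>" for \<phi> :: "real \<Rightarrow> real"
      unfolding uniformly_continuous_on_def dist_real_def using that le_less_trans by blast
    have sl: "\<bar>s x - s y\<bar> \<le> \<bar>x - y\<bar>" for x y
      unfolding s_def c_def by linarith
    have sinl: "\<bar>sin x - sin y\<bar> \<le> \<bar>x - y\<bar>" for x y :: real
    proof -
      have "\<bar>sin x - sin y\<bar> \<le> 2 * \<bar>sin ((x - y) / 2)\<bar>"
        unfolding sin_diff_sin using trig(2)[of "2 * sin ((x - y) / 2)" "(x + y) / 2"] by (simp add: abs_mult)
      also have "\<dots> \<le> \<bar>x - y\<bar>" using abs_sin_x_le_abs_x[of "(x - y) / 2"] by simp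
      finally show ?thesis .
    qed
    have cosl: "\<bar>cos x - cos y\<bar> \<le> \<bar>x - y\<bar>" for x y :: real
      using sinl[of "pi / 2 - x" "pi / 2 - y"] by (simp add: sin_diff)
    have us: "uniformly_continuous_on UNIV (\<lambda>x. sin (s x))" "uniformly_continuous_on UNIV (\<lambda>x. cos (s x))"
      by (rule lip; use sinl cosl sl order_trans in blast)+
    have "\<bar>sin (s x)\<bar> \<le> b" "\<bar>cos (s x)\<bar> \<le> b" "\<bar>g (c x)\<bar> \<le> b" "\<bar>g' (c x)\<bar> \<le> b" for x
      using abs_sin_le_one[of "s x"] abs_cos_le_one[of "s x"] bg[of x] bg'[of x] unfolding b_def by linarith+
    then show ?thesis
      unfolding q_def
      by (intro uniformly_continuous_on_diff uniformly_continuous_on_mult_bounded[where b = b] ug ug' us)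
  qed
  moreover have "\<mu> * G x + \<sigma>\<^sup>2 / 2 * q x = \<gamma> - h x" if "d \<le> x" "x \<le> u" for x
  proof -
    have "G x = g x" "q x = g' x" using that by (auto simp: G_def q_def s_def c_def)
    moreover have "H0 x = h x" using that order by (simp add: H0_def)
    ultimately show ?thesis using generator_slope[of g x H0] by simp
  qed
  moreover have "f x = g_prim x" if "d \<le> x" "x \<le> u" for x
    using that by (auto simp: f_def s_def c_def)
  then have "f D - f d = - (K + k * (D - d))" "f U - f u = - (L + l * (u - U))"
    using order shape(10,11) by auto
  ultimately show ?thesis using that by blast
qed

text \<open>The derivative \<open>G\<close> of \<open>f\<close> is \<open>g\<close> stopped outside \<open>[d, u]\<close>, minus a ramp of height \<open>l\<close> that starts at a point \<open>R\<close> where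
  \<open>h R \<ge> \<bar>\<gamma>\<bar> + \<sigma>\<^sup>2 / 2\<close>; there the holding cost pays for the slope \<open>-1\<close> of the ramp.  The holding cost
  is cut off at \<open>R\<close> as well, which makes \<open>H\<close> and \<open>q\<close> bounded and uniformly continuous.\<close>

lemma lower_test_function:
  obtains f G q H b where
    "continuous_on UNIV f" "continuous_on UNIV G" "continuous_on UNIV q" "continuous_on UNIV H"
    "uniformly_continuous_on UNIV H"
    "\<And>x. \<bar>f x\<bar> \<le> b" "\<And>x. \<bar>G x\<bar> \<le> b" "\<And>x. \<bar>q x\<bar> \<le> b" "\<And>x. \<bar>H x\<bar> \<le> b"
    "\<And>x. 0 \<le> H x" "\<And>x. 0 \<le> x \<Longrightarrow> H x \<le> h x"
    "\<And>e. 0 < e \<Longrightarrow> second_order_minorant {e..} f G q"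
    "\<And>z p. 0 \<le> z \<Longrightarrow> 0 < p \<Longrightarrow> f z - K - k * p \<le> f (z + p)"
    "\<And>z p. 0 \<le> z - p \<Longrightarrow> 0 < p \<Longrightarrow> f z - L - l * p \<le> f (z - p)"
    "\<And>z. \<gamma> - H z \<le> \<mu> * G z + \<sigma>\<^sup>2 / 2 * q z"
proof -
  obtain R where R: "u < R" "\<bar>\<gamma>\<bar> + \<sigma>\<^sup>2 / 2 \<le> h R" using h_unbounded by blast
  note shp = shape
  have aR: "a < R" using R shp(9) by simp
  have R0: "0 \<le> R" using order R by simp
  define H where "H = (\<lambda>x. h (max 0 (min x R)))"
  define G where "G = (\<lambda>x. g (max d (min x u)) - max 0 (min l (x - R)))"
  define q where "q = slope H G"
  have contH: "continuous_on UNIV H"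
    unfolding H_def by (rule continuous_on_compose2[OF h_continuous]) (auto intro!: continuous_intros)
  have contG: "continuous_on UNIV G"
    unfolding G_def
    by (intro continuous_intros continuous_on_compose2[OF g_continuous]) auto
  have contq: "continuous_on UNIV q"
    unfolding q_def slope_def[abs_def] using contG contH by (intro continuous_intros)
  define R' where "R' = R + l"
  have R'0: "0 \<le> R'" using R0 pos by (simp add: R'_def)
  have clampH: "H x = H (max 0 (min x R'))" for x
    using R0 pos by (auto simp: H_def R'_def max_def min_def)
  have clampG: "G x = G (max 0 (min x R'))" for x
  proof -
    have e1: "max d (min x u) = max d (min (max 0 (min x R')) u)" using order R pos by (auto simp: R'_def)
    have e2: "max 0 (min l (x - R)) = max 0 (min l (max 0 (min x R') - R))"
      using R0 pos by (auto simp: R'_def)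
    show ?thesis unfolding G_def by (rule arg_cong2[where f = "\<lambda>a b. g a - b", OF e1 e2])
  qed
  have clampq: "q x = q (max 0 (min x R'))" for x
    unfolding q_def slope_def
    by (rule arg_cong2[where f = "\<lambda>a b. 2 / \<sigma>\<^sup>2 * (\<gamma> - a - \<mu> * b)", OF clampH clampG])
  note bH = clamped_bounded_uniformly_continuous[OF R'0 contH clampH]
  note bG = clamped_bounded_uniformly_continuous[OF R'0 contG clampG]
  note bq = clamped_bounded_uniformly_continuous[OF R'0 contq clampq]
  obtain f0 where f0: "\<And>x. (f0 has_real_derivative G x) (at x)"
    using real_antiderivative_exists[OF contG] by blast
  obtain Q where Q: "\<And>x. (Q has_real_derivative q x) (at x)"
    using real_antiderivative_exists[OF contq] by blast
  define f where "f = (\<lambda>x. f0 (max 0 x))"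
  have contf: "continuous_on UNIV f"
    unfolding f_def by (rule continuous_on_compose2[OF continuous_on_UNIV_if_DERIV[OF f0]])
      (auto intro!: continuous_intros)
  have G_mid: "G x = g x" if "d \<le> x" "x \<le> u" for x
    using that R pos by (simp add: G_def)
  have G_left: "G x = g d" if "x \<le> d" for x
    using that R pos order by (simp add: G_def)
  have G_right: "G x = l - max 0 (min l (x - R))" if "u \<le> x" for x
    using that order shp(7) by (simp add: G_def)
  have incr: "\<phi> x \<le> \<phi> y" if "x \<le> y" "\<And>w. (\<phi> has_real_derivative \<phi>' w) (at w)" "\<And>w. x \<le> w \<Longrightarrow> w \<le> y \<Longrightarrow> 0 \<le> \<phi>' w"
    for \<phi> \<phi>' :: "real \<Rightarrow> real" and x y
    by (rule DERIV_nonneg_imp_nondecreasing[OF that(1)]) (use that in blast)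
  have decr: "\<phi> y \<le> \<phi> x" if "x \<le> y" "\<And>w. (\<phi> has_real_derivative \<phi>' w) (at w)" "\<And>w. x \<le> w \<Longrightarrow> w \<le> y \<Longrightarrow> \<phi>' w \<le> 0"
    for \<phi> \<phi>' :: "real \<Rightarrow> real" and x y
    by (rule DERIV_nonpos_imp_nonincreasing[OF that(1)]) (use that in blast)
  have f_far: "f x = f (max 0 (min x R'))" for x
  proof (cases "x \<le> R'")
    case False
    have G0: "G w = 0" if "R' \<le> w" for w
      using that R pos by (subst G_right) (auto simp: R'_def)
    have "f0 x \<le> f0 R'" by (rule decr[OF _ f0]) (use False G0 in auto)
    moreover have "f0 R' \<le> f0 x" by (rule incr[OF _ f0]) (use False G0 in auto)
    ultimately show ?thesis using False R'0 by (simp add: f_def)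
  qed (simp add: f_def)
  note bf = clamped_bounded_uniformly_continuous[OF R'0 contf f_far]
  have Hh: "H x \<le> h x" if "0 \<le> x" for x
    using that h_increasing[of R x] aR R0 by (cases "x \<le> R") (auto simp: H_def)
  have Hpos: "0 \<le> H x" for x
    using H0_nonneg[of "max 0 (min x R)"] by (simp add: H_def H0_def)
  have gen: "\<mu> * G z + \<sigma>\<^sup>2 / 2 * q z = \<gamma> - H z" for z
    unfolding q_def by (rule generator_slope)
  have q_le: "q x \<le> slope \<eta> \<Phi> y" if "\<eta> y \<le> H x" "\<Phi> y \<le> G x" for \<eta> \<Phi> x y
    unfolding q_def slope_def using that pos
    by (intro mult_left_mono diff_mono order_refl) auto
  \<comment> \<open>compare with \<open>d\<close> and \<open>u\<close>: \<open>h\<close> is larger below \<open>d\<close> and above \<open>u\<close> than at these points, where the slope of \<open>g\<close> is nonpositive\<close>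
  have q_left: "q x \<le> 0" if "0 \<le> x" "x \<le> d" "0 < d" for x
  proof -
    have "H0 d \<le> H x" using h_decreasing[of x d] that shp(2) order R by (simp add: H0_def H_def)
    then have "q x \<le> g' d" using G_left that by (intro q_le) auto
    then show ?thesis using shp(2) that by simp
  qed
  have q_mid: "q x = g' x" if "d \<le> x" "x \<le> u" for x
    unfolding q_def slope_def using G_mid[OF that] that order R by (simp add: H_def H0_def)
  have q_right: "q x \<le> 0" if "u \<le> x" "x \<le> R" for x
  proof -
    have "H0 u \<le> H x" using h_increasing[of u x] that shp(9) order R by (simp add: H0_def H_def)
    then have "q x \<le> g' u" using G_right[of x] that pos shp(7) by (intro q_le) auto
    then show ?thesis using shp(8) by simp
  qed
  have q_far: "q x \<le> - 1" if "R \<le> x" for x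
  proof -
    have "H x = h R" using that R0 by (simp add: H_def)
    moreover have "0 \<le> G x" using G_right[of x] that R pos by auto
    then have "0 \<le> \<mu> * G x" using pos by simp
    ultimately have "\<gamma> - H x - \<mu> * G x \<le> - \<sigma>\<^sup>2 / 2" using R(2) by linarith
    then have "2 / \<sigma>\<^sup>2 * (\<gamma> - H x - \<mu> * G x) \<le> 2 / \<sigma>\<^sup>2 * (- \<sigma>\<^sup>2 / 2)"
      by (intro mult_left_mono) auto
    then show ?thesis using pos by (simp add: q_def slope_def)
  qed
  define m where "m = (\<lambda>x. G x - Q x)"
  have m1: "m x \<le> m y" if "0 \<le> x" "x \<le> y" "y \<le> d" for x y
  proof (cases "d = 0")
    case False
    then have "0 < d" using order by simp
    then have "Q y \<le> Q x" using that q_left by (intro decr[OF _ Q]) auto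
    then show ?thesis using that G_left[of x] G_left[of y] by (simp add: m_def)
  next
    case True
    then have "x = y" using that by simp
    then show ?thesis by simp
  qed
  have m2: "m x \<le> m y" if "d \<le> x" "x \<le> y" "y \<le> u" for x y
  proof -
    have "(\<lambda>w. g w - Q w) x \<le> (\<lambda>w. g w - Q w) y"
      by (rule incr[OF that(2) DERIV_diff[OF g_DERIV Q]]) (use that q_mid in simp)
    then show ?thesis using that G_mid by (simp add: m_def)
  qed
  have m3: "m x \<le> m y" if "u \<le> x" "x \<le> y" "y \<le> R" for x y
  proof -
    have "Q y \<le> Q x" using that q_right by (intro decr[OF _ Q]) auto
    then show ?thesis using that G_right[of x] G_right[of y] pos by (simp add: m_def)
  qed
  have m4: "m x \<le> m y" if "R \<le> x" "x \<le> y" for x y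
  proof -
    have "(\<lambda>w. Q w + w) y \<le> (\<lambda>w. Q w + w) x"
    proof (rule decr[OF that(2) DERIV_add[OF Q DERIV_ident]])
      fix w assume "x \<le> w" "w \<le> y"
      then show "q w + 1 \<le> 0" using q_far[of w] that by simp
    qed
    moreover have "G x - G y \<le> y - x"
      using that R G_right[of x] G_right[of y] by (simp; linarith)
    ultimately show ?thesis by (simp add: m_def)
  qed
  have m_mono: "mono_on {0<..} m"
  proof (rule mono_onI)
    fix x y :: real assume xy: "x \<in> {0<..}" "y \<in> {0<..}" "x \<le> y"
    have du: "m x \<le> m y" if "0 \<le> x" "x \<le> y" "y \<le> u" for x y
      by (rule nondecreasing_glue[where p = d and f = m and lo = 0 and hi = u]) (use m1 m2 that in auto)
    have dR: "m x \<le> m y" if "0 \<le> x" "x \<le> y" "y \<le> R" for x y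
      by (rule nondecreasing_glue[where p = u and f = m and lo = 0 and hi = R]) (use du m3 that in auto)
    show "m x \<le> m y"
      by (rule nondecreasing_glue[where p = R and f = m and lo = 0 and hi = y]) (use dR m4 xy in auto)
  qed
  obtain b1 b2 b3 b4 where b1: "\<And>x. \<bar>f x\<bar> \<le> b1" and b2: "\<And>x. \<bar>G x\<bar> \<le> b2"
    and b3: "\<And>x. \<bar>q x\<bar> \<le> b3" and b4: "\<And>x. \<bar>H x\<bar> \<le> b4"
    using bf(1) bG(1) bq(1) bH(1) by blast
  define b where "b = max (max b1 b2) (max b3 b4)"
  have bnd: "\<bar>f x\<bar> \<le> b" "\<bar>G x\<bar> \<le> b" "\<bar>q x\<bar> \<le> b" "\<bar>H x\<bar> \<le> b" for x
    using b1[of x] b2[of x] b3[of x] b4[of x] by (auto simp: b_def)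
  have minor: "second_order_minorant {e..} f G q" if "0 < e" for e
  proof (rule second_order_minorantI[where T = "{0<..}" and e = "e / 2" and Q = Q and b = b])
    fix z w assume "z \<in> {e..}" "\<bar>w - z\<bar> \<le> e / 2"
    then show "w \<in> {0<..}" using that unfolding greaterThan_iff atLeast_iff by linarith
  next
    fix w :: real assume w: "w \<in> {0<..}"
    have "(f0 has_real_derivative G w) (at w)" by (rule f0)
    then show "(f has_real_derivative G w) (at w)"
      by (rule has_field_derivative_transform_within_open[where S = "{0<..}"])
        (use w in \<open>auto simp: f_def\<close>)
  qed (use that Q m_mono bq(2) bnd in \<open>simp_all add: m_def\<close>)
  have F_mid: "f0 y - f0 x = g_prim y - g_prim x" if "d \<le> x" "x \<le> y" "y \<le> u" for x y
  proof -
    have D: "((\<lambda>w. f0 w - g_prim w) has_real_derivative (G w - g w)) (at w)" for w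
      by (intro DERIV_diff f0 g_prim_DERIV)
    have "(\<lambda>w. f0 w - g_prim w) x \<le> (\<lambda>w. f0 w - g_prim w) y"
      by (rule incr[OF that(2) D]) (use that G_mid in auto)
    moreover have "(\<lambda>w. f0 w - g_prim w) y \<le> (\<lambda>w. f0 w - g_prim w) x"
      by (rule decr[OF that(2) D]) (use that G_mid in auto)
    ultimately show ?thesis by simp
  qed
  have up: "f z - K - k * p \<le> f (z + p)" if "0 \<le> z" "0 < p" for z p
  proof -
    define \<psi> where "\<psi> = (\<lambda>x. f0 x + k * x)"
    have d\<psi>: "(\<psi> has_real_derivative G x + k) (at x)" for x
      unfolding \<psi>_def by (auto intro!: derivative_eq_intros f0)
    have drop: "\<psi> D - \<psi> d = - K"
      using F_mid[of d D] shp(10) order by (simp add: \<psi>_def algebra_simps)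
    have up_D: "\<psi> x \<le> \<psi> y" if "D \<le> x" "x \<le> y" for x y
    proof (rule incr[OF that(2) d\<psi>])
      fix w assume "x \<le> w" "w \<le> y"
      then show "0 \<le> G w + k"
        using G_mid[of w] G_right[of w] shp(4)[of w] that order pos by (cases "w \<le> u") auto
    qed
    have down_D: "\<psi> y \<le> \<psi> x" if "d \<le> x" "x \<le> y" "y \<le> D" for x y
    proof (rule decr[OF that(2) d\<psi>])
      fix w assume "x \<le> w" "w \<le> y"
      then show "G w + k \<le> 0" using G_mid[of w] shp(3)[of w] that order by auto
    qed
    have flat: "\<psi> x = \<psi> d" if "0 \<le> x" "x \<le> d" for x
    proof (cases "d = 0")
      case False
      then have gd: "g d = - k" using order shp(2) by simp
      have "\<psi> x \<le> \<psi> d" by (rule incr[OF _ d\<psi>]) (use that G_left gd in auto)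
      moreover have "\<psi> d \<le> \<psi> x" by (rule decr[OF _ d\<psi>]) (use that G_left gd in auto)
      ultimately show ?thesis by simp
    qed (use that in simp)
    have top: "\<psi> x \<le> \<psi> d" if "0 \<le> x" "x \<le> D" for x
    proof (cases "x \<le> d")
      case True
      show ?thesis by (rule eq_refl[OF flat[OF that(1) True]])
    next
      case False
      show ?thesis by (rule down_D) (use False that in simp_all)
    qed
    have bot: "\<psi> D \<le> \<psi> x" if "0 \<le> x" for x
    proof -
      consider "x \<le> d" | "d \<le> x" "x \<le> D" | "D \<le> x" by linarith
      then show ?thesis
      proof cases
        case 1
        show ?thesis unfolding flat[OF that 1] by (rule down_D) (use order in simp_all)
      next
        case 2
        show ?thesis by (rule down_D) (use 2 in simp_all)
      next
        case 3
        show ?thesis by (rule up_D) (use 3 in simp_all)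
      qed
    qed
    have "\<psi> z - K \<le> \<psi> (z + p)"
    proof (cases "z \<le> D")
      case True
      have "\<psi> z \<le> \<psi> d" "\<psi> D \<le> \<psi> (z + p)" using True that by (auto intro!: top bot)
      then show ?thesis using drop by linarith
    next
      case False
      then have "\<psi> z \<le> \<psi> (z + p)" using that by (intro up_D) simp_all
      then show ?thesis using pos by linarith
    qed
    then show ?thesis using that by (simp add: \<psi>_def f_def algebra_simps)
  qed
  have down: "f z - L - l * p \<le> f (z - p)" if "0 \<le> z - p" "0 < p" for z p
  proof -
    define \<zeta> where "\<zeta> = (\<lambda>x. f0 x - l * x)"
    have d\<zeta>: "(\<zeta> has_real_derivative G x - l) (at x)" for x
      unfolding \<zeta>_def by (auto intro!: derivative_eq_intros f0)
    have rise: "\<zeta> u - \<zeta> U = L"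
      using F_mid[of U u] shp(11) order by (simp add: \<zeta>_def algebra_simps)
    have c1: "\<zeta> y \<le> \<zeta> x" if "0 \<le> x" "x \<le> y" "y \<le> U" for x y
    proof (rule decr[OF that(2) d\<zeta>])
      fix w assume "x \<le> w" "w \<le> y"
      then show "G w - l \<le> 0"
        using G_mid[of w] G_left[of w] shp(5)[of w] shp(1) that order pos by (cases "d \<le> w") auto
    qed
    have c2: "\<zeta> x \<le> \<zeta> y" if "U \<le> x" "x \<le> y" "y \<le> u" for x y
    proof (rule incr[OF that(2) d\<zeta>])
      fix w assume "x \<le> w" "w \<le> y"
      then show "0 \<le> G w - l" using G_mid[of w] shp(6)[of w] that order by auto
    qed
    have c3: "\<zeta> y \<le> \<zeta> x" if "u \<le> x" "x \<le> y" for x y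
    proof (rule decr[OF that(2) d\<zeta>])
      fix w assume "x \<le> w" "w \<le> y"
      then show "G w - l \<le> 0" using G_right[of w] that by auto
    qed
    have top: "\<zeta> x \<le> \<zeta> u" if "U \<le> x" for x
    proof (cases "x \<le> u")
      case True
      show ?thesis by (rule c2) (use True that in simp_all)
    next
      case False
      show ?thesis by (rule c3) (use False in simp_all)
    qed
    have bot: "\<zeta> U \<le> \<zeta> x" if "0 \<le> x" "x \<le> u" for x
    proof (cases "x \<le> U")
      case True
      show ?thesis by (rule c1) (use True that in simp_all)
    next
      case False
      show ?thesis by (rule c2) (use False that in simp_all)
    qed
    have "\<zeta> z - L \<le> \<zeta> (z - p)"
    proof (cases "z \<le> U")
      case True
      then have "\<zeta> z \<le> \<zeta> (z - p)" using that by (intro c1) simp_all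
      then show ?thesis using pos by linarith
    next
      case False
      show ?thesis
      proof (cases "z - p \<le> u")
        case True
        have "\<zeta> z \<le> \<zeta> u" "\<zeta> U \<le> \<zeta> (z - p)" using True False that by (auto intro!: top bot)
        then show ?thesis using rise by linarith
      next
        case z: False
        then have "\<zeta> z \<le> \<zeta> (z - p)" using that by (intro c3) simp_all
        then show ?thesis using pos by linarith
      qed
    qed
    then show ?thesis using that by (simp add: \<zeta>_def f_def algebra_simps)
  qed
  have gen_le: "\<gamma> - H z \<le> \<mu> * G z + \<sigma>\<^sup>2 / 2 * q z" for z by (rule eq_refl) (rule gen[symmetric])
  show ?thesis
    by (rule that[OF contf contG contq contH bH(2) bnd Hpos Hh minor up down gen_le])
qed

end

section \<open>Paths under a control band policy\<close>

text \<open>Control band policies are studied first for a single continuous path \<open>p\<close>.\<close>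

locale band_path =
  fixes d D U u :: real and p :: "real \<Rightarrow> real"
  assumes order: "d < D" "D < U" "U < u" and cont: "continuous_on {0..} p"
begin

abbreviation T :: "nat \<Rightarrow> ereal" where "T \<equiv> band_time d D U u p"
abbreviation \<xi> :: "nat \<Rightarrow> real" where "\<xi> \<equiv> band_jump d D U u p"
text \<open>The total adjustment up to and including the \<open>n\<close>-th one.\<close>

abbreviation c :: "nat \<Rightarrow> real" where "c n \<equiv> snd (snd (band_step d D U u p n))"
abbreviation rT :: "nat \<Rightarrow> real" where "rT n \<equiv> real_of_ereal (T n)"

lemma T_0: "T 0 = 0"
  and \<xi>_0: "\<xi> 0 = (if p 0 \<le> d then D - p 0 else if p 0 < u then 0 else U - p 0)"
  and c_0: "c 0 = \<xi> 0"
  by (simp_all add: band_time_def band_jump_def Let_def)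

lemma T_Suc: "T (Suc n) = Inf {ereal t | t. T n < ereal t \<and> p t + c n \<in> {d, u}}"
  by (cases "band_step d D U u p n") (simp add: band_time_def Let_def)

lemma \<xi>_Suc: "\<xi> (Suc n) = (if p (rT (Suc n)) + c n = d then D - d
    else if p (rT (Suc n)) + c n = u then U - u else 0)"
  by (cases "band_step d D U u p n") (simp add: band_time_def band_jump_def Let_def)

lemma c_Suc: "c (Suc n) = c n + \<xi> (Suc n)"
  by (cases "band_step d D U u p n") (simp add: band_jump_def Let_def)

lemma c_eq_sum: "c n = (\<Sum>i\<le>n. \<xi> i)"
  by (induction n) (simp_all only: c_0 c_Suc sum.atMost_Suc atMost_0 sum.insert finite.emptyI empty_iff
      not_False_eq_True sum.empty add_0_right)

lemma T_le_Suc: "T n \<le> T (Suc n)"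
  unfolding T_Suc by (rule Inf_greatest) (auto intro: less_imp_le)

lemma T_mono: "n \<le> m \<Longrightarrow> T n \<le> T m"
  using lift_Suc_mono_le[of T, OF T_le_Suc] .

lemma T_nonneg: "0 \<le> T n"
  using T_mono[of 0 n] by (simp add: T_0)

lemma T_real: "T n < \<infinity> \<Longrightarrow> T n = ereal (rT n)" "0 \<le> rT n"
  using T_nonneg[of n] by (cases "T n"; simp)+

text \<open>Intermediate value theorem: a continuous path leaves \<open>(d, u)\<close> only through \<open>d\<close> or \<open>u\<close>.\<close>

lemma stays_inside:
  assumes \<tau>: "0 \<le> \<tau>" "\<tau> \<le> t" and start: "d < p \<tau> + v" "p \<tau> + v < u"
    and avoid: "\<And>r. \<tau> < r \<Longrightarrow> r \<le> t \<Longrightarrow> p r + v \<noteq> d \<and> p r + v \<noteq> u"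
  shows "d < p t + v \<and> p t + v < u"
proof -
  have con: "continuous_on {\<tau>..t} (\<lambda>r. p r + v)"
    using \<tau> by (intro continuous_intros continuous_on_subset[OF cont]) auto
  have "d < p t + v"
  proof (rule ccontr)
    assume "\<not> d < p t + v"
    then obtain r where "\<tau> \<le> r" "r \<le> t" "p r + v = d"
      using IVT2'[of "\<lambda>r. p r + v" t d \<tau>] start \<tau> con by auto
    moreover from this have "r \<noteq> \<tau>" using start by auto
    ultimately show False using avoid[of r] by simp
  qed
  moreover have "p t + v < u"
  proof (rule ccontr)
    assume "\<not> p t + v < u"
    then obtain r where "\<tau> \<le> r" "r \<le> t" "p r + v = u"
      using IVT'[of "\<lambda>r. p r + v" \<tau> u t] start \<tau> con by auto
    moreover from this have "r \<noteq> \<tau>" using start by auto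
    ultimately show False using avoid[of r] by simp
  qed
  ultimately show ?thesis by simp
qed

text \<open>Since the path starts inside, the set of later times at the boundary is closed, and its infimum is
  attained and strictly later than \<open>\<tau>\<close>.\<close>

lemma exit_time:
  assumes \<tau>: "0 \<le> \<tau>" and start: "d < p \<tau> + v" "p \<tau> + v < u"
    and s: "T' = Inf {ereal t | t. ereal \<tau> < ereal t \<and> p t + v \<in> {d, u}}"
  shows "ereal \<tau> < T'"
    and "T' < \<infinity> \<Longrightarrow> p (real_of_ereal T') + v \<in> {d, u}"
    and "\<tau> \<le> t \<Longrightarrow> ereal t < T' \<Longrightarrow> d < p t + v \<and> p t + v < u"
proof -
  define S where "S = {t. \<tau> < t \<and> p t + v \<in> {d, u}}"
  have T': "T' = Inf (ereal ` S)"
    unfolding s S_def by (rule arg_cong[where f = Inf]) auto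
  have not\<tau>: "p \<tau> + v \<notin> {d, u}" using start by auto
  have S_eq: "S = {\<tau>..} \<inter> (\<lambda>t. p t + v) -` {d, u}"
  proof -
    have "\<tau> < t" if "\<tau> \<le> t" "p t + v \<in> {d, u}" for t
      using that not\<tau> by (cases "t = \<tau>") auto
    then show ?thesis by (auto simp: S_def)
  qed
  have "closed S"
    unfolding S_eq
    using \<tau> by (intro continuous_closed_preimage continuous_intros continuous_on_subset[OF cont]) auto
  have bdd: "bdd_below S" by (rule bdd_belowI[of _ \<tau>]) (simp add: S_def)
  have inf: "T' = ereal (Inf S) \<and> Inf S \<in> S" if "S \<noteq> {}"
  proof
    show in_S: "Inf S \<in> S" using closed_contains_Inf[OF that bdd \<open>closed S\<close>] .
    show "T' = ereal (Inf S)" unfolding T'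
      by (rule antisym[OF Inf_lower Inf_greatest]) (use in_S cInf_lower[OF _ bdd] in auto)
  qed
  show "ereal \<tau> < T'"
  proof (cases "S = {}")
    case True
    then show ?thesis by (simp add: T' top_ereal_def)
  next
    case False
    then show ?thesis using inf by (simp add: S_def)
  qed
  show "p (real_of_ereal T') + v \<in> {d, u}" if "T' < \<infinity>"
  proof -
    have "S \<noteq> {}" using that by (auto simp: T' top_ereal_def)
    then show ?thesis using inf by (simp add: S_def)
  qed
  show "d < p t + v \<and> p t + v < u" if t: "\<tau> \<le> t" "ereal t < T'"
  proof (rule stays_inside[OF \<tau> t(1) start])
    fix r assume r: "\<tau> < r" "r \<le> t"
    have "r \<notin> S"
    proof
      assume "r \<in> S"
      then have "T' \<le> ereal r" unfolding T' by (intro Inf_lower) simp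
      also have "\<dots> \<le> ereal t" using r by simp
      finally show False using t(2) by simp
    qed
    then show "p r + v \<noteq> d \<and> p r + v \<noteq> u" using r by (simp add: S_def)
  qed
qed

lemma start_inside: "T n < \<infinity> \<Longrightarrow> d < p (rT n) + c n \<and> p (rT n) + c n < u"
proof (induction n)
  case 0
  show ?case using order by (simp only: T_0 c_0 \<xi>_0) simp
next
  case (Suc n)
  have fin: "T n < \<infinity>" using le_less_trans[OF T_le_Suc Suc.prems] .
  have *: "T (Suc n) = Inf {ereal t | t. ereal (rT n) < ereal t \<and> p t + c n \<in> {d, u}}"
    unfolding T_Suc T_real(1)[OF fin, symmetric] ..
  have "p (rT (Suc n)) + c n \<in> {d, u}"
    using exit_time(2)[OF T_real(2) _ _ * Suc.prems] Suc.IH[OF fin] by simp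
  then show ?case unfolding c_Suc \<xi>_Suc using order by auto
qed

lemma T_finite_pred: "T (Suc n) < \<infinity> \<Longrightarrow> T n < \<infinity>"
  using le_less_trans[OF T_le_Suc] .

lemma T_Suc_real:
  "T n < \<infinity> \<Longrightarrow> T (Suc n) = Inf {ereal t | t. ereal (rT n) < ereal t \<and> p t + c n \<in> {d, u}}"
  unfolding T_Suc by (simp only: T_real(1)[symmetric])

lemma T_less_Suc: "T n < \<infinity> \<Longrightarrow> T n < T (Suc n)"
  using exit_time(1)[OF T_real(2) _ _ T_Suc_real] start_inside T_real(1) by simp

lemma hit_boundary: "T (Suc n) < \<infinity> \<Longrightarrow> p (rT (Suc n)) + c n \<in> {d, u}"
  using exit_time(2)[OF T_real(2) _ _ T_Suc_real] start_inside T_finite_pred by simp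

lemma inside_between:
  assumes "T n \<le> ereal t" "ereal t < T (Suc n)"
  shows "d < p t + c n \<and> p t + c n < u"
proof -
  have fin: "T n < \<infinity>" using assms(1) by (cases "T n") auto
  have "rT n \<le> t" using assms(1) T_real(1)[OF fin] by (metis ereal_less_eq(3))
  then show ?thesis
    using exit_time(3)[OF T_real(2) _ _ T_Suc_real[OF fin] _ assms(2)] start_inside[OF fin] by simp
qed

lemma T_le_D: "T n \<le> ereal t \<Longrightarrow> T n < \<infinity> \<and> rT n \<le> t"
  using T_nonneg[of n] by (cases "T n") auto

text \<open>From the second adjustment on, the path moves by at least \<open>min (D - d) (u - U)\<close> between consecutive
  adjustments.  By uniform continuity this takes at least a time \<open>\<delta>\<close>.\<close>

lemma finite_adjustments: "finite {n. T n \<le> ereal t}"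
proof (rule ccontr)
  assume inf: "infinite {n. T n \<le> ereal t}"
  have all: "T n \<le> ereal t" for n
  proof -
    obtain m where "n \<le> m" "T m \<le> ereal t" using inf by (auto simp: infinite_nat_iff_unbounded_le)
    then show ?thesis using T_mono order_trans by blast
  qed
  have fin: "T n < \<infinity>" "rT n \<le> t" for n using T_le_D[OF all] by auto
  \<comment> \<open>after an upward or downward adjustment the path is at \<open>D\<close> or \<open>U\<close>, at least this far from both boundaries\<close>
  define w where "w = min (D - d) (u - U)"
  have w: "0 < w" using order by (simp add: w_def)
  have "uniformly_continuous_on {0..t} p"
    by (rule compact_uniformly_continuous[OF continuous_on_subset[OF cont] compact_Icc]) auto
  then obtain \<delta> where \<delta>: "0 < \<delta>"
    "\<And>r s. r \<in> {0..t} \<Longrightarrow> s \<in> {0..t} \<Longrightarrow> dist s r < \<delta> \<Longrightarrow> dist (p s) (p r) < w"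
    using w unfolding uniformly_continuous_on_def by meson
  have gap: "rT (Suc n) + \<delta> \<le> rT (Suc (Suc n))" for n
  proof -
    have lt: "rT (Suc n) < rT (Suc (Suc n))"
      using T_less_Suc[OF fin(1), of "Suc n"] T_real(1)[OF fin(1)] by (metis ereal_less(2) less_ereal.simps(1))
    have "p (rT (Suc n)) + c (Suc n) \<in> {D, U}"
      using hit_boundary[OF fin(1), of n] order unfolding c_Suc \<xi>_Suc by auto
    moreover have "p (rT (Suc (Suc n))) + c (Suc n) \<in> {d, u}"
      using hit_boundary[OF fin(1), of "Suc n"] .
    ultimately have "w \<le> dist (p (rT (Suc (Suc n)))) (p (rT (Suc n)))"
      using order unfolding w_def dist_real_def by auto
    then have "\<not> dist (rT (Suc (Suc n))) (rT (Suc n)) < \<delta>"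
      using \<delta>(2)[of "rT (Suc n)" "rT (Suc (Suc n))"] T_real(2) fin(2) by force
    then show ?thesis using lt by (simp add: dist_real_def)
  qed
  have "real n * \<delta> \<le> rT (Suc n)" for n
  proof (induction n)
    case (Suc n)
    then show ?case using gap[of n] by (simp add: algebra_simps)
  qed (simp add: T_real(2))
  then have "real n * \<delta> \<le> t" for n using fin(2)[of "Suc n"] order_trans by blast
  moreover obtain n where "t / \<delta> < real n" using reals_Archimedean2 by blast
  ultimately show False using \<delta>(1) by (metis linorder_not_less pos_divide_less_eq)
qed

lemma times_before_eq:
  assumes "T n \<le> ereal t" "ereal t < T (Suc n)"
  shows "{i. T i \<le> ereal t} = {..n}"
proof -
  have "T i \<le> ereal t" if "i \<le> n" for i using T_mono[OF that] assms(1) order_trans by blast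
  moreover have "i \<le> n" if "T i \<le> ereal t" for i
  proof (rule ccontr)
    assume "\<not> i \<le> n"
    then have "T (Suc n) \<le> T i" by (intro T_mono) simp
    then show False using that assms(2) by simp
  qed
  ultimately show ?thesis by auto
qed

lemma last_adjustment:
  assumes "0 \<le> t"
  obtains n where "T n \<le> ereal t" "ereal t < T (Suc n)"
proof -
  define n where "n = Max {i. T i \<le> ereal t}"
  have ne: "{i. T i \<le> ereal t} \<noteq> {}" using assms T_0 by (metis (mono_tags) empty_iff ereal_less_eq(5) mem_Collect_eq)
  have "T n \<le> ereal t" using Max_in[OF finite_adjustments ne] by (simp add: n_def)
  moreover have "\<not> T (Suc n) \<le> ereal t"
    using Max_ge[OF finite_adjustments, of "Suc n" t] by (auto simp: n_def)
  ultimately show ?thesis using that by (simp add: not_le)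
qed

lemma controlled_path_inside:
  assumes "0 \<le> t"
  shows "p t + (\<Sum>i | T i \<le> ereal t. \<xi> i) \<in> {d<..<u}"
proof -
  obtain n where n: "T n \<le> ereal t" "ereal t < T (Suc n)" using last_adjustment[OF assms] .
  show ?thesis
    using inside_between[OF n] unfolding times_before_eq[OF n] c_eq_sum by simp
qed

lemma right_constant:
  assumes "0 \<le> t"
  obtains e where "0 < e" "\<And>s. t \<le> s \<Longrightarrow> s < t + e \<Longrightarrow> {i. T i \<le> ereal s} = {i. T i \<le> ereal t}"
proof -
  obtain n where n: "T n \<le> ereal t" "ereal t < T (Suc n)" using last_adjustment[OF assms] .
  obtain b where b: "ereal t < ereal b" "ereal b \<le> T (Suc n)"
    using n(2) by (metis ereal_dense2 less_imp_le)
  show ?thesis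
  proof
    show "0 < b - t" using b by simp
    fix s assume s: "t \<le> s" "s < t + (b - t)"
    have "T n \<le> ereal s" using n(1) s(1) by (metis ereal_less_eq(3) order_trans)
    moreover have "ereal s < T (Suc n)" using s(2) b(2) by (metis add.commute diff_add_cancel less_ereal.simps(1) order_less_le_trans)
    ultimately show "{i. T i \<le> ereal s} = {i. T i \<le> ereal t}"
      using times_before_eq[OF n] times_before_eq by blast
  qed
qed

lemma left_constant:
  assumes "0 < t"
  obtains s0 m where "0 \<le> s0" "s0 < t" "\<And>s. s0 \<le> s \<Longrightarrow> s < t \<Longrightarrow> {i. T i \<le> ereal s} = {..m}"
    "\<And>i. m < i \<Longrightarrow> ereal t \<le> T i"
proof -
  obtain n where n: "T n \<le> ereal t" "ereal t < T (Suc n)" using last_adjustment assms by (metis less_imp_le)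
  define m where "m = (if T n < ereal t then n else n - 1)"
  have m: "T m < ereal t" "ereal t \<le> T (Suc m)"
  proof -
    have "T m < ereal t \<and> ereal t \<le> T (Suc m)"
    proof (cases "T n < ereal t")
      case True
      then show ?thesis using n by (simp add: m_def)
    next
      case False
      then have eq: "T n = ereal t" using n by simp
      then have "n \<noteq> 0" using assms T_0 by (metis ereal_eq_0(2) less_irrefl)
      then obtain k where k: "n = Suc k" by (cases n) auto
      have "T k < T n" using T_less_Suc[of k] T_finite_pred[of k] eq k by simp
      then show ?thesis using eq k by (simp add: m_def)
    qed
    then show "T m < ereal t" "ereal t \<le> T (Suc m)" by auto
  qed
  have fin: "T m < \<infinity>" using m(1) by (cases "T m") auto
  show ?thesis
  proof
    show "0 \<le> rT m" by (rule T_real)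
    show "rT m < t" using m(1) T_real(1)[OF fin] by (metis less_ereal.simps(1))
    fix s assume s: "rT m \<le> s" "s < t"
    show "{i. T i \<le> ereal s} = {..m}"
    proof (rule times_before_eq)
      show "T m \<le> ereal s" using s(1) T_real(1)[OF fin] by (metis ereal_less_eq(3))
      show "ereal s < T (Suc m)" using s(2) m(2) by (metis less_ereal.simps(1) order_less_le_trans)
    qed
  next
    fix i assume "m < i"
    then have "T (Suc m) \<le> T i" by (intro T_mono) simp
    then show "ereal t \<le> T i" using m(2) by simp
  qed
qed

definition adjusted :: "(nat \<Rightarrow> real) \<Rightarrow> real \<Rightarrow> real" where
  "adjusted w t = (\<Sum>i | T i \<le> ereal t. w i)"

lemma adjusted_mono:
  assumes "\<And>i. 0 \<le> w i" shows "mono_on {0..} (adjusted w)"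
proof (rule mono_onI)
  fix r s :: real assume "r \<le> s"
  then have "{i. T i \<le> ereal r} \<subseteq> {i. T i \<le> ereal s}"
    by (auto intro: order_trans[of _ "ereal r"])
  then show "adjusted w r \<le> adjusted w s"
    unfolding adjusted_def using assms by (intro sum_mono2 finite_adjustments) auto
qed

lemma adjusted_right_continuous:
  assumes "0 \<le> t" shows "continuous (at_right t) (adjusted w)"
proof -
  obtain e where e: "0 < e" "\<And>s. t \<le> s \<Longrightarrow> s < t + e \<Longrightarrow> {i. T i \<le> ereal s} = {i. T i \<le> ereal t}"
    by (rule right_constant[OF assms]) blast
  have "eventually (\<lambda>s. adjusted w t = adjusted w s) (at_right t)"
    unfolding eventually_at_right_field
  proof (intro exI[of _ "t + e"] conjI allI impI)
    fix s assume "t < s" "s < t + e"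
    then show "adjusted w t = adjusted w s" using e(2)[of s] by (simp add: adjusted_def)
  qed (use e in simp)
  then show ?thesis
    unfolding continuous_within by (rule Lim_transform_eventually[OF tendsto_const])
qed

lemma adjusted_left_limit:
  assumes "0 < t"
  obtains m where "(adjusted w \<longlongrightarrow> (\<Sum>i\<le>m. w i)) (at_left t)" "\<And>i. m < i \<Longrightarrow> ereal t \<le> T i"
proof -
  obtain s0 m where m: "0 \<le> s0" "s0 < t" "\<And>s. s0 \<le> s \<Longrightarrow> s < t \<Longrightarrow> {i. T i \<le> ereal s} = {..m}"
    "\<And>i. m < i \<Longrightarrow> ereal t \<le> T i"
    by (rule left_constant[OF assms]) blast
  have "eventually (\<lambda>s. (\<Sum>i\<le>m. w i) = adjusted w s) (at_left t)"
    unfolding eventually_at_left_field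
  proof (intro exI[of _ s0] conjI allI impI)
    fix s assume "s0 < s" "s < t"
    then show "(\<Sum>i\<le>m. w i) = adjusted w s" using m(3)[of s] by (simp add: adjusted_def)
  qed (use m in simp)
  then have "(adjusted w \<longlongrightarrow> (\<Sum>i\<le>m. w i)) (at_left t)"
    by (rule Lim_transform_eventually[OF tendsto_const])
  then show ?thesis using that m(4) by blast
qed

lemma adjusted_at_0: "adjusted w 0 = w 0"
proof -
  have "T 0 \<le> ereal 0" "ereal 0 < T (Suc 0)"
    using T_less_Suc[of 0] by (simp_all add: T_0 zero_ereal_def)
  from times_before_eq[OF this] show ?thesis by (simp add: adjusted_def)
qed

text \<open>At an increasing point the function exceeds its left limit, because it is constant immediately afterwards.  For \<open>s = 0\<close> the left limit
  is \<open>0\<close> by convention, and the initial adjustment plays the role of the jump.\<close>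

lemma increasing_point_adjusted:
  assumes w: "\<And>i. 0 \<le> w i" and s: "increasing_point (adjusted w) s"
  obtains i where "T i = ereal s" "0 < w i"
proof -
  have s0: "0 \<le> s" and inc: "\<And>r. s < r \<Longrightarrow> left_limit (adjusted w) s < adjusted w r"
    using s by (auto simp: increasing_point_def)
  obtain e where e: "0 < e" "\<And>r. s \<le> r \<Longrightarrow> r < s + e \<Longrightarrow> {i. T i \<le> ereal r} = {i. T i \<le> ereal s}"
    by (rule right_constant[OF s0]) blast
  have "adjusted w (s + e / 2) = adjusted w s"
    using e(2)[of "s + e / 2"] e(1) by (simp add: adjusted_def)
  then have jump: "left_limit (adjusted w) s < adjusted w s" using inc[of "s + e / 2"] e(1) by simp
  show ?thesis
  proof (cases "s = 0")
    case True
    then show ?thesis using jump that[of 0] by (simp add: left_limit_def adjusted_at_0 T_0 zero_ereal_def)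
  next
    case False
    then have "0 < s" using s0 by simp
    obtain m where m: "(adjusted w \<longlongrightarrow> (\<Sum>i\<le>m. w i)) (at_left s)" "\<And>i. m < i \<Longrightarrow> ereal s \<le> T i"
      using adjusted_left_limit[OF \<open>0 < s\<close>, of w] by blast
    have ll: "left_limit (adjusted w) s = (\<Sum>i\<le>m. w i)"
      using False m(1) by (simp add: left_limit_def tendsto_Lim)
    have "\<exists>i. m < i \<and> T i \<le> ereal s \<and> 0 < w i"
    proof (rule ccontr)
      assume none: "\<nexists>i. m < i \<and> T i \<le> ereal s \<and> 0 < w i"
      have "adjusted w s \<le> (\<Sum>i\<in>{i. T i \<le> ereal s} \<union> {..m}. w i)"
        unfolding adjusted_def using w finite_adjustments by (intro sum_mono2) auto
      also have "\<dots> = (\<Sum>i\<le>m. w i)"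
      proof (rule sum.mono_neutral_right)
        show "\<forall>i\<in>({i. T i \<le> ereal s} \<union> {..m}) - {..m}. w i = 0"
        proof
          fix i assume "i \<in> ({i. T i \<le> ereal s} \<union> {..m}) - {..m}"
          then have "m < i" "T i \<le> ereal s" by auto
          then have "\<not> 0 < w i" using none by blast
          then show "w i = 0" using w[of i] by simp
        qed
      qed (use finite_adjustments in auto)
      finally show False using jump ll by simp
    qed
    then show ?thesis using m(2) that by (meson antisym)
  qed
qed

lemma count_adjusted_le:
  assumes w: "\<And>i. 0 \<le> w i"
  shows "emeasure (count_space UNIV) {s \<in> {0..t}. increasing_point (adjusted w) s}
    \<le> of_nat (card {i. T i \<le> ereal t \<and> 0 < w i})"
proof -
  let ?A = "{s \<in> {0..t}. increasing_point (adjusted w) s}" and ?B = "{i. T i \<le> ereal t \<and> 0 < w i}"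
  have fin: "finite ?B" using finite_adjustments by (rule finite_subset[rotated]) auto
  have sub: "?A \<subseteq> rT ` ?B"
  proof
    fix s assume s: "s \<in> ?A"
    then have "increasing_point (adjusted w) s" by simp
    with w obtain i where "T i = ereal s" "0 < w i" by (rule increasing_point_adjusted) blast
    then show "s \<in> rT ` ?B" using s by (intro image_eqI[of _ _ i]) auto
  qed
  have "emeasure (count_space UNIV) ?A \<le> emeasure (count_space UNIV) (rT ` ?B)"
    using sub by (intro emeasure_mono) auto
  also have "\<dots> = of_nat (card (rT ` ?B))" using fin by (simp add: emeasure_count_space)
  also have "\<dots> \<le> of_nat (card ?B)" using card_image_le[OF fin] by simp
  finally show ?thesis .
qed

text \<open>The total adjustment up to time \<open>t\<close> under the policy that makes no adjustment after the \<open>m\<close>-th.\<close>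

definition shift :: "nat \<Rightarrow> real \<Rightarrow> real" where
  "shift m t = (\<Sum>i\<le>m. of_bool (T i \<le> ereal t) * \<xi> i)"

lemma shift_complete: "T m \<le> ereal t \<Longrightarrow> shift m t = c m"
proof -
  assume "T m \<le> ereal t"
  then have "T i \<le> ereal t" if "i \<le> m" for i using T_mono[OF that] order_trans by blast
  then show ?thesis unfolding shift_def c_eq_sum by (intro sum.cong) auto
qed

text \<open>Adjustments happen in order, so the right side telescopes up to the last one that has happened.  In this form the time
  enters only through indicator functions.\<close>

lemma shift_expansion:
  fixes f :: "real \<Rightarrow> real"
  assumes "0 \<le> t"
  shows "f (x + shift m t) = f (x + c 0) +
    (\<Sum>i<m. of_bool (T (Suc i) \<le> ereal t) * (f (x + c (Suc i)) - f (x + c i)))"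
proof (induction m)
  case 0
  have "T 0 \<le> ereal t" using assms by (simp add: T_0)
  then show ?case by (simp only: shift_complete) simp
next
  case (Suc m)
  show ?case
  proof (cases "T (Suc m) \<le> ereal t")
    case True
    have "T m \<le> ereal t" using order_trans[OF T_le_Suc True] .
    then have "shift m t = c m" by (rule shift_complete)
    then show ?thesis using Suc True unfolding shift_complete[OF True] by (simp del: band_step.simps)
  next
    case False
    then have "shift (Suc m) t = shift m t" by (simp add: shift_def)
    then show ?thesis using Suc False by (simp del: band_step.simps)
  qed
qed

lemma shift_eventually: "T (Suc m) > ereal t \<Longrightarrow> shift m t = adjusted \<xi> t"
proof -
  assume gt: "T (Suc m) > ereal t"
  have "{i. T i \<le> ereal t} \<subseteq> {..m}"
  proof
    fix i assume i: "i \<in> {i. T i \<le> ereal t}"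
    show "i \<in> {..m}"
    proof (rule ccontr)
      assume "i \<notin> {..m}"
      then have "T (Suc m) \<le> T i" by (intro T_mono) simp
      then show False using i gt by simp
    qed
  qed
  then have "adjusted \<xi> t = (\<Sum>i\<in>{..m} \<inter> {i. T i \<le> ereal t}. \<xi> i)"
    unfolding adjusted_def by (simp add: Int_absorb1)
  also have "\<dots> = shift m t"
    unfolding shift_def sum.inter_restrict[of "{..m}" \<xi> "{i. T i \<le> ereal t}", OF finite_atMost]
    by (intro sum.cong) simp_all
  finally show ?thesis by simp
qed

lemma shift_right_continuous:
  assumes "0 \<le> t" shows "continuous (at_right t) (shift m)"
proof -
  obtain e where e: "0 < e" "\<And>s. t \<le> s \<Longrightarrow> s < t + e \<Longrightarrow> {i. T i \<le> ereal s} = {i. T i \<le> ereal t}"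
    by (rule right_constant[OF assms]) blast
  have "eventually (\<lambda>s. shift m t = shift m s) (at_right t)"
    unfolding eventually_at_right_field
  proof (intro exI[of _ "t + e"] conjI allI impI)
    fix s assume "t < s" "s < t + e"
    then have "{i. T i \<le> ereal s} = {i. T i \<le> ereal t}" by (intro e(2)) simp_all
    then have "T i \<le> ereal s \<longleftrightarrow> T i \<le> ereal t" for i by blast
    then show "shift m t = shift m s" by (simp only: shift_def)
  qed (use e in simp)
  then show ?thesis
    unfolding continuous_within by (rule Lim_transform_eventually[OF tendsto_const])
qed

end

text \<open>Among the grid cells exactly one contains \<open>s\<close>, and its right endpoint tends to \<open>s\<close>.\<close>

lemma grid_localization:
  fixes \<psi> :: "real \<Rightarrow> real" and s :: ereal
  assumes t: "0 < t" and s: "0 < s" and cont: "continuous_on {0..} \<psi>"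
  defines "\<tau> \<equiv> \<lambda>N j. t * real j / real N"
  shows "(\<lambda>N. \<Sum>j<N. (of_bool (s \<le> ereal (\<tau> N (Suc j))) - of_bool (s \<le> ereal (\<tau> N j))) * \<psi> (\<tau> N (Suc j)))
    \<longlonglongrightarrow> of_bool (s \<le> ereal t) * \<psi> (real_of_ereal s)" (is "?S \<longlonglongrightarrow> _")
proof (cases "s \<le> ereal t")
  case False
  have "?S N = 0" for N
  proof (intro sum.neutral ballI)
    fix j assume "j \<in> {..<N}"
    then have "real (Suc j) \<le> real N" "real j \<le> real N" "0 < real N" by simp_all
    then have "\<tau> N (Suc j) \<le> t" "\<tau> N j \<le> t"
      using t unfolding \<tau>_def by (simp_all only: pos_divide_le_eq mult_le_cancel_left_pos)
    then have "\<not> s \<le> ereal (\<tau> N (Suc j))" "\<not> s \<le> ereal (\<tau> N j)"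
      using False by (meson ereal_less_eq(3) order_trans)+
    then show "(of_bool (s \<le> ereal (\<tau> N (Suc j))) - of_bool (s \<le> ereal (\<tau> N j))) * \<psi> (\<tau> N (Suc j)) = 0" by simp
  qed
  then have "?S = (\<lambda>_. 0)" by (rule ext)
  then show ?thesis using False by simp
next
  case True
  then obtain r where r: "s = ereal r" using s by (cases s) auto
  have r0: "0 < r" "r \<le> t" using s True r by auto
  define k where "k = (\<lambda>N. nat \<lceil>r * real N / t\<rceil>)"
  have k: "1 \<le> k N" "k N \<le> N" "\<tau> N (k N) - t / real N < r" "r \<le> \<tau> N (k N)" if "0 < N" for N
  proof -
    have pos: "0 < r * real N / t" using that t r0 by simp
    have "r * real N / t \<le> real N" using that t r0 by (simp add: field_simps)
    then show "k N \<le> N" unfolding k_def by linarith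
    show "1 \<le> k N" using pos unfolding k_def by linarith
    have b: "real (k N) - 1 < r * real N / t" "r * real N / t \<le> real (k N)"
      using pos unfolding k_def by linarith+
    show "r \<le> \<tau> N (k N)" using b(2) t that by (simp add: \<tau>_def field_simps)
    show "\<tau> N (k N) - t / real N < r" using b(1) t that by (simp add: \<tau>_def field_simps)
  qed
  have S_eq: "?S N = \<psi> (\<tau> N (k N))" if N: "0 < N" for N
  proof -
    obtain i where i: "k N = Suc i" using k(1)[OF N] by (cases "k N") auto
    have \<tau>mono: "\<tau> N a \<le> \<tau> N b" if "a \<le> b" for a b
      unfolding \<tau>_def using that t by (intro divide_right_mono mult_left_mono) auto
    have \<tau>i: "\<tau> N i < r"
      using k(3)[OF N] N unfolding i \<tau>_def by (simp add: field_simps)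
    have low: "\<not> r \<le> \<tau> N j" if "j \<le> i" for j using \<tau>mono[OF that] \<tau>i by simp
    have high: "r \<le> \<tau> N j" if "Suc i \<le> j" for j using \<tau>mono[OF that] k(4)[OF N] i by simp
    have "?S N = (\<Sum>j\<in>{i}. (of_bool (s \<le> ereal (\<tau> N (Suc j))) - of_bool (s \<le> ereal (\<tau> N j))) * \<psi> (\<tau> N (Suc j)))"
    proof (rule sum.mono_neutral_right)
      show "{i} \<subseteq> {..<N}" using k(2)[OF N] i by simp
      show "\<forall>j\<in>{..<N} - {i}. (of_bool (s \<le> ereal (\<tau> N (Suc j))) - of_bool (s \<le> ereal (\<tau> N j))) * \<psi> (\<tau> N (Suc j)) = 0"
      proof
        fix j assume "j \<in> {..<N} - {i}"
        then consider "Suc j \<le> i" | "Suc i \<le> j" by force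
        then show "(of_bool (s \<le> ereal (\<tau> N (Suc j))) - of_bool (s \<le> ereal (\<tau> N j))) * \<psi> (\<tau> N (Suc j)) = 0"
        proof cases
          case 1
          then show ?thesis using low[of j] low[of "Suc j"] unfolding r by simp
        next
          case 2
          then show ?thesis using high[of j] high[of "Suc j"] unfolding r by simp
        qed
      qed
    qed simp
    then show ?thesis using low[of i] high[of "Suc i"] unfolding r i by simp
  qed
  have "(\<lambda>N. \<tau> N (k N)) \<longlonglongrightarrow> r"
  proof (rule tendsto_sandwich)
    show "eventually (\<lambda>N. r \<le> \<tau> N (k N)) sequentially"
      using eventually_gt_at_top[of 0] by eventually_elim (rule k(4))
    show "eventually (\<lambda>N. \<tau> N (k N) \<le> r + t / real N) sequentially"
      using eventually_gt_at_top[of 0] 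
    proof eventually_elim
      case (elim N)
      then show ?case using k(3)[of N] by linarith
    qed
    show "(\<lambda>N. r + t / real N) \<longlonglongrightarrow> r"
      using tendsto_add[OF tendsto_const lim_const_over_n, of r t] by simp
  qed simp
  moreover have "isCont \<psi> r"
  proof -
    have "continuous_on {0<..} \<psi>" using cont by (rule continuous_on_subset) auto
    then show ?thesis using r0 by (simp add: continuous_on_eq_continuous_at)
  qed
  ultimately have "(\<lambda>N. \<psi> (\<tau> N (k N))) \<longlonglongrightarrow> \<psi> r"
    by (rule isCont_tendsto_compose[rotated])
  moreover have "eventually (\<lambda>N. \<psi> (\<tau> N (k N)) = ?S N) sequentially"
    using eventually_gt_at_top[of 0] by eventually_elim (rule S_eq[symmetric])
  ultimately have "?S \<longlonglongrightarrow> \<psi> r" by (rule Lim_transform_eventually)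
  then show ?thesis using True by (simp add: r)
qed

section \<open>Adjustment times are stopping times\<close>

text \<open>The path reaches \<open>lo\<close> by time \<open>t\<close> strictly before \<open>hi\<close> if and only if, for some fixed distance
  \<open>1 / real (Suc j)\<close> from \<open>hi\<close>, it comes arbitrarily close to \<open>lo\<close> at rational times without having come closer to \<open>hi\<close> before.
  In the converse direction compactness of the time interval up to the first visit \<open>b\<close> of \<open>hi\<close> excludes that the path
  stays away from \<open>lo\<close>.\<close>

lemma hits_lower_first_iff:
  fixes p :: "real \<Rightarrow> real"
  assumes cont: "continuous_on {0..} p" and \<tau>: "0 \<le> \<tau>" and start: "lo < p \<tau>" "p \<tau> < hi"
  shows "(\<exists>s. \<tau> \<le> s \<and> s \<le> t \<and> p s = lo \<and> (\<forall>r. \<tau> \<le> r \<and> r \<le> s \<longrightarrow> p r < hi)) \<longleftrightarrow>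
    (\<exists>j::nat. \<forall>m::nat. \<exists>q::rat. \<tau> \<le> of_rat q \<and> of_rat q \<le> t \<and> p (of_rat q) \<le> lo + 1 / real (Suc m) \<and>
      (\<forall>r::rat. \<tau> \<le> of_rat r \<and> r \<le> q \<longrightarrow> p (of_rat r) \<le> hi - 1 / real (Suc j)))"
    (is "?hit \<longleftrightarrow> ?approx")
proof
  have con: "continuous_on {\<tau>..s} p" for s
    by (rule continuous_on_subset[OF cont]) (use \<tau> in auto)
  {
    assume ?hit
    then obtain s where s: "\<tau> \<le> s" "s \<le> t" "p s = lo" and below: "\<And>r. \<tau> \<le> r \<Longrightarrow> r \<le> s \<Longrightarrow> p r < hi" by blast
    have "\<tau> \<noteq> s" using s start by auto
    then have \<tau>s: "\<tau> < s" using s by simp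
    obtain x where x: "x \<in> {\<tau>..s}" "\<And>y. y \<in> {\<tau>..s} \<Longrightarrow> p y \<le> p x"
      using continuous_attains_sup[OF compact_Icc _ con[of s]] \<tau>s by (metis atLeastatMost_empty_iff2 less_imp_le)
    have "0 < hi - p x" using below[of x] x(1) by simp
    then obtain j where j: "inverse (real (Suc j)) < hi - p x" using reals_Archimedean by blast
    have "\<exists>q::rat. \<tau> \<le> of_rat q \<and> of_rat q \<le> t \<and> p (of_rat q) \<le> lo + 1 / real (Suc m) \<and>
      (\<forall>r::rat. \<tau> \<le> of_rat r \<and> r \<le> q \<longrightarrow> p (of_rat r) \<le> hi - 1 / real (Suc j))" for m
    proof -
      have "continuous (at s within {0..}) p"
        using cont \<tau> s by (simp add: continuous_on_eq_continuous_within)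
      then obtain \<delta> where \<delta>: "0 < \<delta>" "\<And>y. y \<in> {0..} \<Longrightarrow> dist y s < \<delta> \<Longrightarrow> dist (p y) (p s) < 1 / real (Suc m)"
        unfolding continuous_within_eps_delta by (metis of_nat_0_less_iff zero_less_Suc zero_less_divide_1_iff)
      have "max \<tau> (s - \<delta>) < s" using \<tau>s \<delta>(1) by simp
      then obtain q :: rat where q: "max \<tau> (s - \<delta>) < of_rat q" "of_rat q < s" using of_rat_dense by blast
      show ?thesis
      proof (intro exI[of _ q] conjI allI impI)
        show "\<tau> \<le> of_rat q" "of_rat q \<le> t" using q s by auto
        have "dist (p (of_rat q)) (p s) < 1 / real (Suc m)"
        proof (rule \<delta>(2))
          show "of_rat q \<in> {0::real..}" using q \<tau> unfolding atLeast_iff by linarith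
          show "dist (of_rat q) s < \<delta>" using q unfolding dist_real_def by linarith
        qed
        then show "p (of_rat q) \<le> lo + 1 / real (Suc m)" using s(3) unfolding dist_real_def by linarith
        fix r :: rat assume r: "\<tau> \<le> of_rat r \<and> r \<le> q"
        then have "(of_rat r :: real) \<le> of_rat q" by (simp add: of_rat_less_eq)
        then have "p (of_rat r) \<le> p x" using r q by (intro x(2)) simp
        then show "p (of_rat r) \<le> hi - 1 / real (Suc j)" using j unfolding inverse_eq_divide by linarith
      qed
    qed
    then show ?approx by blast
  }
  assume ?approx
  then obtain j :: nat where j: "\<forall>m::nat. \<exists>q::rat. \<tau> \<le> of_rat q \<and> of_rat q \<le> t \<and> p (of_rat q) \<le> lo + 1 / real (Suc m) \<and>
      (\<forall>r::rat. \<tau> \<le> of_rat r \<and> r \<le> q \<longrightarrow> p (of_rat r) \<le> hi - 1 / real (Suc j))" by blast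
  have \<tau>t: "\<tau> \<le> t" using j order_trans by blast
  define B where "B = {r\<in>{\<tau>..t}. hi \<le> p r}"
  define b where "b = (if B = {} then t else Inf B)"
  have "B = {\<tau>..t} \<inter> p -` {hi..}" by (auto simp: B_def)
  then have clB: "closed B" using continuous_closed_preimage[OF con[of t] closed_atLeastAtMost closed_atLeast] by simp
  have bddB: "bdd_below B" by (rule bdd_belowI[of _ \<tau>]) (simp add: B_def)
  have InfB: "Inf B \<in> B" if "B \<noteq> {}" using closed_contains_Inf[OF that bddB clB] .
  have b: "\<tau> \<le> b" "b \<le> t" using InfB \<tau>t by (auto simp: b_def B_def)
  have before_b: "p r < hi" if "\<tau> \<le> r" "r < b" for r
  proof (rule ccontr)
    assume "\<not> p r < hi"
    then have rB: "r \<in> B" using that b by (simp add: B_def)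
    then have "b \<le> r" using cInf_lower[OF rB bddB] by (auto simp: b_def)
    then show False using that by simp
  qed
  have hit_hi: "hi \<le> p b" if "B \<noteq> {}" using InfB[OF that] that by (simp add: b_def B_def)
  obtain x where x: "x \<in> {\<tau>..b}" "\<And>y. y \<in> {\<tau>..b} \<Longrightarrow> p x \<le> p y"
    using continuous_attains_inf[OF compact_Icc _ con[of b]] b by (metis atLeastatMost_empty_iff2)
  have "p x \<le> lo"
  proof (rule ccontr)
    assume "\<not> p x \<le> lo"
    then have "0 < p x - lo" by simp
    then obtain m where m: "inverse (real (Suc m)) < p x - lo" using reals_Archimedean by blast
    obtain q :: rat where q: "\<tau> \<le> of_rat q" "of_rat q \<le> t" "p (of_rat q) \<le> lo + 1 / real (Suc m)"
      and qr: "\<And>r::rat. \<tau> \<le> of_rat r \<Longrightarrow> r \<le> q \<Longrightarrow> p (of_rat r) \<le> hi - 1 / real (Suc j)"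
      using j by meson
    have "b < of_rat q"
    proof (rule ccontr)
      assume "\<not> b < of_rat q"
      then have "p x \<le> p (of_rat q)" using q by (intro x(2)) simp
      then show False using q(3) m unfolding inverse_eq_divide by linarith
    qed
    then have "B \<noteq> {}" using q(2) by (auto simp: b_def)
    then have hb: "hi \<le> p b" by (rule hit_hi)
    have "\<tau> \<noteq> b" using hb start by auto
    then have "\<tau> < b" using b by simp
    have "continuous (at b within {0..}) p"
      using cont \<tau> b by (simp add: continuous_on_eq_continuous_within)
    then obtain \<delta> where \<delta>: "0 < \<delta>" "\<And>y. y \<in> {0..} \<Longrightarrow> dist y b < \<delta> \<Longrightarrow> dist (p y) (p b) < 1 / real (Suc j)"
      unfolding continuous_within_eps_delta by (metis of_nat_0_less_iff zero_less_Suc zero_less_divide_1_iff)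
    have "max \<tau> (b - \<delta>) < b" using \<open>\<tau> < b\<close> \<delta>(1) by simp
    then obtain r :: rat where r: "max \<tau> (b - \<delta>) < of_rat r" "of_rat r < b" using of_rat_dense by blast
    have "dist (p (of_rat r)) (p b) < 1 / real (Suc j)"
    proof (rule \<delta>(2))
      show "of_rat r \<in> {0::real..}" using r \<tau> unfolding atLeast_iff by linarith
      show "dist (of_rat r) b < \<delta>" using r unfolding dist_real_def by linarith
    qed
    moreover have "(of_rat r :: real) < of_rat q" using r(2) \<open>b < of_rat q\<close> by (rule less_trans)
    then have "r \<le> q" by (simp add: of_rat_less)
    then have "p (of_rat r) \<le> hi - 1 / real (Suc j)" using r(1) by (intro qr) simp_all
    ultimately show False using hb unfolding dist_real_def by linarith
  qed
  then obtain s where s: "\<tau> \<le> s" "s \<le> x" "p s = lo"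
    using IVT2'[of p x lo \<tau>] start x(1) con[of x] by auto
  have "p r < hi" if r: "\<tau> \<le> r" "r \<le> s" for r
  proof (cases "r < b")
    case True
    then show ?thesis using before_b r by blast
  next
    case False
    then have "r = s" using r s x(1) by simp
    then show ?thesis using s(3) start by simp
  qed
  then show ?hit using s x(1) b by (intro exI[of _ s]) auto
qed

context band_path
begin

lemma T_le_iff: "T n < \<infinity> \<Longrightarrow> T n \<le> ereal s \<longleftrightarrow> rT n \<le> s"
  and T_less_iff: "T n < \<infinity> \<Longrightarrow> T n < ereal s \<longleftrightarrow> rT n < s"
  using T_nonneg[of n] by (cases "T n"; simp)+

lemma jump_up_iff:
  "T (Suc n) \<le> ereal t \<and> \<xi> (Suc n) = D - d \<longleftrightarrow> T n \<le> ereal t \<and>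
    (\<exists>s. rT n \<le> s \<and> s \<le> t \<and> p s + c n = d \<and> (\<forall>r. rT n \<le> r \<and> r \<le> s \<longrightarrow> p r + c n < u))"
    (is "?jump \<longleftrightarrow> _ \<and> ?hit")
proof
  assume j: ?jump
  then have fin: "T (Suc n) < \<infinity>" "rT (Suc n) \<le> t" using T_le_D by auto
  have Tn: "T n \<le> ereal t" using j T_le_Suc order_trans by blast
  define s where "s = rT (Suc n)"
  have Ts: "T (Suc n) = ereal s" using T_real(1)[OF fin(1)] by (simp add: s_def)
  have fin': "T n < \<infinity>" using T_finite_pred[OF fin(1)] .
  have hit: "p s + c n = d"
    using hit_boundary[OF fin(1)] j order unfolding \<xi>_Suc s_def by (auto split: if_splits)
  have "rT n < s" using T_less_Suc[OF fin'] unfolding Ts T_less_iff[OF fin'] .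
  moreover have "p r + c n < u" if r: "rT n \<le> r" "r \<le> s" for r
  proof (cases "r = s")
    case True
    then show ?thesis using hit order by simp
  next
    case False
    have "T n \<le> ereal r" unfolding T_le_iff[OF fin'] using r by simp
    moreover have "ereal r < T (Suc n)" unfolding Ts using r False by simp
    ultimately show ?thesis using inside_between by blast
  qed
  ultimately show "T n \<le> ereal t \<and> ?hit" using hit fin(2) Tn by (intro conjI exI[of _ s]) (auto simp: s_def)
next
  assume a: "T n \<le> ereal t \<and> ?hit"
  then obtain s where s: "rT n \<le> s" "s \<le> t" "p s + c n = d"
    and below: "\<And>r. rT n \<le> r \<Longrightarrow> r \<le> s \<Longrightarrow> p r + c n < u" by blast
  have fin': "T n < \<infinity>" using a T_le_D by blast
  have "rT n \<noteq> s" using s start_inside[OF fin'] by auto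
  then have "T n < ereal s" unfolding T_less_iff[OF fin'] using s by simp
  then have Ts: "T (Suc n) \<le> ereal s" unfolding T_Suc using s by (intro Inf_lower) auto
  then have fin: "T (Suc n) < \<infinity>" "rT (Suc n) \<le> s" using T_le_D by auto
  have "rT n \<le> rT (Suc n)"
    using T_le_Suc[of n] T_le_iff[OF fin', of "rT (Suc n)"] T_real(1)[OF fin(1)] by metis
  then have "p (rT (Suc n)) + c n < u" using below fin(2) by blast
  then have "p (rT (Suc n)) + c n = d" using hit_boundary[OF fin(1)] by auto
  moreover have "T (Suc n) \<le> ereal t" using Ts s(2) by (metis ereal_less_eq(3) order_trans)
  ultimately show ?jump by (simp add: \<xi>_Suc)
qed

lemma jump_down_iff:
  "T (Suc n) \<le> ereal t \<and> \<xi> (Suc n) = U - u \<longleftrightarrow> T n \<le> ereal t \<and>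
    (\<exists>s. rT n \<le> s \<and> s \<le> t \<and> p s + c n = u \<and> (\<forall>r. rT n \<le> r \<and> r \<le> s \<longrightarrow> d < p r + c n))"
    (is "?jump \<longleftrightarrow> _ \<and> ?hit")
proof
  assume j: ?jump
  then have fin: "T (Suc n) < \<infinity>" "rT (Suc n) \<le> t" using T_le_D by auto
  have Tn: "T n \<le> ereal t" using j T_le_Suc order_trans by blast
  define s where "s = rT (Suc n)"
  have Ts: "T (Suc n) = ereal s" using T_real(1)[OF fin(1)] by (simp add: s_def)
  have fin': "T n < \<infinity>" using T_finite_pred[OF fin(1)] .
  have hit: "p s + c n = u"
    using hit_boundary[OF fin(1)] j order unfolding \<xi>_Suc s_def by (auto split: if_splits)
  have "rT n < s" using T_less_Suc[OF fin'] unfolding Ts T_less_iff[OF fin'] .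
  moreover have "d < p r + c n" if r: "rT n \<le> r" "r \<le> s" for r
  proof (cases "r = s")
    case True
    then show ?thesis using hit order by simp
  next
    case False
    have "T n \<le> ereal r" unfolding T_le_iff[OF fin'] using r by simp
    moreover have "ereal r < T (Suc n)" unfolding Ts using r False by simp
    ultimately show ?thesis using inside_between by blast
  qed
  ultimately show "T n \<le> ereal t \<and> ?hit" using hit fin(2) Tn by (intro conjI exI[of _ s]) (auto simp: s_def)
next
  assume a: "T n \<le> ereal t \<and> ?hit"
  then obtain s where s: "rT n \<le> s" "s \<le> t" "p s + c n = u"
    and above: "\<And>r. rT n \<le> r \<Longrightarrow> r \<le> s \<Longrightarrow> d < p r + c n" by blast
  have fin': "T n < \<infinity>" using a T_le_D by blast
  have "rT n \<noteq> s" using s start_inside[OF fin'] by auto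
  then have "T n < ereal s" unfolding T_less_iff[OF fin'] using s by simp
  then have Ts: "T (Suc n) \<le> ereal s" unfolding T_Suc using s by (intro Inf_lower) auto
  then have fin: "T (Suc n) < \<infinity>" "rT (Suc n) \<le> s" using T_le_D by auto
  have "rT n \<le> rT (Suc n)"
    using T_le_Suc[of n] T_le_iff[OF fin', of "rT (Suc n)"] T_real(1)[OF fin(1)] by metis
  then have "d < p (rT (Suc n)) + c n" using above fin(2) by blast
  then have "p (rT (Suc n)) + c n = u" using hit_boundary[OF fin(1)] by auto
  moreover have "T (Suc n) \<le> ereal t" using Ts s(2) by (metis ereal_less_eq(3) order_trans)
  ultimately show ?jump using order by (simp add: \<xi>_Suc)
qed

lemma jump_size:
  assumes "T (Suc n) < \<infinity>" shows "\<xi> (Suc n) = D - d \<or> \<xi> (Suc n) = U - u"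
  using hit_boundary[OF assms] unfolding \<xi>_Suc by auto

text \<open>The event that the next adjustment is upward and happens by time \<open>t\<close>, described by rational times only.  The factor
  \<open>of_bool\<close> changes nothing, since it multiplies \<open>c n\<close> only at times not before \<open>T n\<close>; it
  makes the sum measurable at time \<open>q\<close> even in scenarios where \<open>T n > q\<close>.\<close>

definition approx_up :: "nat \<Rightarrow> real \<Rightarrow> bool" where
  "approx_up n t \<longleftrightarrow> (\<exists>j::nat. \<forall>m::nat. \<exists>q::rat. (0 \<le> q \<and> of_rat q \<le> t) \<and> T n \<le> ereal (of_rat q) \<and>
      p (of_rat q) + of_bool (T n \<le> ereal (of_rat q)) * c n \<le> d + 1 / real (Suc m) \<and>
      (\<forall>r::rat. (0 \<le> r \<and> r \<le> q) \<longrightarrow> T n \<le> ereal (of_rat r) \<longrightarrow>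
        p (of_rat r) + of_bool (T n \<le> ereal (of_rat r)) * c n \<le> u - 1 / real (Suc j)))"

definition approx_down :: "nat \<Rightarrow> real \<Rightarrow> bool" where
  "approx_down n t \<longleftrightarrow> (\<exists>j::nat. \<forall>m::nat. \<exists>q::rat. (0 \<le> q \<and> of_rat q \<le> t) \<and> T n \<le> ereal (of_rat q) \<and>
      - (p (of_rat q) + of_bool (T n \<le> ereal (of_rat q)) * c n) \<le> - u + 1 / real (Suc m) \<and>
      (\<forall>r::rat. (0 \<le> r \<and> r \<le> q) \<longrightarrow> T n \<le> ereal (of_rat r) \<longrightarrow>
        - (p (of_rat r) + of_bool (T n \<le> ereal (of_rat r)) * c n) \<le> - d - 1 / real (Suc j)))"

lemma rat_time_iff:
  assumes "T n < \<infinity>"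
  shows "0 \<le> q \<and> T n \<le> ereal (of_rat q) \<longleftrightarrow> rT n \<le> of_rat q"
  using T_real(2)[of n] T_le_iff[OF assms, of "of_rat q"] by (metis order_trans zero_le_of_rat_iff)

lemma approx_jump_aux:
  fixes v :: "real \<Rightarrow> real"
  assumes cv: "continuous_on {0..} v" and start: "T n < \<infinity> \<Longrightarrow> lo < v (rT n) \<and> v (rT n) < hi"
  shows "(\<exists>j::nat. \<forall>m::nat. \<exists>q::rat. (0 \<le> q \<and> of_rat q \<le> t) \<and> T n \<le> ereal (of_rat q) \<and>
      v (of_rat q) \<le> lo + 1 / real (Suc m) \<and>
      (\<forall>r::rat. (0 \<le> r \<and> r \<le> q) \<longrightarrow> T n \<le> ereal (of_rat r) \<longrightarrow> v (of_rat r) \<le> hi - 1 / real (Suc j)))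
    \<longleftrightarrow> T n \<le> ereal t \<and> (\<exists>s. rT n \<le> s \<and> s \<le> t \<and> v s = lo \<and> (\<forall>r. rT n \<le> r \<and> r \<le> s \<longrightarrow> v r < hi))"
    (is "?L \<longleftrightarrow> _ \<and> ?R")
proof (cases "T n < \<infinity>")
  case True
  note * = hits_lower_first_iff[OF cv T_real(2) conjunct1[OF start[OF True]] conjunct2[OF start[OF True]], of t]
  have "?L \<longleftrightarrow> (\<exists>j::nat. \<forall>m::nat. \<exists>q::rat. rT n \<le> of_rat q \<and> of_rat q \<le> t \<and> v (of_rat q) \<le> lo + 1 / real (Suc m) \<and>
      (\<forall>r::rat. rT n \<le> of_rat r \<and> r \<le> q \<longrightarrow> v (of_rat r) \<le> hi - 1 / real (Suc j)))"
    using rat_time_iff[OF True] by (intro ex_cong1 all_cong1) metis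
  also have "\<dots> \<longleftrightarrow> ?R" using * by simp
  finally have "?L \<longleftrightarrow> ?R" .
  moreover have "T n \<le> ereal t" if ?R
  proof -
    have "rT n \<le> t" using that by force
    then show ?thesis by (simp only: T_le_iff[OF True])
  qed
  ultimately show ?thesis by blast
next
  case False
  then have "T n = \<infinity>" by simp
  then show ?thesis by simp
qed

lemma elapsed_conj:
  shows "(T n \<le> ereal s \<and> p s + of_bool (T n \<le> ereal s) * c n \<le> z \<and> R) = (T n \<le> ereal s \<and> p s + c n \<le> z \<and> R)"
    and "(T n \<le> ereal s \<and> - (p s + of_bool (T n \<le> ereal s) * c n) \<le> z \<and> R) = (T n \<le> ereal s \<and> - (p s + c n) \<le> z \<and> R)"
  by (cases "T n \<le> ereal s"; simp)+

lemma elapsed_imp: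
  "(T n \<le> ereal s \<longrightarrow> p s + of_bool (T n \<le> ereal s) * c n \<le> z) = (T n \<le> ereal s \<longrightarrow> p s + c n \<le> z)"
  "(T n \<le> ereal s \<longrightarrow> - (p s + of_bool (T n \<le> ereal s) * c n) \<le> z) = (T n \<le> ereal s \<longrightarrow> - (p s + c n) \<le> z)"
  by (cases "T n \<le> ereal s"; simp)+

lemma approx_up_iff: "approx_up n t \<longleftrightarrow> T (Suc n) \<le> ereal t \<and> \<xi> (Suc n) = D - d"
proof -
  have cv: "continuous_on {0..} (\<lambda>s. p s + c n)" using cont by (intro continuous_intros)
  show ?thesis unfolding jump_up_iff approx_up_def elapsed_conj elapsed_imp
    by (rule approx_jump_aux[OF cv start_inside])
qed

lemma approx_down_iff: "approx_down n t \<longleftrightarrow> T (Suc n) \<le> ereal t \<and> \<xi> (Suc n) = U - u"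
proof -
  have cv: "continuous_on {0..} (\<lambda>s. - (p s + c n))" using cont by (intro continuous_intros)
  have st: "- u < - (p (rT n) + c n) \<and> - (p (rT n) + c n) < - d" if "T n < \<infinity>"
    using start_inside[OF that] by simp
  have "T n \<le> ereal t \<and> (\<exists>s. rT n \<le> s \<and> s \<le> t \<and> p s + c n = u \<and> (\<forall>r. rT n \<le> r \<and> r \<le> s \<longrightarrow> d < p r + c n))
    \<longleftrightarrow> T n \<le> ereal t \<and> (\<exists>s. rT n \<le> s \<and> s \<le> t \<and> - (p s + c n) = - u \<and> (\<forall>r. rT n \<le> r \<and> r \<le> s \<longrightarrow> - (p r + c n) < - d))"
    by (simp only: neg_equal_iff_equal neg_less_iff_less)
  moreover have "approx_down n t \<longleftrightarrow> T n \<le> ereal t \<and> (\<exists>s. rT n \<le> s \<and> s \<le> t \<and> - (p s + c n) = - u \<and> (\<forall>r. rT n \<le> r \<and> r \<le> s \<longrightarrow> - (p r + c n) < - d))"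
    unfolding approx_down_def elapsed_conj elapsed_imp
    by (rule approx_jump_aux[OF cv st])
  ultimately show ?thesis unfolding jump_down_iff by (simp only:)
qed

end

context brownian_motion
begin

text \<open>Hitting times become measurable with respect to the past because only countably many times up to \<open>t\<close> are involved.\<close>

lemma rational_hitting_event:
  fixes Y :: "real \<Rightarrow> 'a \<Rightarrow> real" and A :: "real \<Rightarrow> 'a \<Rightarrow> bool"
  assumes Y: "\<And>q. 0 \<le> q \<Longrightarrow> Y q \<in> borel_measurable (F q)" and A: "\<And>q. 0 \<le> q \<Longrightarrow> Measurable.pred (F q) (A q)"
  shows "Measurable.pred (F t) (\<lambda>\<omega>. \<exists>j::nat. \<forall>m::nat. \<exists>q::rat. (0 \<le> q \<and> of_rat q \<le> t) \<and> A (of_rat q) \<omega> \<and>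
      Y (of_rat q) \<omega> \<le> lo + 1 / real (Suc m) \<and>
      (\<forall>r::rat. (0 \<le> r \<and> r \<le> q) \<longrightarrow> A (of_rat r) \<omega> \<longrightarrow> Y (of_rat r) \<omega> \<le> hi - 1 / real (Suc j)))"
proof (intro pred_intros_countable)
  fix j m :: nat and q :: rat
  have one: "Measurable.pred (F t) (A (of_rat r))" "Measurable.pred (F t) (\<lambda>\<omega>. Y (of_rat r) \<omega> \<le> v)"
    if r: "0 \<le> r" "of_rat r \<le> t" for r and v :: real
  proof -
    have r0: "0 \<le> (of_rat r :: real)" using r by simp
    show "Measurable.pred (F t) (A (of_rat r))" by (rule measurable_F_mono[OF r(2) A[OF r0]])
    have [measurable]: "Y (of_rat r) \<in> borel_measurable (F t)" by (rule measurable_F_mono[OF r(2) Y[OF r0]])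
    show "Measurable.pred (F t) (\<lambda>\<omega>. Y (of_rat r) \<omega> \<le> v)" by measurable
  qed
  show "Measurable.pred (F t) (\<lambda>\<omega>. (0 \<le> q \<and> of_rat q \<le> t) \<and> A (of_rat q) \<omega> \<and>
      Y (of_rat q) \<omega> \<le> lo + 1 / real (Suc m) \<and>
      (\<forall>r::rat. (0 \<le> r \<and> r \<le> q) \<longrightarrow> A (of_rat r) \<omega> \<longrightarrow> Y (of_rat r) \<omega> \<le> hi - 1 / real (Suc j)))"
  proof (cases "0 \<le> q \<and> of_rat q \<le> t")
    case True
    define R where "R = (\<lambda>\<omega>. \<forall>r::rat. (0 \<le> r \<and> r \<le> q) \<longrightarrow> A (of_rat r) \<omega> \<longrightarrow> Y (of_rat r) \<omega> \<le> hi - 1 / real (Suc j))"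
    have "Measurable.pred (F t) (\<lambda>\<omega>. (0 \<le> r \<and> r \<le> q) \<longrightarrow> A (of_rat r) \<omega> \<longrightarrow> Y (of_rat r) \<omega> \<le> hi - 1 / real (Suc j))" for r
    proof (cases "0 \<le> r \<and> r \<le> q")
      case r: True
      then have "(of_rat r :: real) \<le> of_rat q" by (simp add: of_rat_less_eq)
      then have "of_rat r \<le> t" using True by simp
      then show ?thesis using r by (intro pred_intros_logic one) simp_all
    next
      case False
      show ?thesis by (simp only: False simp_thms) simp
    qed
    then have R: "Measurable.pred (F t) R" unfolding R_def by (rule pred_intros_countable)
    have "Measurable.pred (F t) (\<lambda>\<omega>. (0 \<le> q \<and> of_rat q \<le> t) \<and> A (of_rat q) \<omega> \<and>
        Y (of_rat q) \<omega> \<le> lo + 1 / real (Suc m) \<and> R \<omega>)"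
      using True by (intro pred_intros_logic one R) simp_all
    then show ?thesis unfolding R_def .
  next
    case False
    show ?thesis by (simp only: False simp_thms) simp
  qed
qed

lemma band_path_netput:
  assumes "d < D" "D < U" "U < u" "\<omega> \<in> space M"
  shows "band_path d D U u (\<lambda>s. brownian_netput \<mu> \<sigma> W x s \<omega>)"
  using assms netput_continuous by unfold_locales auto

text \<open>Induction over the adjustments, carrying along the total adjustment \<open>c n\<close>, which is needed
  to express that the \<open>n\<close>-th excursion reaches \<open>d\<close> or \<open>u\<close>.\<close>

lemma adjustment_adapted:
  fixes d D U u \<mu> \<sigma> x :: real
  assumes order: "d < D" "D < U" "U < u"
  defines "X \<equiv> brownian_netput \<mu> \<sigma> W x"
  defines "T \<equiv> \<lambda>n \<omega>. band_time d D U u (\<lambda>s. X s \<omega>) n"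
    and "\<xi> \<equiv> \<lambda>n \<omega>. band_jump d D U u (\<lambda>s. X s \<omega>) n"
    and "c \<equiv> \<lambda>n \<omega>. snd (snd (band_step d D U u (\<lambda>s. X s \<omega>) n))"
  assumes t: "0 \<le> t"
  shows "Measurable.pred (F t) (\<lambda>\<omega>. T n \<omega> \<le> ereal t)"
    and "(\<lambda>\<omega>. of_bool (T n \<omega> \<le> ereal t) * \<xi> n \<omega>) \<in> borel_measurable (F t)"
proof -
  note bp = band_path_netput[OF order, where \<mu> = \<mu> and \<sigma> = \<sigma> and x = x, folded X_def]
  have spF: "\<omega> \<in> space (F s) \<longleftrightarrow> \<omega> \<in> space M" for \<omega> s using space_F by simp
  have main: "(\<forall>t\<ge>0. Measurable.pred (F t) (\<lambda>\<omega>. T n \<omega> \<le> ereal t) \<and>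
      (\<lambda>\<omega>. of_bool (T n \<omega> \<le> ereal t) * \<xi> n \<omega>) \<in> borel_measurable (F t) \<and>
      (\<lambda>\<omega>. of_bool (T n \<omega> \<le> ereal t) * c n \<omega>) \<in> borel_measurable (F t))"
  proof (induction n)
    case 0
    define v where "v = (if x \<le> d then D - x else if x < u then 0 else U - x)"
    have T0: "T 0 \<omega> \<le> ereal t" if "0 \<le> t" for t \<omega>
      using that by (simp add: T_def band_time_def Let_def)
    have v: "\<xi> 0 \<omega> = v" "c 0 \<omega> = v" if "\<omega> \<in> space M" for \<omega>
      using W_0[OF that] by (simp_all add: c_def \<xi>_def v_def band_jump_def Let_def X_def brownian_netput_def)
    show ?case
    proof (intro allI impI conjI)
      fix t :: real assume t: "0 \<le> t"
      show "Measurable.pred (F t) (\<lambda>\<omega>. T 0 \<omega> \<le> ereal t)" by (simp only: T0[OF t] simp_thms) simp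
      show "(\<lambda>\<omega>. of_bool (T 0 \<omega> \<le> ereal t) * \<xi> 0 \<omega>) \<in> borel_measurable (F t)"
        by (rule measurable_cong[THEN iffD2, OF _ measurable_const[of v]]) (use v T0[OF t] spF in simp_all)
      show "(\<lambda>\<omega>. of_bool (T 0 \<omega> \<le> ereal t) * c 0 \<omega>) \<in> borel_measurable (F t)"
        by (rule measurable_cong[THEN iffD2, OF _ measurable_const[of v]]) (use v T0[OF t] spF in simp_all)
    qed
  next
    case (Suc n)
    show ?case
    proof (intro allI impI)
      fix t :: real assume t: "0 \<le> t"
      define Y where "Y = (\<lambda>q \<omega>. X q \<omega> + of_bool (T n \<omega> \<le> ereal q) * c n \<omega>)"
      have Ym: "Y q \<in> borel_measurable (F q)" if "0 \<le> q" for q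
      proof -
        have "(\<lambda>\<omega>. of_bool (T n \<omega> \<le> ereal q) * c n \<omega>) \<in> borel_measurable (F q)"
          using Suc that by blast
        then show ?thesis unfolding Y_def X_def by (intro borel_measurable_add netput_adapted that)
      qed
      have nYm: "(\<lambda>\<omega>. - Y q \<omega>) \<in> borel_measurable (F q)" if "0 \<le> q" for q
        using Ym[OF that] by measurable
      have Am: "Measurable.pred (F q) (\<lambda>\<omega>. T n \<omega> \<le> ereal q)" if "0 \<le> q" for q
        using Suc that by blast
      have up: "Measurable.pred (F t) (\<lambda>\<omega>. T (Suc n) \<omega> \<le> ereal t \<and> \<xi> (Suc n) \<omega> = D - d)"
      proof (rule measurable_cong[THEN iffD1])
        show "Measurable.pred (F t) (\<lambda>\<omega>. band_path.approx_up d D U u (\<lambda>s. X s \<omega>) n t)"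
        proof (rule measurable_cong[THEN iffD2])
          fix \<omega> assume "\<omega> \<in> space (F t)"
          then interpret band_path d D U u "\<lambda>s. X s \<omega>" using bp spF by blast
          show "approx_up n t = (\<exists>j::nat. \<forall>m::nat. \<exists>q::rat. (0 \<le> q \<and> of_rat q \<le> t) \<and> T n \<omega> \<le> ereal (of_rat q) \<and>
            Y (of_rat q) \<omega> \<le> d + 1 / real (Suc m) \<and>
            (\<forall>r::rat. (0 \<le> r \<and> r \<le> q) \<longrightarrow> T n \<omega> \<le> ereal (of_rat r) \<longrightarrow> Y (of_rat r) \<omega> \<le> u - 1 / real (Suc j)))"
            unfolding approx_up_def Y_def T_def c_def ..
        qed (rule rational_hitting_event[OF Ym Am])
        fix \<omega> assume "\<omega> \<in> space (F t)"
        then interpret band_path d D U u "\<lambda>s. X s \<omega>" using bp spF by blast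
        show "approx_up n t = (T (Suc n) \<omega> \<le> ereal t \<and> \<xi> (Suc n) \<omega> = D - d)"
          unfolding T_def \<xi>_def by (rule approx_up_iff)
      qed
      have down: "Measurable.pred (F t) (\<lambda>\<omega>. T (Suc n) \<omega> \<le> ereal t \<and> \<xi> (Suc n) \<omega> = U - u)"
      proof (rule measurable_cong[THEN iffD1])
        show "Measurable.pred (F t) (\<lambda>\<omega>. band_path.approx_down d D U u (\<lambda>s. X s \<omega>) n t)"
        proof (rule measurable_cong[THEN iffD2])
          fix \<omega> assume "\<omega> \<in> space (F t)"
          then interpret band_path d D U u "\<lambda>s. X s \<omega>" using bp spF by blast
          show "approx_down n t = (\<exists>j::nat. \<forall>m::nat. \<exists>q::rat. (0 \<le> q \<and> of_rat q \<le> t) \<and> T n \<omega> \<le> ereal (of_rat q) \<and>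
            - Y (of_rat q) \<omega> \<le> - u + 1 / real (Suc m) \<and>
            (\<forall>r::rat. (0 \<le> r \<and> r \<le> q) \<longrightarrow> T n \<omega> \<le> ereal (of_rat r) \<longrightarrow> - Y (of_rat r) \<omega> \<le> - d - 1 / real (Suc j)))"
            unfolding approx_down_def Y_def T_def c_def ..
        qed (rule rational_hitting_event[OF nYm Am])
        fix \<omega> assume "\<omega> \<in> space (F t)"
        then interpret band_path d D U u "\<lambda>s. X s \<omega>" using bp spF by blast
        show "approx_down n t = (T (Suc n) \<omega> \<le> ereal t \<and> \<xi> (Suc n) \<omega> = U - u)"
          unfolding T_def \<xi>_def by (rule approx_down_iff)
      qed
      have cases: "T (Suc n) \<omega> \<le> ereal t \<longrightarrow> \<xi> (Suc n) \<omega> = D - d \<or> \<xi> (Suc n) \<omega> = U - u" if "\<omega> \<in> space (F t)" for \<omega>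
      proof -
        interpret band_path d D U u "\<lambda>s. X s \<omega>" using bp spF that by blast
        show ?thesis using jump_size[of n] T_le_D[of "Suc n" t] unfolding T_def \<xi>_def by blast
      qed
      have Tm: "Measurable.pred (F t) (\<lambda>\<omega>. T (Suc n) \<omega> \<le> ereal t)"
      proof (rule measurable_cong[THEN iffD1])
        show "Measurable.pred (F t) (\<lambda>\<omega>. (T (Suc n) \<omega> \<le> ereal t \<and> \<xi> (Suc n) \<omega> = D - d) \<or>
            (T (Suc n) \<omega> \<le> ereal t \<and> \<xi> (Suc n) \<omega> = U - u))"
          using up down by (rule pred_intros_logic)
      qed (use cases in blast)
      have \<xi>m: "(\<lambda>\<omega>. of_bool (T (Suc n) \<omega> \<le> ereal t) * \<xi> (Suc n) \<omega>) \<in> borel_measurable (F t)"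
      proof (rule measurable_cong[THEN iffD1])
        note [measurable] = up down
        show "(\<lambda>\<omega>. if T (Suc n) \<omega> \<le> ereal t \<and> \<xi> (Suc n) \<omega> = D - d then D - d
          else if T (Suc n) \<omega> \<le> ereal t \<and> \<xi> (Suc n) \<omega> = U - u then U - u else 0) \<in> borel_measurable (F t)"
          by measurable
      qed (use cases order in auto)
      have cm: "(\<lambda>\<omega>. of_bool (T (Suc n) \<omega> \<le> ereal t) * c (Suc n) \<omega>) \<in> borel_measurable (F t)"
      proof (rule measurable_cong[THEN iffD1])
        have [measurable]: "(\<lambda>\<omega>. of_bool (T n \<omega> \<le> ereal t) * c n \<omega>) \<in> borel_measurable (F t)"
          using Suc t by blast
        note [measurable] = Tm \<xi>m
        have "(\<lambda>\<omega>. if T (Suc n) \<omega> \<le> ereal t then of_bool (T n \<omega> \<le> ereal t) * c n \<omega>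
          + of_bool (T (Suc n) \<omega> \<le> ereal t) * \<xi> (Suc n) \<omega> else 0) \<in> borel_measurable (F t)"
          by measurable
        then show "(\<lambda>\<omega>. if T (Suc n) \<omega> \<le> ereal t then of_bool (T n \<omega> \<le> ereal t) * c n \<omega>
          + of_bool (T (Suc n) \<omega> \<le> ereal t) * \<xi> (Suc n) \<omega> else 0) \<in> borel_measurable (F t)" .
        fix \<omega> assume "\<omega> \<in> space (F t)"
        then interpret band_path d D U u "\<lambda>s. X s \<omega>" using bp spF by blast
        have "T n \<omega> \<le> ereal t" if "T (Suc n) \<omega> \<le> ereal t"
          using order_trans[OF T_le_Suc that[unfolded T_def]] by (simp only: T_def)
        moreover have "c (Suc n) \<omega> = c n \<omega> + \<xi> (Suc n) \<omega>" unfolding c_def \<xi>_def by (rule c_Suc)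
        ultimately show "(if T (Suc n) \<omega> \<le> ereal t then of_bool (T n \<omega> \<le> ereal t) * c n \<omega>
          + of_bool (T (Suc n) \<omega> \<le> ereal t) * \<xi> (Suc n) \<omega> else 0) = of_bool (T (Suc n) \<omega> \<le> ereal t) * c (Suc n) \<omega>"
          by (cases "T (Suc n) \<omega> \<le> ereal t") simp_all
      qed
      show "Measurable.pred (F t) (\<lambda>\<omega>. T (Suc n) \<omega> \<le> ereal t) \<and>
        (\<lambda>\<omega>. of_bool (T (Suc n) \<omega> \<le> ereal t) * \<xi> (Suc n) \<omega>) \<in> borel_measurable (F t) \<and>
        (\<lambda>\<omega>. of_bool (T (Suc n) \<omega> \<le> ereal t) * c (Suc n) \<omega>) \<in> borel_measurable (F t)"
        using Tm \<xi>m cm by blast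
    qed
  qed
  show "Measurable.pred (F t) (\<lambda>\<omega>. T n \<omega> \<le> ereal t)"
    "(\<lambda>\<omega>. of_bool (T n \<omega> \<le> ereal t) * \<xi> n \<omega>) \<in> borel_measurable (F t)"
    using main t by blast+
qed

end

section \<open>Expected costs of the control band policy\<close>

locale band_policy = brownian_motion M F W
  for M :: "'a measure" and F :: "real \<Rightarrow> 'a measure" and W :: "real \<Rightarrow> 'a \<Rightarrow> real" +
  fixes d D U u \<mu> \<sigma> x :: real
  assumes order: "d < D" "D < U" "U < u"
begin

abbreviation X :: "real \<Rightarrow> 'a \<Rightarrow> real" where "X \<equiv> brownian_netput \<mu> \<sigma> W x"
abbreviation path :: "'a \<Rightarrow> real \<Rightarrow> real" where "path \<omega> \<equiv> (\<lambda>s. X s \<omega>)"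
abbreviation adj_time :: "nat \<Rightarrow> 'a \<Rightarrow> ereal" where "adj_time n \<omega> \<equiv> band_time d D U u (path \<omega>) n"
abbreviation adj_size :: "nat \<Rightarrow> 'a \<Rightarrow> real" where "adj_size n \<omega> \<equiv> band_jump d D U u (path \<omega>) n"

definition Z :: "real \<Rightarrow> 'a \<Rightarrow> real" where
  "Z t \<omega> = X t \<omega> + band_path.adjusted d D U u (path \<omega>) (\<lambda>n. adj_size n \<omega>) t"

text \<open>The inventory under the band policy that stops after the \<open>m\<close>-th adjustment; it may then leave \<open>[d, u]\<close>.\<close>

definition truncated :: "nat \<Rightarrow> real \<Rightarrow> 'a \<Rightarrow> real" where
  "truncated m t \<omega> = X t \<omega> + (\<Sum>i\<le>m. of_bool (adj_time i \<omega> \<le> ereal t) * adj_size i \<omega>)"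

lemma path: "\<omega> \<in> space M \<Longrightarrow> band_path d D U u (path \<omega>)"
  using order by (rule band_path_netput)

lemma truncated_eq: "\<omega> \<in> space M \<Longrightarrow> truncated m t \<omega> = X t \<omega> + band_path.shift d D U u (path \<omega>) m t"
  by (simp add: truncated_def band_path.shift_def[OF path])

lemma T_pred: "0 \<le> t \<Longrightarrow> Measurable.pred (F t) (\<lambda>\<omega>. adj_time n \<omega> \<le> ereal t)"
  and \<xi>_adapted: "0 \<le> t \<Longrightarrow> (\<lambda>\<omega>. of_bool (adj_time n \<omega> \<le> ereal t) * adj_size n \<omega>) \<in> borel_measurable (F t)"
  by (rule adjustment_adapted[OF order], assumption)+

lemma truncated_adapted: "0 \<le> t \<Longrightarrow> truncated m t \<in> borel_measurable (F t)"
  unfolding truncated_def[abs_def]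
  by (intro borel_measurable_add borel_measurable_sum netput_adapted \<xi>_adapted)

lemma truncated_right_continuous:
  assumes "0 \<le> t" "\<omega> \<in> space M"
  shows "continuous (at_right t) (\<lambda>t. truncated m t \<omega>)"
  unfolding truncated_eq[OF assms(2)]
  by (intro continuous_add netput_right_continuous assms band_path.shift_right_continuous[OF path])

text \<open>Up to a fixed time a path makes finitely many adjustments, so the truncation is not felt for large \<open>m\<close>.\<close>

lemma truncated_eventually:
  assumes "\<omega> \<in> space M" "0 \<le> t"
  obtains m0 where "\<And>m s. m0 \<le> m \<Longrightarrow> s \<le> t \<Longrightarrow> truncated m s \<omega> = Z s \<omega>"
proof -
  interpret band_path d D U u "path \<omega>" by (rule path[OF assms(1)])
  obtain n where n: "adj_time n \<omega> \<le> ereal t" "ereal t < adj_time (Suc n) \<omega>" using last_adjustment[OF assms(2)] by blast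
  have "truncated m s \<omega> = Z s \<omega>" if "n \<le> m" "s \<le> t" for m s
  proof -
    have "ereal s < adj_time (Suc n) \<omega>" using n(2) that(2) by (metis ereal_less_eq(3) le_less_trans)
    also have "\<dots> \<le> adj_time (Suc m) \<omega>" using that(1) by (intro T_mono) simp
    finally have "shift m s = adjusted (\<lambda>n. adj_size n \<omega>) s" by (rule shift_eventually)
    then show ?thesis using truncated_eq[OF assms(1)] by (simp add: Z_def)
  qed
  then show ?thesis using that by blast
qed

lemma Z_adapted:
  assumes "0 \<le> t" shows "Z t \<in> borel_measurable (F t)"
proof (rule borel_measurable_LIMSEQ_real)
  fix \<omega> assume "\<omega> \<in> space (F t)"
  then have \<omega>: "\<omega> \<in> space M" using space_F by simp
  obtain m0 where "\<And>m s. m0 \<le> m \<Longrightarrow> s \<le> t \<Longrightarrow> truncated m s \<omega> = Z s \<omega>"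
    by (rule truncated_eventually[OF \<omega> assms]) blast
  then have "eventually (\<lambda>m. Z t \<omega> = truncated m t \<omega>) sequentially"
    unfolding eventually_sequentially by (intro exI[of _ m0]) simp
  then show "(\<lambda>m. truncated m t \<omega>) \<longlonglongrightarrow> Z t \<omega>"
    by (rule Lim_transform_eventually[OF tendsto_const])
qed (rule truncated_adapted[OF assms])

lemma Z_right_continuous:
  assumes "0 \<le> t" "\<omega> \<in> space M"
  shows "continuous (at_right t) (\<lambda>t. Z t \<omega>)"
  unfolding Z_def
  by (intro continuous_add netput_right_continuous assms band_path.adjusted_right_continuous[OF path])

lemma Z_inside: "0 \<le> t \<Longrightarrow> \<omega> \<in> space M \<Longrightarrow> d < Z t \<omega> \<and> Z t \<omega> < u"
  using band_path.controlled_path_inside[OF path, of \<omega> t]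
  by (simp add: Z_def band_path.adjusted_def[OF path])

definition jump_costs :: "real \<Rightarrow> real \<Rightarrow> nat \<Rightarrow> real \<Rightarrow> 'a \<Rightarrow> real" where
  "jump_costs \<kappa>1 \<kappa>2 m t \<omega> = (\<Sum>i<m. of_bool (adj_time (Suc i) \<omega> \<le> ereal t) * (if 0 < adj_size (Suc i) \<omega> then \<kappa>1 else \<kappa>2))"

lemma jump_costs_measurable:
  assumes "0 \<le> t" shows "jump_costs \<kappa>1 \<kappa>2 m t \<in> borel_measurable M"
proof -
  have "(\<lambda>\<omega>. of_bool (adj_time (Suc i) \<omega> \<le> ereal t) * (if 0 < adj_size (Suc i) \<omega> then \<kappa>1 else \<kappa>2)) \<in> borel_measurable M" for i
  proof -
    have [measurable]: "Measurable.pred M (\<lambda>\<omega>. adj_time (Suc i) \<omega> \<le> ereal t)"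
      "(\<lambda>\<omega>. of_bool (adj_time (Suc i) \<omega> \<le> ereal t) * adj_size (Suc i) \<omega>) \<in> borel_measurable M"
      using T_pred[OF assms] \<xi>_adapted[OF assms] measurable_F_M[OF assms] by blast+
    have "(\<lambda>\<omega>. if adj_time (Suc i) \<omega> \<le> ereal t then
        (if 0 < of_bool (adj_time (Suc i) \<omega> \<le> ereal t) * adj_size (Suc i) \<omega> then \<kappa>1 else \<kappa>2) else 0) \<in> borel_measurable M"
      by measurable
    moreover have "(\<lambda>\<omega>. if adj_time (Suc i) \<omega> \<le> ereal t then
        (if 0 < of_bool (adj_time (Suc i) \<omega> \<le> ereal t) * adj_size (Suc i) \<omega> then \<kappa>1 else \<kappa>2) else 0)
      = (\<lambda>\<omega>. of_bool (adj_time (Suc i) \<omega> \<le> ereal t) * (if 0 < adj_size (Suc i) \<omega> then \<kappa>1 else \<kappa>2))"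
      by (rule ext) simp
    ultimately show ?thesis by simp
  qed
  then show ?thesis unfolding jump_costs_def[abs_def] by (rule borel_measurable_sum)
qed

lemma jump_costs_bounds:
  assumes "0 \<le> \<kappa>1" "0 \<le> \<kappa>2"
  shows "0 \<le> jump_costs \<kappa>1 \<kappa>2 m t \<omega>" "jump_costs \<kappa>1 \<kappa>2 m t \<omega> \<le> real m * (\<kappa>1 + \<kappa>2)"
proof -
  show "0 \<le> jump_costs \<kappa>1 \<kappa>2 m t \<omega>"
    unfolding jump_costs_def using assms by (intro sum_nonneg) simp
  have "jump_costs \<kappa>1 \<kappa>2 m t \<omega> \<le> (\<Sum>i<m. \<kappa>1 + \<kappa>2)"
    unfolding jump_costs_def using assms by (intro sum_mono) simp
  then show "jump_costs \<kappa>1 \<kappa>2 m t \<omega> \<le> real m * (\<kappa>1 + \<kappa>2)" by simp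
qed

text \<open>The sum \<open>S N\<close> is the part of \<open>dynkin_lower_bound\<close> due to control.  After an exchange of sums every
  adjustment contributes the drop of \<open>f\<close> evaluated with the uncontrolled path at the end of its
  grid cell; as the mesh tends to \<open>0\<close> this becomes the drop from \<open>d\<close> to \<open>D\<close> or from \<open>u\<close> to \<open>U\<close>.\<close>

lemma grid_jumps_converge:
  fixes f :: "real \<Rightarrow> real" and m :: nat
  assumes t: "0 < t" and \<omega>: "\<omega> \<in> space M" and contf: "continuous_on UNIV f" and bd: "\<And>x. \<bar>f x\<bar> \<le> b"
    and drop: "f D - f d = - \<kappa>1" "f U - f u = - \<kappa>2"
  defines "\<tau> \<equiv> \<lambda>N i. t * real i / real N"
  defines "S \<equiv> \<lambda>N. \<Sum>j<N. f (truncated m (\<tau> N j) \<omega> + increment \<mu> \<sigma> W (\<tau> N j) (\<tau> N (Suc j)) \<omega>)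
      - f (truncated m (\<tau> N (Suc j)) \<omega>)"
  shows "S \<longlonglongrightarrow> jump_costs \<kappa>1 \<kappa>2 m t \<omega>" and "\<bar>S N\<bar> \<le> real m * (2 * b)"
proof -
  interpret band_path d D U u "path \<omega>" by (rule path[OF \<omega>])
  define \<phi> where "\<phi> = (\<lambda>i y. f (y + c (Suc i)) - f (y + c i))"
  define ob :: "nat \<Rightarrow> real \<Rightarrow> real" where "ob = (\<lambda>i s. of_bool (adj_time (Suc i) \<omega> \<le> ereal s))"
  have \<tau>0: "0 \<le> \<tau> N j" for N j using t by (simp add: \<tau>_def)
  have \<tau>mono: "\<tau> N j \<le> \<tau> N (Suc j)" for N j
    using t unfolding \<tau>_def by (intro divide_right_mono mult_left_mono) simp_all
  have expand: "f (y + shift m s) = f (y + c 0) + (\<Sum>i<m. ob i s * \<phi> i y)" if "0 \<le> s" for y s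
    unfolding ob_def \<phi>_def by (rule shift_expansion[OF that])
  have S_eq: "S N = - (\<Sum>i<m. \<Sum>j<N. (ob i (\<tau> N (Suc j)) - ob i (\<tau> N j)) * \<phi> i (X (\<tau> N (Suc j)) \<omega>))" for N
  proof -
    have "f (truncated m (\<tau> N j) \<omega> + increment \<mu> \<sigma> W (\<tau> N j) (\<tau> N (Suc j)) \<omega>) - f (truncated m (\<tau> N (Suc j)) \<omega>)
      = - (\<Sum>i<m. (ob i (\<tau> N (Suc j)) - ob i (\<tau> N j)) * \<phi> i (X (\<tau> N (Suc j)) \<omega>))" for j
    proof -
      have "truncated m (\<tau> N j) \<omega> + increment \<mu> \<sigma> W (\<tau> N j) (\<tau> N (Suc j)) \<omega> = X (\<tau> N (Suc j)) \<omega> + shift m (\<tau> N j)"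
        unfolding truncated_eq[OF \<omega>] by (simp add: brownian_netput_def increment_def algebra_simps)
      moreover have "truncated m (\<tau> N (Suc j)) \<omega> = X (\<tau> N (Suc j)) \<omega> + shift m (\<tau> N (Suc j))"
        by (rule truncated_eq[OF \<omega>])
      ultimately show ?thesis
        by (simp only: expand[OF \<tau>0]) (simp add: left_diff_distrib sum_subtractf)
    qed
    then have "S N = - (\<Sum>j<N. \<Sum>i<m. (ob i (\<tau> N (Suc j)) - ob i (\<tau> N j)) * \<phi> i (X (\<tau> N (Suc j)) \<omega>))"
      unfolding S_def by (simp only: sum_negf)
    also have "(\<Sum>j<N. \<Sum>i<m. (ob i (\<tau> N (Suc j)) - ob i (\<tau> N j)) * \<phi> i (X (\<tau> N (Suc j)) \<omega>))
      = (\<Sum>i<m. \<Sum>j<N. (ob i (\<tau> N (Suc j)) - ob i (\<tau> N j)) * \<phi> i (X (\<tau> N (Suc j)) \<omega>))"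
      by (rule sum.swap)
    finally show ?thesis .
  qed
  have Tpos: "0 < adj_time (Suc i) \<omega>" for i
  proof (cases "adj_time i \<omega> < \<infinity>")
    case True
    then show ?thesis using le_less_trans[OF T_nonneg T_less_Suc[OF True]] by simp
  next
    case False
    then have "adj_time (Suc i) \<omega> = \<infinity>" using T_le_Suc[of i] by simp
    then show ?thesis by simp
  qed
  have cX: "continuous_on {0..} (\<lambda>s. \<phi> i (X s \<omega>))" for i
  proof -
    have "continuous_on {0..} (\<lambda>s. f (X s \<omega> + v))" for v
      by (rule continuous_on_compose2[OF contf])
        (intro continuous_on_add continuous_on_const netput_continuous[OF \<omega>], simp)
    then show ?thesis unfolding \<phi>_def by (intro continuous_on_diff)
  qed
  have "(\<lambda>N. \<Sum>j<N. (ob i (\<tau> N (Suc j)) - ob i (\<tau> N j)) * \<phi> i (X (\<tau> N (Suc j)) \<omega>))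
      \<longlonglongrightarrow> ob i t * \<phi> i (X (rT (Suc i)) \<omega>)" for i
    unfolding ob_def \<tau>_def by (rule grid_localization[OF t Tpos cX])
  then have "(\<lambda>N. - (\<Sum>i<m. \<Sum>j<N. (ob i (\<tau> N (Suc j)) - ob i (\<tau> N j)) * \<phi> i (X (\<tau> N (Suc j)) \<omega>)))
      \<longlonglongrightarrow> - (\<Sum>i<m. ob i t * \<phi> i (X (rT (Suc i)) \<omega>))"
    by (intro tendsto_minus tendsto_sum)
  moreover have "- (\<Sum>i<m. ob i t * \<phi> i (X (rT (Suc i)) \<omega>)) = jump_costs \<kappa>1 \<kappa>2 m t \<omega>"
  proof -
    have "- (ob i t * \<phi> i (X (rT (Suc i)) \<omega>)) = of_bool (adj_time (Suc i) \<omega> \<le> ereal t) * (if 0 < adj_size (Suc i) \<omega> then \<kappa>1 else \<kappa>2)" for i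
    proof (cases "adj_time (Suc i) \<omega> \<le> ereal t")
      case True
      then have fin: "adj_time (Suc i) \<omega> < \<infinity>" using T_le_D by blast
      consider "X (rT (Suc i)) \<omega> + c i = d" | "X (rT (Suc i)) \<omega> + c i = u" using hit_boundary[OF fin] by auto
      then show ?thesis
      proof cases
        case 1
        then have "adj_size (Suc i) \<omega> = D - d" by (simp add: \<xi>_Suc)
        moreover from this 1 have "X (rT (Suc i)) \<omega> + c (Suc i) = D" unfolding c_Suc by simp
        ultimately show ?thesis using 1 True drop(1) order by (simp add: ob_def \<phi>_def)
      next
        case 2
        then have "adj_size (Suc i) \<omega> = U - u" using order by (simp add: \<xi>_Suc)
        moreover from this 2 have "X (rT (Suc i)) \<omega> + c (Suc i) = U" unfolding c_Suc by simp
        ultimately show ?thesis using 2 True drop(2) order by (simp add: ob_def \<phi>_def)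
      qed
    next
      case False
      then show ?thesis by (simp add: ob_def)
    qed
    then show ?thesis unfolding jump_costs_def by (simp only: sum_negf[symmetric])
  qed
  ultimately show "S \<longlonglongrightarrow> jump_costs \<kappa>1 \<kappa>2 m t \<omega>"
    unfolding S_eq[abs_def] by simp
  show "\<bar>S N\<bar> \<le> real m * (2 * b)"
  proof -
    have one: "\<bar>\<Sum>j<N. (ob i (\<tau> N (Suc j)) - ob i (\<tau> N j)) * \<phi> i (X (\<tau> N (Suc j)) \<omega>)\<bar> \<le> 2 * b" for i
    proof -
      have b0: "0 \<le> b" using bd[of 0] by linarith
      have obm: "0 \<le> ob i (\<tau> N (Suc j)) - ob i (\<tau> N j)" for j
      proof -
        have "adj_time (Suc i) \<omega> \<le> ereal (\<tau> N j) \<Longrightarrow> adj_time (Suc i) \<omega> \<le> ereal (\<tau> N (Suc j))"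
          using \<tau>mono[of N j] by (metis ereal_less_eq(3) order_trans)
        then show ?thesis by (simp add: ob_def)
      qed
      have "\<bar>\<Sum>j<N. (ob i (\<tau> N (Suc j)) - ob i (\<tau> N j)) * \<phi> i (X (\<tau> N (Suc j)) \<omega>)\<bar>
        \<le> (\<Sum>j<N. (ob i (\<tau> N (Suc j)) - ob i (\<tau> N j)) * (2 * b))"
      proof (rule order_trans[OF sum_abs sum_mono])
        fix j
        have "\<bar>\<phi> i (X (\<tau> N (Suc j)) \<omega>)\<bar> \<le> 2 * b"
          using bd[of "X (\<tau> N (Suc j)) \<omega> + c (Suc i)"] bd[of "X (\<tau> N (Suc j)) \<omega> + c i"]
          unfolding \<phi>_def by linarith
        then show "\<bar>(ob i (\<tau> N (Suc j)) - ob i (\<tau> N j)) * \<phi> i (X (\<tau> N (Suc j)) \<omega>)\<bar>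
          \<le> (ob i (\<tau> N (Suc j)) - ob i (\<tau> N j)) * (2 * b)"
          unfolding abs_mult using obm[of j] by (intro mult_mono) simp_all
      qed
      also have "\<dots> = (ob i (\<tau> N N) - ob i (\<tau> N 0)) * (2 * b)"
        using sum_lessThan_telescope[of "\<lambda>j. ob i (\<tau> N j)" N] by (simp only: sum_distrib_right[symmetric])
      also have "\<dots> \<le> 1 * (2 * b)" using b0 by (intro mult_right_mono) (simp_all add: ob_def)
      finally show ?thesis by simp
    qed
    have "\<bar>S N\<bar> \<le> (\<Sum>i<m. 2 * b)"
      unfolding S_eq abs_minus_cancel by (rule order_trans[OF sum_abs sum_mono]) (rule one)
    then show ?thesis by simp
  qed
qed

text \<open>Apply \<open>dynkin_lower_bound\<close> to \<open>- f\<close>.  The bound does not depend on the truncation \<open>m\<close> except through the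
  time integral, which is at most a constant times \<open>t\<close>.\<close>

lemma truncated_dynkin:
  fixes f G q :: "real \<Rightarrow> real"
  assumes t: "0 < t"
    and f: "\<And>x. (f has_real_derivative G x) (at x)" and G: "\<And>x. (G has_real_derivative q x) (at x)"
    and uc: "uniformly_continuous_on UNIV q"
    and bd: "\<And>x. \<bar>f x\<bar> \<le> b" "\<And>x. \<bar>G x\<bar> \<le> b" "\<And>x. \<bar>q x\<bar> \<le> b"
    and drop: "f D - f d = - \<kappa>1" "f U - f u = - \<kappa>2"
  shows "(\<integral>\<omega>. jump_costs \<kappa>1 \<kappa>2 m t \<omega> \<partial>M)
    \<le> 2 * b + (\<integral>\<omega>. (LINT s:{0<..t}|lborel. \<mu> * G (truncated m s \<omega>) + \<sigma>\<^sup>2 / 2 * q (truncated m s \<omega>)) \<partial>M)"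
    (is "_ \<le> 2 * b + (\<integral>\<omega>. ?I \<omega> \<partial>M)")
proof -
  define \<tau> where "\<tau> = (\<lambda>N i. t * real i / real N)"
  define S where "S = (\<lambda>N \<omega>. \<Sum>j<N. f (truncated m (\<tau> N j) \<omega> + increment \<mu> \<sigma> W (\<tau> N j) (\<tau> N (Suc j)) \<omega>)
      - f (truncated m (\<tau> N (Suc j)) \<omega>))"
  have cont: "continuous_on UNIV f" "continuous_on UNIV G" "continuous_on UNIV q"
    using f G uc by (auto intro: continuous_on_UNIV_if_DERIV uniformly_continuous_imp_continuous)
  have [measurable]: "f \<in> borel_measurable borel"
    using cont by (auto intro: borel_measurable_continuous_onI)
  have \<tau>0: "0 \<le> \<tau> N j" for N j using t by (simp add: \<tau>_def)
  have Zm: "truncated m s \<in> borel_measurable M" if "0 \<le> s" for s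
    using truncated_adapted[OF that] measurable_F_M[OF that] by blast
  have ints: "integrable M (\<lambda>\<omega>. f (truncated m (\<tau> N j) \<omega> + increment \<mu> \<sigma> W (\<tau> N j) (\<tau> N (Suc j)) \<omega>)
      - f (truncated m (\<tau> N (Suc j)) \<omega>))" for N j
  proof -
    note [measurable] = Zm[OF \<tau>0] increment_measurable[OF \<tau>0 \<tau>0]
    show ?thesis
      by (intro Bochner_Integration.integrable_diff; rule integrable_bounded[where b = b]; use bd in measurable)
  qed
  have minor: "second_order_minorant UNIV (\<lambda>x. - f x) (\<lambda>x. - G x) (\<lambda>x. - q x)"
  proof (rule second_order_minorantI[where T = UNIV and e = 1 and Q = "\<lambda>x. - G x" and b = b])
    show "((\<lambda>x. - f x) has_real_derivative - G w) (at w)" for w by (rule DERIV_minus[OF f])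
    show "((\<lambda>x. - G x) has_real_derivative - q w) (at w)" for w by (rule DERIV_minus[OF G])
    show "uniformly_continuous_on UNIV (\<lambda>x. - q x)" by (rule uniformly_continuous_on_minus[OF uc])
  qed (use bd in \<open>simp_all add: mono_on_def\<close>)
  have dyn: "eventually (\<lambda>N. - (\<integral>\<omega>. f (truncated m 0 \<omega>) \<partial>M) - (\<integral>\<omega>. ?I \<omega> \<partial>M) - e + (\<integral>\<omega>. S N \<omega> \<partial>M)
      \<le> - (\<integral>\<omega>. f (truncated m t \<omega>) \<partial>M)) sequentially" if e: "0 < e" for e
  proof -
    have neg: "(LINT s:{0<..t}|lborel. \<mu> * - G (truncated m s \<omega>) + \<sigma>\<^sup>2 / 2 * - q (truncated m s \<omega>)) = - ?I \<omega>" for \<omega>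
    proof -
      have "(LINT s:{0<..t}|lborel. \<mu> * - G (truncated m s \<omega>) + \<sigma>\<^sup>2 / 2 * - q (truncated m s \<omega>))
        = (LINT s:{0<..t}|lborel. - (\<mu> * G (truncated m s \<omega>) + \<sigma>\<^sup>2 / 2 * q (truncated m s \<omega>)))"
        by (simp add: algebra_simps)
      then show ?thesis by (simp only: set_lebesgue_integral_def scaleR_minus_right integral_minus)
    qed
    have "eventually (\<lambda>N. (\<integral>\<omega>. - f (truncated m 0 \<omega>) \<partial>M)
        + (\<integral>\<omega>. (LINT s:{0<..t}|lborel. \<mu> * - G (truncated m s \<omega>) + \<sigma>\<^sup>2 / 2 * - q (truncated m s \<omega>)) \<partial>M) - e
        + (\<Sum>j<N. \<integral>\<omega>. - f (truncated m (\<tau> N (Suc j)) \<omega>)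
          - - f (truncated m (\<tau> N j) \<omega> + increment \<mu> \<sigma> W (\<tau> N j) (\<tau> N (Suc j)) \<omega>) \<partial>M)
      \<le> (\<integral>\<omega>. - f (truncated m t \<omega>) \<partial>M)) sequentially"
      unfolding \<tau>_def
      by (rule dynkin_lower_bound[OF t _ _ _ _ _ _ minor truncated_adapted _ truncated_right_continuous e, where b = b])
        (use cont bd in \<open>auto intro: continuous_on_minus\<close>)
    moreover have "(\<Sum>j<N. \<integral>\<omega>. - f (truncated m (\<tau> N (Suc j)) \<omega>)
          - - f (truncated m (\<tau> N j) \<omega> + increment \<mu> \<sigma> W (\<tau> N j) (\<tau> N (Suc j)) \<omega>) \<partial>M) = (\<integral>\<omega>. S N \<omega> \<partial>M)" for N
    proof -
      have "(\<integral>\<omega>. S N \<omega> \<partial>M) = (\<Sum>j<N. \<integral>\<omega>. f (truncated m (\<tau> N j) \<omega> + increment \<mu> \<sigma> W (\<tau> N j) (\<tau> N (Suc j)) \<omega>)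
        - f (truncated m (\<tau> N (Suc j)) \<omega>) \<partial>M)"
        unfolding S_def by (rule Bochner_Integration.integral_sum) (rule ints)
      then show ?thesis by (simp add: add.commute)
    qed
    ultimately show ?thesis unfolding neg by simp
  qed
  have S_lim: "(\<lambda>N. \<integral>\<omega>. S N \<omega> \<partial>M) \<longlonglongrightarrow> (\<integral>\<omega>. jump_costs \<kappa>1 \<kappa>2 m t \<omega> \<partial>M)"
  proof (rule integral_dominated_convergence[where w = "\<lambda>_. real m * (2 * b)"])
    show "jump_costs \<kappa>1 \<kappa>2 m t \<in> borel_measurable M" using t by (intro jump_costs_measurable) simp
    show "S N \<in> borel_measurable M" for N
      unfolding S_def by (intro borel_measurable_sum borel_measurable_integrable[OF ints])
    show "AE \<omega> in M. (\<lambda>N. S N \<omega>) \<longlonglongrightarrow> jump_costs \<kappa>1 \<kappa>2 m t \<omega>"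
      unfolding S_def \<tau>_def by (rule AE_I2) (rule grid_jumps_converge(1)[OF t _ cont(1) bd(1) drop])
    show "AE \<omega> in M. norm (S N \<omega>) \<le> real m * (2 * b)" for N
      unfolding S_def \<tau>_def real_norm_def by (rule AE_I2) (rule grid_jumps_converge(2)[OF t _ cont(1) bd(1) drop])
  qed simp
  have fb: "\<bar>\<integral>\<omega>. f (truncated m s \<omega>) \<partial>M\<bar> \<le> b" if "0 \<le> s" for s
  proof -
    have "integrable M (\<lambda>\<omega>. f (truncated m s \<omega>))"
      by (rule integrable_bounded[where b = b]) (use Zm[OF that] bd in measurable)
    then have "\<bar>\<integral>\<omega>. f (truncated m s \<omega>) \<partial>M\<bar> \<le> (\<integral>\<omega>. b \<partial>M)"
      by (intro order_trans[OF integral_abs_bound integral_mono] bd integrable_abs) auto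
    then show ?thesis by (simp add: prob_space)
  qed
  show ?thesis
  proof (rule field_le_epsilon)
    fix e :: real assume e: "0 < e"
    have "eventually (\<lambda>N. (\<integral>\<omega>. S N \<omega> \<partial>M) \<le> 2 * b + (\<integral>\<omega>. ?I \<omega> \<partial>M) + e) sequentially"
      using dyn[OF e]
    proof eventually_elim
      case (elim N)
      then show ?case using fb[of 0] fb[of t] t by linarith
    qed
    then show "(\<integral>\<omega>. jump_costs \<kappa>1 \<kappa>2 m t \<omega> \<partial>M) \<le> 2 * b + (\<integral>\<omega>. ?I \<omega> \<partial>M) + e"
      by (rule tendsto_upperbound[OF S_lim]) simp
  qed
qed

definition all_jump_costs :: "real \<Rightarrow> real \<Rightarrow> real \<Rightarrow> 'a \<Rightarrow> real" where
  "all_jump_costs \<kappa>1 \<kappa>2 t \<omega> = (\<Sum>i | adj_time (Suc i) \<omega> \<le> ereal t. if 0 < adj_size (Suc i) \<omega> then \<kappa>1 else \<kappa>2)"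

lemma finite_later_times: "\<omega> \<in> space M \<Longrightarrow> finite {i. adj_time (Suc i) \<omega> \<le> ereal t}"
  using finite_vimageI[OF band_path.finite_adjustments[OF path], of \<omega> Suc t] by (simp add: vimage_def)

lemma jump_costs_eventually:
  assumes "\<omega> \<in> space M"
  shows "eventually (\<lambda>m. jump_costs \<kappa>1 \<kappa>2 m t \<omega> = all_jump_costs \<kappa>1 \<kappa>2 t \<omega>) sequentially"
proof -
  let ?A = "{i. adj_time (Suc i) \<omega> \<le> ereal t}"
  obtain n where n: "?A \<subseteq> {..<n}" using finite_later_times[OF assms] finite_nat_iff_bounded by blast
  have "jump_costs \<kappa>1 \<kappa>2 m t \<omega> = all_jump_costs \<kappa>1 \<kappa>2 t \<omega>" if "n \<le> m" for m
  proof -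
    have "?A \<subseteq> {..<m}" using n that by force
    then have "all_jump_costs \<kappa>1 \<kappa>2 t \<omega> = (\<Sum>i\<in>{..<m} \<inter> ?A. if 0 < adj_size (Suc i) \<omega> then \<kappa>1 else \<kappa>2)"
      unfolding all_jump_costs_def by (simp only: Int_absorb1)
    also have "\<dots> = jump_costs \<kappa>1 \<kappa>2 m t \<omega>"
      unfolding jump_costs_def sum.inter_restrict[of "{..<m}" _ ?A, OF finite_lessThan]
      by (intro sum.cong) simp_all
    finally show ?thesis by simp
  qed
  then show ?thesis unfolding eventually_sequentially by blast
qed

lemma all_jump_costs_measurable:
  assumes "0 \<le> t" shows "all_jump_costs \<kappa>1 \<kappa>2 t \<in> borel_measurable M"
proof (rule borel_measurable_LIMSEQ_real)
  fix \<omega> assume "\<omega> \<in> space M"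
  from jump_costs_eventually[OF this, of \<kappa>1 \<kappa>2 t]
  show "(\<lambda>m. jump_costs \<kappa>1 \<kappa>2 m t \<omega>) \<longlonglongrightarrow> all_jump_costs \<kappa>1 \<kappa>2 t \<omega>"
    by (rule tendsto_eventually)
qed (rule jump_costs_measurable[OF assms])

text \<open>Let \<open>m \<rightarrow> \<infinity>\<close>: the time integrals converge boundedly, and Fatou's lemma transfers the bound from the
  truncated costs to all adjustment costs.  With positive costs, the number of adjustments is thus integrable.\<close>

lemma band_cost_bound:
  fixes f G q :: "real \<Rightarrow> real"
  assumes t: "0 < t"
    and f: "\<And>x. (f has_real_derivative G x) (at x)" and G: "\<And>x. (G has_real_derivative q x) (at x)"
    and uc: "uniformly_continuous_on UNIV q"
    and bd: "\<And>x. \<bar>f x\<bar> \<le> b" "\<And>x. \<bar>G x\<bar> \<le> b" "\<And>x. \<bar>q x\<bar> \<le> b"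
    and drop: "f D - f d = - \<kappa>1" "f U - f u = - \<kappa>2" and \<kappa>: "0 \<le> \<kappa>1" "0 \<le> \<kappa>2"
    and \<eta>: "\<And>z. \<eta> z = \<gamma> - (\<mu> * G z + \<sigma>\<^sup>2 / 2 * q z)" "\<And>z. d < z \<Longrightarrow> z < u \<Longrightarrow> 0 \<le> \<eta> z"
  defines "I \<equiv> \<lambda>\<omega>. LINT s:{0<..t}|lborel. \<eta> (Z s \<omega>)"
  shows "(\<integral>\<^sup>+\<omega>. ennreal (all_jump_costs \<kappa>1 \<kappa>2 t \<omega> + I \<omega>) \<partial>M) \<le> ennreal (2 * b + \<gamma> * t)"
    and "I \<in> borel_measurable M" and "\<And>\<omega>. \<omega> \<in> space M \<Longrightarrow> 0 \<le> I \<omega>"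
    and "\<And>\<omega>. \<omega> \<in> space M \<Longrightarrow> set_integrable lborel {0<..t} (\<lambda>s. \<eta> (Z s \<omega>))"
proof -
  define \<Gamma> where "\<Gamma> = (\<lambda>z. \<mu> * G z + \<sigma>\<^sup>2 / 2 * q z)"
  define \<beta> where "\<beta> = \<bar>\<mu>\<bar> * b + \<sigma>\<^sup>2 / 2 * b"
  have cont: "continuous_on UNIV f" "continuous_on UNIV G" "continuous_on UNIV q"
    using f G uc by (auto intro: continuous_on_UNIV_if_DERIV uniformly_continuous_imp_continuous)
  have contG: "continuous_on UNIV \<Gamma>" unfolding \<Gamma>_def using cont by (intro continuous_intros)
  have bdG: "\<bar>\<Gamma> x\<bar> \<le> \<beta>" for x
    unfolding \<Gamma>_def \<beta>_def by (rule generator_bounded) (rule bd)+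
  have Zm: "truncated m s \<in> borel_measurable M" "Z s \<in> borel_measurable M" if "0 \<le> s" for m s
    using truncated_adapted[OF that] Z_adapted[OF that] measurable_F_M[OF that] by blast+
  define It where "It = (\<lambda>m \<omega>. LINT s:{0<..t}|lborel. \<Gamma> (truncated m s \<omega>))"
  define IZ where "IZ = (\<lambda>\<omega>. LINT s:{0<..t}|lborel. \<Gamma> (Z s \<omega>))"
  have It_m: "It m \<in> borel_measurable M" for m
    unfolding It_def by (rule time_integral_right_continuous(1)[OF t contG bdG Zm(1) truncated_right_continuous])
  have It_b: "\<bar>It m \<omega>\<bar> \<le> \<beta> * t" if "\<omega> \<in> space M" for m \<omega>
    unfolding It_def by (rule time_integral_right_continuous(2)[OF t contG bdG Zm(1) truncated_right_continuous that])
  have IZ_m: "IZ \<in> borel_measurable M"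
    unfolding IZ_def by (rule time_integral_right_continuous(1)[OF t contG bdG Zm(2) Z_right_continuous])
  have IZ_b: "\<bar>IZ \<omega>\<bar> \<le> \<beta> * t" if "\<omega> \<in> space M" for \<omega>
    unfolding IZ_def by (rule time_integral_right_continuous(2)[OF t contG bdG Zm(2) Z_right_continuous that])
  have IZ_s: "set_integrable lborel {0<..t} (\<lambda>s. \<Gamma> (Z s \<omega>))" if "\<omega> \<in> space M" for \<omega>
    by (rule time_integral_right_continuous(3)[OF t contG bdG Zm(2) Z_right_continuous that])
  have sc: "set_integrable lborel {0<..t} (\<lambda>_. \<gamma>)"
    using t by (simp add: set_integrable_def)
  have \<eta>': "\<eta> z = \<gamma> - \<Gamma> z" for z unfolding \<Gamma>_def by (rule \<eta>)
  show "set_integrable lborel {0<..t} (\<lambda>s. \<eta> (Z s \<omega>))" if "\<omega> \<in> space M" for \<omega>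
    unfolding \<eta>' by (rule set_integral_diff(1)[OF sc IZ_s[OF that]])
  have I_eq: "I \<omega> = \<gamma> * t - IZ \<omega>" if "\<omega> \<in> space M" for \<omega>
    unfolding I_def \<eta>' IZ_def set_integral_diff(2)[OF sc IZ_s[OF that]]
    using t by (simp add: set_lebesgue_integral_def)
  show Im: "I \<in> borel_measurable M"
    by (rule measurable_cong[THEN iffD2, OF I_eq]) (use IZ_m in measurable)
  show I0: "0 \<le> I \<omega>" if "\<omega> \<in> space M" for \<omega>
    unfolding I_def set_lebesgue_integral_def
  proof (rule integral_nonneg_AE, rule AE_I2)
    fix s
    show "0 \<le> indicator {0<..t} s *\<^sub>R \<eta> (Z s \<omega>)"
      using \<eta>(2)[of "Z s \<omega>"] Z_inside[of s \<omega>] that by (cases "s \<in> {0<..t}") simp_all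
  qed
  have Iint: "integrable M I"
  proof (rule integrable_const_bound[where B = "\<bar>\<gamma> * t\<bar> + \<beta> * t"])
    show "AE \<omega> in M. norm (I \<omega>) \<le> \<bar>\<gamma> * t\<bar> + \<beta> * t"
    proof (rule AE_I2)
      fix \<omega> assume "\<omega> \<in> space M"
      from I_eq[OF this] IZ_b[OF this] show "norm (I \<omega>) \<le> \<bar>\<gamma> * t\<bar> + \<beta> * t"
        unfolding real_norm_def by linarith
    qed
  qed (rule Im)
  have IZint: "integrable M IZ"
    by (rule integrable_const_bound[where B = "\<beta> * t"]) (use IZ_b IZ_m in auto)
  have EI: "(\<integral>\<omega>. I \<omega> \<partial>M) = \<gamma> * t - (\<integral>\<omega>. IZ \<omega> \<partial>M)"
  proof -
    have "(\<integral>\<omega>. I \<omega> \<partial>M) = (\<integral>\<omega>. \<gamma> * t - IZ \<omega> \<partial>M)" by (rule Bochner_Integration.integral_cong[OF refl I_eq])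
    then show ?thesis using IZint by (simp add: prob_space)
  qed
  have It_lim: "(\<lambda>m. \<integral>\<omega>. It m \<omega> \<partial>M) \<longlonglongrightarrow> (\<integral>\<omega>. IZ \<omega> \<partial>M)"
  proof (rule integral_dominated_convergence[where w = "\<lambda>_. \<beta> * t"])
    show "AE \<omega> in M. (\<lambda>m. It m \<omega>) \<longlonglongrightarrow> IZ \<omega>"
    proof (rule AE_I2)
      fix \<omega> assume \<omega>: "\<omega> \<in> space M"
      have t0: "0 \<le> t" using t by simp
      obtain m0 where m0: "\<And>m s. m0 \<le> m \<Longrightarrow> s \<le> t \<Longrightarrow> truncated m s \<omega> = Z s \<omega>"
        by (rule truncated_eventually[OF \<omega> t0]) blast
      have "It m \<omega> = IZ \<omega>" if "m0 \<le> m" for m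
        unfolding It_def IZ_def by (rule set_lebesgue_integral_cong) (use m0[OF that] in simp_all)
      then show "(\<lambda>m. It m \<omega>) \<longlonglongrightarrow> IZ \<omega>"
        by (intro tendsto_eventually) (auto simp: eventually_sequentially)
    qed
    show "AE \<omega> in M. norm (It m \<omega>) \<le> \<beta> * t" for m
      unfolding real_norm_def by (rule AE_I2) (rule It_b)
  qed (use It_m IZ_m in simp_all)
  let ?J = "\<lambda>m. jump_costs \<kappa>1 \<kappa>2 m t"
  have t0: "0 \<le> t" using t by simp
  have Jm: "?J m \<in> borel_measurable M" for m by (rule jump_costs_measurable[OF t0])
  have Jint: "integrable M (?J m)" for m
    by (rule integrable_bounded[where b = "real m * (\<kappa>1 + \<kappa>2)"])
      (use Jm jump_costs_bounds[OF \<kappa>, of m t] in simp_all)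
  have step: "(\<integral>\<^sup>+\<omega>. ennreal (?J m \<omega> + I \<omega>) \<partial>M) \<le> ennreal (2 * b + (\<integral>\<omega>. It m \<omega> \<partial>M) + (\<integral>\<omega>. I \<omega> \<partial>M))" for m
  proof -
    have "(\<integral>\<^sup>+\<omega>. ennreal (?J m \<omega> + I \<omega>) \<partial>M) = ennreal (\<integral>\<omega>. ?J m \<omega> + I \<omega> \<partial>M)"
    proof (rule nn_integral_eq_integral)
      show "integrable M (\<lambda>\<omega>. ?J m \<omega> + I \<omega>)" by (rule Bochner_Integration.integrable_add[OF Jint Iint])
      show "AE \<omega> in M. 0 \<le> ?J m \<omega> + I \<omega>"
        by (rule AE_I2) (intro add_nonneg_nonneg jump_costs_bounds(1)[OF \<kappa>] I0)
    qed
    also have "(\<integral>\<omega>. ?J m \<omega> + I \<omega> \<partial>M) = (\<integral>\<omega>. ?J m \<omega> \<partial>M) + (\<integral>\<omega>. I \<omega> \<partial>M)"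
      by (rule Bochner_Integration.integral_add[OF Jint Iint])
    also have "ennreal \<dots> \<le> ennreal (2 * b + (\<integral>\<omega>. It m \<omega> \<partial>M) + (\<integral>\<omega>. I \<omega> \<partial>M))"
      unfolding It_def \<Gamma>_def by (intro ennreal_leI add_right_mono truncated_dynkin[OF t f G uc bd drop])
    finally show ?thesis .
  qed
  have "(\<integral>\<^sup>+\<omega>. ennreal (all_jump_costs \<kappa>1 \<kappa>2 t \<omega> + I \<omega>) \<partial>M)
      = (\<integral>\<^sup>+\<omega>. liminf (\<lambda>m. ennreal (?J m \<omega> + I \<omega>)) \<partial>M)"
  proof (rule nn_integral_cong)
    fix \<omega> assume \<omega>: "\<omega> \<in> space M"
    have "eventually (\<lambda>m. ennreal (?J m \<omega> + I \<omega>) = ennreal (all_jump_costs \<kappa>1 \<kappa>2 t \<omega> + I \<omega>)) sequentially"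
      using jump_costs_eventually[OF \<omega>, of \<kappa>1 \<kappa>2 t] by eventually_elim simp
    then have "(\<lambda>m. ennreal (?J m \<omega> + I \<omega>)) \<longlonglongrightarrow> ennreal (all_jump_costs \<kappa>1 \<kappa>2 t \<omega> + I \<omega>)"
      by (rule tendsto_eventually)
    then show "ennreal (all_jump_costs \<kappa>1 \<kappa>2 t \<omega> + I \<omega>) = liminf (\<lambda>m. ennreal (?J m \<omega> + I \<omega>))"
      using lim_imp_Liminf[OF sequentially_bot] by metis
  qed
  also have "\<dots> \<le> liminf (\<lambda>m. \<integral>\<^sup>+\<omega>. ennreal (?J m \<omega> + I \<omega>) \<partial>M)"
    by (rule nn_integral_liminf) (use Jm Im in measurable)
  also have "\<dots> \<le> liminf (\<lambda>m. ennreal (2 * b + (\<integral>\<omega>. It m \<omega> \<partial>M) + (\<integral>\<omega>. I \<omega> \<partial>M)))"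
    by (rule Liminf_mono) (simp add: step)
  also have "\<dots> = ennreal (2 * b + (\<integral>\<omega>. IZ \<omega> \<partial>M) + (\<integral>\<omega>. I \<omega> \<partial>M))"
    by (rule lim_imp_Liminf[OF sequentially_bot])
      (intro tendsto_ennrealI tendsto_add tendsto_const It_lim)
  also have "\<dots> = ennreal (2 * b + \<gamma> * t)" by (simp add: EI)
  finally show "(\<integral>\<^sup>+\<omega>. ennreal (all_jump_costs \<kappa>1 \<kappa>2 t \<omega> + I \<omega>) \<partial>M) \<le> ennreal (2 * b + \<gamma> * t)" .
qed

lemma adj_size_0: "\<omega> \<in> space M \<Longrightarrow> adj_size 0 \<omega> = (if x \<le> d then D - x else if x < u then 0 else U - x)"
  using W_0 by (simp add: band_jump_def Let_def brownian_netput_def)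

text \<open>The processes \<open>band_up\<close> and \<open>band_down\<close> are the instances of this for the positive and the negative part.\<close>

definition weighted :: "(real \<Rightarrow> real) \<Rightarrow> real \<Rightarrow> 'a \<Rightarrow> real" where
  "weighted w t \<omega> = (\<Sum>n | adj_time n \<omega> \<le> ereal t. w (adj_size n \<omega>))"

lemma band_up_eq: "band_up d D U u X = weighted (\<lambda>z. max 0 z)"
  and band_down_eq: "band_down d D U u X = weighted (\<lambda>z. max 0 (- z))"
  by (simp_all add: fun_eq_iff band_up_def band_down_def weighted_def)

lemma weighted_eq: "\<omega> \<in> space M \<Longrightarrow> weighted w t \<omega> = band_path.adjusted d D U u (path \<omega>) (\<lambda>n. w (adj_size n \<omega>)) t"
  by (simp add: weighted_def band_path.adjusted_def[OF path])

lemma weighted_adapted: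
  assumes t: "0 \<le> t" and [measurable]: "w \<in> borel_measurable borel" and w0: "w 0 = 0"
  shows "weighted w t \<in> borel_measurable (F t)"
proof (rule borel_measurable_LIMSEQ_real)
  fix \<omega> assume "\<omega> \<in> space (F t)"
  then have \<omega>: "\<omega> \<in> space M" using space_F by simp
  let ?A = "{i. adj_time i \<omega> \<le> ereal t}"
  obtain n where n: "?A \<subseteq> {..<n}" using band_path.finite_adjustments[OF path[OF \<omega>]] finite_nat_iff_bounded by blast
  have "(\<Sum>i<m. w (of_bool (adj_time i \<omega> \<le> ereal t) * adj_size i \<omega>)) = weighted w t \<omega>" if "n \<le> m" for m
  proof -
    have "?A \<subseteq> {..<m}" using n that by force
    then have "weighted w t \<omega> = (\<Sum>i\<in>{..<m} \<inter> ?A. w (adj_size i \<omega>))"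
      unfolding weighted_def by (simp only: Int_absorb1)
    also have "\<dots> = (\<Sum>i<m. w (of_bool (adj_time i \<omega> \<le> ereal t) * adj_size i \<omega>))"
      unfolding sum.inter_restrict[of "{..<m}" _ ?A, OF finite_lessThan]
      by (intro sum.cong) (simp_all add: w0)
    finally show ?thesis by simp
  qed
  then show "(\<lambda>m. \<Sum>i<m. w (of_bool (adj_time i \<omega> \<le> ereal t) * adj_size i \<omega>)) \<longlonglongrightarrow> weighted w t \<omega>"
    by (intro tendsto_eventually) (auto simp: eventually_sequentially)
next
  fix m
  have "(\<lambda>\<omega>. w (of_bool (adj_time i \<omega> \<le> ereal t) * adj_size i \<omega>)) \<in> borel_measurable (F t)" for i
    by (rule measurable_compose[OF \<xi>_adapted[OF t]]) measurable
  then show "(\<lambda>\<omega>. \<Sum>i<m. w (of_bool (adj_time i \<omega> \<le> ereal t) * adj_size i \<omega>)) \<in> borel_measurable (F t)"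
    by (rule borel_measurable_sum)
qed

lemma weighted_control_process:
  assumes "w \<in> borel_measurable borel" "w 0 = 0" and w: "\<And>z. 0 \<le> w z"
  shows "control_process M F (weighted w)"
  unfolding control_process_def
proof (intro conjI allI ballI impI)
  fix t :: real assume "0 \<le> t"
  then show "weighted w t \<in> borel_measurable (F t)" by (rule weighted_adapted[OF _ assms(1,2)])
next
  fix \<omega> assume \<omega>: "\<omega> \<in> space M"
  interpret band_path d D U u "path \<omega>" by (rule path[OF \<omega>])
  have eq: "(\<lambda>t. weighted w t \<omega>) = adjusted (\<lambda>n. w (adj_size n \<omega>))"
    using weighted_eq[OF \<omega>] by (rule ext)
  show "0 \<le> weighted w 0 \<omega>" unfolding weighted_def by (rule sum_nonneg) (rule w)
  show "mono_on {0..} (\<lambda>t. weighted w t \<omega>)" unfolding eq by (rule adjusted_mono) (rule w)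
  show "continuous (at_right t) (\<lambda>t. weighted w t \<omega>)" if "0 \<le> t" for t
    unfolding eq by (rule adjusted_right_continuous[OF that])
  show "\<exists>l. ((\<lambda>t. weighted w t \<omega>) \<longlongrightarrow> l) (at_left t)" if "0 < t" for t
    unfolding eq by (rule adjusted_left_limit[OF that, of "\<lambda>n. w (adj_size n \<omega>)"]) blast
qed

lemma weighted_count:
  assumes \<omega>: "\<omega> \<in> space M" and w: "\<And>z. 0 \<le> w z"
  shows "adjustment_count (weighted w) t \<omega> \<le> of_nat (card {n. adj_time n \<omega> \<le> ereal t \<and> 0 < w (adj_size n \<omega>)})"
proof -
  interpret band_path d D U u "path \<omega>" by (rule path[OF \<omega>])
  have eq: "(\<lambda>t. weighted w t \<omega>) = adjusted (\<lambda>n. w (adj_size n \<omega>))"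
    using weighted_eq[OF \<omega>] by (rule ext)
  show ?thesis unfolding adjustment_count_def eq by (rule count_adjusted_le) (rule w)
qed

lemma inventory_band:
  assumes "\<omega> \<in> space M"
  shows "inventory X (band_up d D U u X) (band_down d D U u X) t \<omega> = Z t \<omega>"
proof -
  have "weighted (\<lambda>z. max 0 z) t \<omega> - weighted (\<lambda>z. max 0 (- z)) t \<omega>
    = (\<Sum>n | adj_time n \<omega> \<le> ereal t. adj_size n \<omega>)"
    unfolding weighted_def sum_subtractf[symmetric] by (intro sum.cong) auto
  then show ?thesis
    unfolding inventory_def band_up_eq band_down_eq Z_def band_path.adjusted_def[OF path[OF assms]]
    by simp
qed

definition initial_cost :: "real \<Rightarrow> real \<Rightarrow> real \<Rightarrow> real \<Rightarrow> real" where
  "initial_cost K L k l = (let v = (if x \<le> d then D - x else if x < u then 0 else U - x)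
     in adjustment_cost K L k l (max 0 v) (max 0 (- v)))"

text \<open>Only an inequality is claimed because the number of increasing points has only been bounded
  from above.\<close>

lemma pathwise_adjustment_cost:
  assumes \<omega>: "\<omega> \<in> space M" and t: "0 \<le> t" and cost: "0 \<le> K" "0 \<le> L" "0 \<le> k" "0 \<le> l"
  shows "ennreal K * adjustment_count (band_up d D U u X) t \<omega> + ennreal L * adjustment_count (band_down d D U u X) t \<omega>
      + ennreal k * ennreal (band_up d D U u X t \<omega>) + ennreal l * ennreal (band_down d D U u X t \<omega>)
    \<le> ennreal (initial_cost K L k l + all_jump_costs (K + k * (D - d)) (L + l * (u - U)) t \<omega>)"
proof -
  interpret band_path d D U u "path \<omega>" by (rule path[OF \<omega>])
  let ?A = "{n. adj_time n \<omega> \<le> ereal t}"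
  define a where "a = (\<lambda>n. max 0 (adj_size n \<omega>))"
  define b where "b = (\<lambda>n. max 0 (- adj_size n \<omega>))"
  define n1 where "n1 = card {n. adj_time n \<omega> \<le> ereal t \<and> 0 < a n}"
  define n2 where "n2 = card {n. adj_time n \<omega> \<le> ereal t \<and> 0 < b n}"
  have fin: "finite ?A" by (rule finite_adjustments)
  have Y: "band_up d D U u X t \<omega> = sum a ?A" "band_down d D U u X t \<omega> = sum b ?A"
    unfolding band_up_eq band_down_eq weighted_def a_def b_def by simp_all
  have Y0: "0 \<le> sum a ?A" "0 \<le> sum b ?A" by (rule sum_nonneg; simp add: a_def b_def)+
  have cnt: "adjustment_count (band_up d D U u X) t \<omega> \<le> of_nat n1"
    "adjustment_count (band_down d D U u X) t \<omega> \<le> of_nat n2"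
    unfolding band_up_eq band_down_eq n1_def n2_def a_def b_def by (rule weighted_count[OF \<omega>], simp)+
  have card: "(\<Sum>n\<in>?A. of_bool (Q n) :: real) = real (card {n. adj_time n \<omega> \<le> ereal t \<and> Q n})" for Q
  proof -
    have "?A \<inter> {n. Q n} = {n. adj_time n \<omega> \<le> ereal t \<and> Q n}" by auto
    then show ?thesis using fin by (simp only: sum_of_bool_eq)
  qed
  have "(\<Sum>n\<in>?A. adjustment_cost K L k l (a n) (b n)) = K * (\<Sum>n\<in>?A. of_bool (0 < a n))
      + L * (\<Sum>n\<in>?A. of_bool (0 < b n)) + k * sum a ?A + l * sum b ?A"
    unfolding adjustment_cost_def by (simp only: sum.distrib sum_distrib_left)
  then have tot: "(\<Sum>n\<in>?A. adjustment_cost K L k l (a n) (b n)) = K * real n1 + L * real n2 + k * sum a ?A + l * sum b ?A"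
    unfolding card n1_def n2_def .
  have split: "?A = insert 0 (Suc ` {i. adj_time (Suc i) \<omega> \<le> ereal t})"
  proof (rule set_eqI)
    fix n
    have "adj_time 0 \<omega> \<le> ereal t" using t T_0 by simp
    then show "n \<in> ?A \<longleftrightarrow> n \<in> insert 0 (Suc ` {i. adj_time (Suc i) \<omega> \<le> ereal t})"
      by (cases n) auto
  qed
  have "(\<Sum>n\<in>?A. adjustment_cost K L k l (a n) (b n)) = adjustment_cost K L k l (a 0) (b 0)
      + (\<Sum>i | adj_time (Suc i) \<omega> \<le> ereal t. adjustment_cost K L k l (a (Suc i)) (b (Suc i)))"
    unfolding split using finite_later_times[OF \<omega>, of t]
    by (subst sum.insert) (simp_all add: sum.reindex)
  also have "adjustment_cost K L k l (a 0) (b 0) = initial_cost K L k l"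
    unfolding a_def b_def adj_size_0[OF \<omega>] initial_cost_def Let_def ..
  also have "(\<Sum>i | adj_time (Suc i) \<omega> \<le> ereal t. adjustment_cost K L k l (a (Suc i)) (b (Suc i)))
      = all_jump_costs (K + k * (D - d)) (L + l * (u - U)) t \<omega>"
    unfolding all_jump_costs_def
  proof (rule sum.cong[OF refl])
    fix i assume "i \<in> {i. adj_time (Suc i) \<omega> \<le> ereal t}"
    then have "adj_time (Suc i) \<omega> < \<infinity>" using T_le_D[of "Suc i" t] by simp
    from jump_size[OF this] order
    show "adjustment_cost K L k l (a (Suc i)) (b (Suc i))
        = (if 0 < adj_size (Suc i) \<omega> then K + k * (D - d) else L + l * (u - U))"
      unfolding a_def b_def adjustment_cost_def by (elim disjE) simp_all
  qed
  finally have tot': "K * real n1 + L * real n2 + k * sum a ?A + l * sum b ?A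
      = initial_cost K L k l + all_jump_costs (K + k * (D - d)) (L + l * (u - U)) t \<omega>" using tot by simp
  have "ennreal K * adjustment_count (band_up d D U u X) t \<omega> + ennreal L * adjustment_count (band_down d D U u X) t \<omega>
      + ennreal k * ennreal (band_up d D U u X t \<omega>) + ennreal l * ennreal (band_down d D U u X t \<omega>)
    \<le> ennreal K * of_nat n1 + ennreal L * of_nat n2 + ennreal k * ennreal (sum a ?A) + ennreal l * ennreal (sum b ?A)"
    unfolding Y by (intro add_mono mult_left_mono cnt order_refl) simp_all
  also have "\<dots> = ennreal (K * real n1 + L * real n2 + k * sum a ?A + l * sum b ?A)"
  proof -
    have "0 \<le> K * real n1" "0 \<le> L * real n2" "0 \<le> k * sum a ?A" "0 \<le> l * sum b ?A"
      using cost Y0 by (intro mult_nonneg_nonneg; simp)+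
    then show ?thesis using cost Y0
      by (simp add: ennreal_plus ennreal_mult' ennreal_of_nat_eq_real_of_nat)
  qed
  also have "\<dots> = ennreal (initial_cost K L k l + all_jump_costs (K + k * (D - d)) (L + l * (u - U)) t \<omega>)"
    unfolding tot' ..
  finally show ?thesis .
qed

end

section \<open>Average costs\<close>

lemma ennreal_integral_le_nn_integral:
  fixes f :: "'a \<Rightarrow> real"
  assumes "\<And>x. 0 \<le> f x" shows "ennreal (integral\<^sup>L M f) \<le> (\<integral>\<^sup>+x. ennreal (f x) \<partial>M)"
proof (cases "integrable M f")
  case True
  then show ?thesis using nn_integral_eq_integral[OF True] assms by simp
next
  case False
  then show ?thesis by (simp add: not_integrable_integral_eq)
qed

lemma averaged_affine_tendsto: "((\<lambda>t::real. ennreal ((\<gamma> * t + c) / t)) \<longlongrightarrow> ennreal \<gamma>) at_top"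
proof (rule tendsto_ennrealI)
  have "((\<lambda>t::real. \<gamma> + c / t) \<longlongrightarrow> \<gamma> + 0) at_top"
    by (intro tendsto_add tendsto_const real_tendsto_divide_at_top[OF tendsto_const filterlim_ident])
  moreover have "eventually (\<lambda>t::real. \<gamma> + c / t = (\<gamma> * t + c) / t) at_top"
    using eventually_gt_at_top[of 0] by eventually_elim (simp add: add_divide_distrib)
  ultimately show "((\<lambda>t::real. (\<gamma> * t + c) / t) \<longlongrightarrow> \<gamma>) at_top"
    using Lim_transform_eventually by fastforce
qed

lemma ennreal_divide_real: "0 < t \<Longrightarrow> ennreal a / ennreal t = ennreal (a / t)"
proof (cases "0 \<le> a")
  case True
  assume "0 < t"
  then show ?thesis using True by (simp add: divide_ennreal)
next
  case False
  assume "0 < t"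
  then have "a / t \<le> 0" using False by (simp add: divide_nonpos_pos)
  then show ?thesis using False by (simp add: ennreal_neg)
qed

locale inventory_model = brownian_motion M F W + free_boundary \<mu> \<sigma> K L k l a h d D U u A B
  for M :: "'a measure" and F :: "real \<Rightarrow> 'a measure" and W :: "real \<Rightarrow> 'a \<Rightarrow> real"
    and \<mu> \<sigma> K L k l a :: real and h :: "real \<Rightarrow> real" and d D U u A B :: real
begin

definition expected_cost :: "real \<Rightarrow> (real \<Rightarrow> 'a \<Rightarrow> real) \<Rightarrow> (real \<Rightarrow> 'a \<Rightarrow> real) \<Rightarrow> real \<Rightarrow> ennreal" where
  "expected_cost x Y1 Y2 t = (\<integral>\<^sup>+\<omega>.
     (\<integral>\<^sup>+s\<in>{0..t}. ennreal (h (inventory (brownian_netput \<mu> \<sigma> W x) Y1 Y2 s \<omega>)) \<partial>lborel)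
     + ennreal K * adjustment_count Y1 t \<omega> + ennreal L * adjustment_count Y2 t \<omega>
     + ennreal k * ennreal (Y1 t \<omega>) + ennreal l * ennreal (Y2 t \<omega>) \<partial>M)"

lemma average_cost_eq:
  "average_cost M h K L k l (brownian_netput \<mu> \<sigma> W x) Y1 Y2
    = Limsup at_top (\<lambda>t. expected_cost x Y1 Y2 t / ennreal t)"
  by (simp add: average_cost_def expected_cost_def)

text \<open>The initial level is raised to \<open>x + e\<close>, which lifts the whole inventory by \<open>e\<close>.  Replacing \<open>H\<close> by \<open>max 0 (H z - \<delta>)\<close>
  compensates for the shift of the argument, and lowers the rate \<open>\<gamma>\<close> by \<open>\<delta>\<close> only.  The constant \<open>b\<close>
  does not depend on \<open>e\<close>.\<close>

lemma feasible_cost_lower_bound: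
  obtains b where "\<And>x V1 V2 t. 0 \<le> x \<Longrightarrow> 0 < t \<Longrightarrow> feasible_policy M F (brownian_netput \<mu> \<sigma> W x) V1 V2
    \<Longrightarrow> ennreal (\<gamma> * t - 2 * b) \<le> expected_cost x V1 V2 t"
proof (rule lower_test_function)
  fix f G q H b
  assume cont: "continuous_on UNIV f" "continuous_on UNIV G" "continuous_on UNIV q" "continuous_on UNIV H"
    and uc: "uniformly_continuous_on UNIV H"
    and bd: "\<And>x. \<bar>f x\<bar> \<le> b" "\<And>x. \<bar>G x\<bar> \<le> b" "\<And>x. \<bar>q x\<bar> \<le> b" "\<And>x. \<bar>H x\<bar> \<le> b"
    and H: "\<And>x. 0 \<le> H x" "\<And>x. 0 \<le> x \<Longrightarrow> H x \<le> h x"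
    and minor: "\<And>e. 0 < e \<Longrightarrow> second_order_minorant {e..} f G q"
    and up: "\<And>z p. 0 \<le> z \<Longrightarrow> 0 < p \<Longrightarrow> f z - K - k * p \<le> f (z + p)"
    and down: "\<And>z p. 0 \<le> z - p \<Longrightarrow> 0 < p \<Longrightarrow> f z - L - l * p \<le> f (z - p)"
    and gen: "\<And>z. \<gamma> - H z \<le> \<mu> * G z + \<sigma>\<^sup>2 / 2 * q z"
  have "ennreal (\<gamma> * t - 2 * b) \<le> expected_cost x V1 V2 t"
    if x: "0 \<le> x" and t: "0 < t" and feas: "feasible_policy M F (brownian_netput \<mu> \<sigma> W x) V1 V2" for x V1 V2 t
  proof (rule ennreal_le_of_all_slack)
    fix \<epsilon> :: real assume \<epsilon>: "0 < \<epsilon>"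
    define \<delta> where "\<delta> = \<epsilon> / t"
    have \<delta>: "0 < \<delta>" "\<delta> * t = \<epsilon>" using \<epsilon> t by (simp_all add: \<delta>_def)
    obtain r where r: "0 < r" "\<And>y z. dist z y < r \<Longrightarrow> dist (H z) (H y) < \<delta>"
      using uc \<delta>(1) unfolding uniformly_continuous_on_def by (meson UNIV_I)
    define e where "e = r / 2"
    have e: "0 < e" "e < r" using r by (simp_all add: e_def)
    define H' where "H' = (\<lambda>z. max 0 (H z - \<delta>))"
    let ?Z = "inventory (brownian_netput \<mu> \<sigma> W x) V1 V2"
    let ?Z' = "inventory (brownian_netput \<mu> \<sigma> W (x + e)) V1 V2"
    have Z': "?Z' s \<omega> = ?Z s \<omega> + e" for s \<omega> by (simp add: inventory_def brownian_netput_def)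
    have Z0: "0 \<le> ?Z s \<omega>" if "0 \<le> s" "\<omega> \<in> space M" for s \<omega>
      using feas that by (simp add: feasible_policy_def)
    have "ennreal ((\<gamma> - \<delta>) * t - 2 * b) \<le> (\<integral>\<^sup>+\<omega>. ennreal (LINT s:{0<..t}|lborel. H' (?Z' s \<omega>))
       + ennreal K * adjustment_count V1 t \<omega> + ennreal L * adjustment_count V2 t \<omega>
       + ennreal k * ennreal (V1 t \<omega>) + ennreal l * ennreal (V2 t \<omega>) \<partial>M)"
    proof (rule cost_lower_bound[OF t e(1), where f = f and G = G and q = q and H = H' and b = b and \<gamma> = "\<gamma> - \<delta>"])
      show "control_process M F V1" "control_process M F V2"
        "(\<integral>\<^sup>+\<omega>. ennreal (V1 t \<omega>) \<partial>M) < \<infinity>" "(\<integral>\<^sup>+\<omega>. ennreal (V2 t \<omega>) \<partial>M) < \<infinity>"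
        using feas t by (simp_all add: feasible_policy_def)
      show "continuous_on UNIV H'" unfolding H'_def using cont(4) by (intro continuous_intros)
      show "\<bar>H' z\<bar> \<le> b" for z using bd(4)[of z] H(1)[of z] \<delta>(1) unfolding H'_def by linarith
      show "0 \<le> H' z" for z by (simp add: H'_def)
      show "\<gamma> - \<delta> - H' z \<le> \<mu> * G z + \<sigma>\<^sup>2 / 2 * q z" for z
        using gen[of z] unfolding H'_def by linarith
      show "e \<le> ?Z' s \<omega>" if "0 \<le> s" "\<omega> \<in> space M" for s \<omega>
        using Z0[OF that] by (simp add: Z')
      show "0 \<le> K" "0 \<le> L" "0 \<le> k" "0 \<le> l" "0 \<le> x + e" using pos x e by simp_all
    qed (fact cont bd up down minor[OF e(1)])+
    also have "\<dots> \<le> expected_cost x V1 V2 t"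
      unfolding expected_cost_def
    proof (intro nn_integral_mono add_mono order_refl)
      fix \<omega> assume \<omega>: "\<omega> \<in> space M"
      have "ennreal (LINT s:{0<..t}|lborel. H' (?Z' s \<omega>))
          \<le> (\<integral>\<^sup>+s. ennreal (indicator {0<..t} s *\<^sub>R H' (?Z' s \<omega>)) \<partial>lborel)"
        unfolding set_lebesgue_integral_def by (rule ennreal_integral_le_nn_integral) (simp add: H'_def)
      also have "\<dots> \<le> (\<integral>\<^sup>+s\<in>{0..t}. ennreal (h (?Z s \<omega>)) \<partial>lborel)"
      proof (rule nn_integral_mono)
        fix s
        show "ennreal (indicator {0<..t} s *\<^sub>R H' (?Z' s \<omega>)) \<le> ennreal (h (?Z s \<omega>)) * indicator {0..t} s"
        proof (cases "s \<in> {0<..t}")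
          case True
          then have z: "0 \<le> ?Z s \<omega>" using Z0[of s \<omega>] \<omega> by simp
          have "dist (H (?Z s \<omega> + e)) (H (?Z s \<omega>)) < \<delta>" using e by (intro r(2)) (simp add: dist_real_def)
          then have "H' (?Z s \<omega> + e) \<le> H (?Z s \<omega>)"
            using H(1)[of "?Z s \<omega>"] unfolding H'_def dist_real_def by linarith
          also have "\<dots> \<le> h (?Z s \<omega>)" by (rule H(2)[OF z])
          finally show ?thesis using True by (simp add: Z' ennreal_leI)
        qed simp
      qed
      finally show "ennreal (LINT s:{0<..t}|lborel. H' (?Z' s \<omega>))
          \<le> (\<integral>\<^sup>+s\<in>{0..t}. ennreal (h (?Z s \<omega>)) \<partial>lborel)" .
    qed
    finally have "ennreal ((\<gamma> - \<delta>) * t - 2 * b) \<le> expected_cost x V1 V2 t" .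
    moreover have "(\<gamma> - \<delta>) * t - 2 * b = \<gamma> * t - 2 * b - \<epsilon>" using \<delta>(2) by (simp add: algebra_simps)
    ultimately show "ennreal (\<gamma> * t - 2 * b - \<epsilon>) \<le> expected_cost x V1 V2 t" by simp
  qed
  then show thesis by (rule that)
qed

lemma average_cost_lower_bound:
  assumes "0 \<le> x" "feasible_policy M F (brownian_netput \<mu> \<sigma> W x) V1 V2"
  shows "ennreal \<gamma> \<le> average_cost M h K L k l (brownian_netput \<mu> \<sigma> W x) V1 V2"
proof -
  obtain b where b: "\<And>t. 0 < t \<Longrightarrow> ennreal (\<gamma> * t - 2 * b) \<le> expected_cost x V1 V2 t"
    by (rule feasible_cost_lower_bound) (use assms in blast)
  have "ennreal \<gamma> = Limsup at_top (\<lambda>t. ennreal ((\<gamma> * t + (- 2 * b)) / t))"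
    by (rule lim_imp_Limsup[symmetric, OF trivial_limit_at_top_linorder averaged_affine_tendsto])
  also have "\<dots> \<le> Limsup at_top (\<lambda>t. expected_cost x V1 V2 t / ennreal t)"
  proof (rule Limsup_mono)
    show "eventually (\<lambda>t. ennreal ((\<gamma> * t + (- 2 * b)) / t) \<le> expected_cost x V1 V2 t / ennreal t) at_top"
      using eventually_gt_at_top[of 0]
    proof eventually_elim
      case (elim t)
      have "ennreal ((\<gamma> * t + (- 2 * b)) / t) = ennreal (\<gamma> * t - 2 * b) / ennreal t"
        using elim by (simp add: ennreal_divide_real)
      also have "\<dots> \<le> expected_cost x V1 V2 t / ennreal t"
        by (rule divide_right_mono_ennreal[OF b[OF elim]])
      finally show ?case .
    qed
  qed
  finally show ?thesis unfolding average_cost_eq .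
qed

text \<open>The constant \<open>m\<close> is a lower bound for all four cost rates, so the bound for the total cost also bounds
  each of the expectations required for feasibility.\<close>

lemma band_policy_cost:
  fixes x :: real
  assumes x: "0 \<le> x"
  defines "X \<equiv> brownian_netput \<mu> \<sigma> W x"
  defines "Y1 \<equiv> band_up d D U u X" and "Y2 \<equiv> band_down d D U u X"
  shows "feasible_policy M F X Y1 Y2"
    and "average_cost M h K L k l X Y1 Y2 \<le> ennreal \<gamma>"
proof -
  note d0 = order(1)
  interpret band_policy M F W d D U u \<mu> \<sigma> x
    by unfold_locales (use order in auto)
  obtain f G q b where
    f: "\<And>x. (f has_real_derivative G x) (at x)" and G: "\<And>x. (G has_real_derivative q x) (at x)"
    and uc: "uniformly_continuous_on UNIV q"
    and bd: "\<And>x. \<bar>f x\<bar> \<le> b" "\<And>x. \<bar>G x\<bar> \<le> b" "\<And>x. \<bar>q x\<bar> \<le> b"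
    and gen: "\<And>x. d \<le> x \<Longrightarrow> x \<le> u \<Longrightarrow> \<mu> * G x + \<sigma>\<^sup>2 / 2 * q x = \<gamma> - h x"
    and drop: "f D - f d = - (K + k * (D - d))" "f U - f u = - (L + l * (u - U))"
    by (rule upper_test_function) blast
  define \<kappa>1 where "\<kappa>1 = K + k * (D - d)"
  define \<kappa>2 where "\<kappa>2 = L + l * (u - U)"
  have \<kappa>: "0 \<le> \<kappa>1" "0 \<le> \<kappa>2" using pos order by (simp_all add: \<kappa>1_def \<kappa>2_def)
  define \<eta> where "\<eta> = (\<lambda>z. \<gamma> - (\<mu> * G z + \<sigma>\<^sup>2 / 2 * q z))"
  have \<eta>_h: "\<eta> z = h z" if "d < z" "z < u" for z using gen[of z] that by (simp add: \<eta>_def)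
  have h0: "0 \<le> h z" if "0 \<le> z" for z using hc that by (simp add: holding_cost_def)
  have \<eta>0: "0 \<le> \<eta> z" if "d < z" "z < u" for z
    using \<eta>_h[OF that] h0[of z] that d0 by simp
  define I where "I = (\<lambda>t \<omega>. LINT s:{0<..t}|lborel. \<eta> (Z s \<omega>))"
  have \<eta>_eq: "\<eta> z = \<gamma> - (\<mu> * G z + \<sigma>\<^sup>2 / 2 * q z)" for z by (simp add: \<eta>_def)
  note bound = band_cost_bound[OF _ f G uc bd drop[folded \<kappa>1_def \<kappa>2_def] \<kappa> \<eta>_eq \<eta>0]
  let ?J = "all_jump_costs \<kappa>1 \<kappa>2"
  \<comment> \<open>the test function knows nothing about the initial adjustment, which is accounted for separately\<close>
  define c0 where "c0 = initial_cost K L k l"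
  have c0: "0 \<le> c0"
    unfolding c0_def initial_cost_def Let_def adjustment_cost_def using pos by simp
  have J0: "0 \<le> ?J t \<omega>" for t \<omega>
    unfolding all_jump_costs_def using \<kappa> by (intro sum_nonneg) simp
  have I0: "0 \<le> I t \<omega>" if "0 < t" "\<omega> \<in> space M" for t \<omega>
    unfolding I_def by (rule bound(3)[OF that(1) _ _ that(2)])
  have total: "(\<integral>\<^sup>+\<omega>. ennreal (c0 + ?J t \<omega> + I t \<omega>) \<partial>M) \<le> ennreal c0 + ennreal (2 * b + \<gamma> * t)" if t: "0 < t" for t
  proof -
    have [measurable]: "?J t \<in> borel_measurable M" "I t \<in> borel_measurable M"
      unfolding I_def by (rule all_jump_costs_measurable, use t in simp) (rule bound(2)[OF t])
    have "(\<integral>\<^sup>+\<omega>. ennreal (c0 + ?J t \<omega> + I t \<omega>) \<partial>M) = (\<integral>\<^sup>+\<omega>. ennreal c0 + ennreal (?J t \<omega> + I t \<omega>) \<partial>M)"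
      by (intro nn_integral_cong) (use c0 J0 I0[OF t] in \<open>simp add: add.assoc ennreal_plus\<close>)
    also have "\<dots> = (\<integral>\<^sup>+\<omega>. ennreal c0 \<partial>M) + (\<integral>\<^sup>+\<omega>. ennreal (?J t \<omega> + I t \<omega>) \<partial>M)"
      by (rule nn_integral_add) measurable
    also have "\<dots> \<le> ennreal c0 + ennreal (2 * b + \<gamma> * t)"
      by (rule add_mono) (use bound(1)[OF t] in \<open>simp_all add: I_def emeasure_space_1\<close>)
    finally show ?thesis .
  qed
  have adj: "ennreal K * adjustment_count Y1 t \<omega> + ennreal L * adjustment_count Y2 t \<omega>
      + ennreal k * ennreal (Y1 t \<omega>) + ennreal l * ennreal (Y2 t \<omega>) \<le> ennreal (c0 + ?J t \<omega>)"
    if "0 \<le> t" "\<omega> \<in> space M" for t \<omega>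
    unfolding Y1_def Y2_def X_def c0_def \<kappa>1_def \<kappa>2_def
    by (rule pathwise_adjustment_cost[OF that(2,1)]) (use pos in simp_all)
  have inv: "inventory X Y1 Y2 t \<omega> = Z t \<omega>" if "\<omega> \<in> space M" for t \<omega>
    unfolding X_def Y1_def Y2_def by (rule inventory_band[OF that])
  have V: "control_process M F Y1" "control_process M F Y2"
    unfolding Y1_def Y2_def X_def band_up_eq band_down_eq by (rule weighted_control_process; simp)+
  show "feasible_policy M F X Y1 Y2"
    unfolding feasible_policy_def
  proof (intro conjI V ballI allI impI)
    fix \<omega> t assume "\<omega> \<in> space M" "(0::real) \<le> t"
    then show "0 \<le> inventory X Y1 Y2 t \<omega>"
      using Z_inside[of t \<omega>] d0 by (simp add: inv)
  next
    fix t :: real and Y assume t: "0 \<le> t" and Y: "Y \<in> {Y1, Y2}"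
    \<comment> \<open>the cost bound requires a positive time, whereas feasibility includes \<open>t = 0\<close>\<close>
    define t' where "t' = t + 1"
    have t': "0 < t'" "t \<le> t'" using t by (simp_all add: t'_def)
    have fin: "(\<integral>\<^sup>+\<omega>. ennreal (c0 + ?J t' \<omega> + I t' \<omega>) \<partial>M) < \<infinity>"
      using le_less_trans[OF total[OF t'(1)]] by simp
    have [measurable]: "?J t' \<in> borel_measurable M" "I t' \<in> borel_measurable M"
      unfolding I_def by (rule all_jump_costs_measurable, use t' in simp) (rule bound(2)[OF t'(1)])
    define m where "m = min (min K L) (min k l)"
    have m: "0 < m" "m \<le> K" "m \<le> L" "m \<le> k" "m \<le> l" using pos by (simp_all add: m_def)
    have scale: "v \<le> ennreal (1 / m) * ennreal (c0 + ?J t' \<omega> + I t' \<omega>)"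
      if "ennreal p * v \<le> ennreal (c0 + ?J t' \<omega>)" "m \<le> p" "\<omega> \<in> space M" for p v \<omega>
    proof -
      have "ennreal m * v \<le> ennreal p * v" using that(2) by (intro mult_right_mono ennreal_leI) simp_all
      also have "\<dots> \<le> ennreal (c0 + ?J t' \<omega>)" by (rule that(1))
      also have "\<dots> \<le> ennreal (c0 + ?J t' \<omega> + I t' \<omega>)" using I0[OF t'(1) that(3)] by (intro ennreal_leI) simp
      finally have "ennreal (1 / m) * (ennreal m * v) \<le> ennreal (1 / m) * ennreal (c0 + ?J t' \<omega> + I t' \<omega>)"
        by (rule mult_left_mono) simp
      moreover have "ennreal (1 / m) * ennreal m = 1" using m by (simp flip: ennreal_mult')
      then have "ennreal (1 / m) * (ennreal m * v) = v" by (metis mult.assoc mult_1)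
      ultimately show ?thesis by simp
    qed
    have fin': "(\<integral>\<^sup>+\<omega>. ennreal (1 / m) * ennreal (c0 + ?J t' \<omega> + I t' \<omega>) \<partial>M) < \<infinity>"
      using fin by (subst nn_integral_cmult) (simp_all add: ennreal_mult_less_top)
    have parts: "ennreal K * adjustment_count Y1 t' \<omega> \<le> ennreal (c0 + ?J t' \<omega>)"
      "ennreal L * adjustment_count Y2 t' \<omega> \<le> ennreal (c0 + ?J t' \<omega>)"
      "ennreal k * ennreal (Y1 t' \<omega>) \<le> ennreal (c0 + ?J t' \<omega>)"
      "ennreal l * ennreal (Y2 t' \<omega>) \<le> ennreal (c0 + ?J t' \<omega>)" if "\<omega> \<in> space M" for \<omega>
      by (rule order_trans[OF _ adj[OF less_imp_le[OF t'(1)] that]]; simp add: add_increasing add_increasing2)+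
    have "ennreal (Y t \<omega>) \<le> ennreal (Y t' \<omega>)" if "\<omega> \<in> space M" for \<omega>
    proof -
      have "mono_on {0..} (\<lambda>s. Y s \<omega>)" using V Y that by (auto simp: control_process_def)
      from mono_onD[OF this, of t t'] show ?thesis using t t' by (intro ennreal_leI) simp
    qed
    moreover have "ennreal (Y t' \<omega>) \<le> ennreal (1 / m) * ennreal (c0 + ?J t' \<omega> + I t' \<omega>)" if "\<omega> \<in> space M" for \<omega>
      using Y scale[OF parts(3)[OF that] m(4) that] scale[OF parts(4)[OF that] m(5) that] by auto
    ultimately have "(\<integral>\<^sup>+\<omega>. ennreal (Y t \<omega>) \<partial>M) \<le> (\<integral>\<^sup>+\<omega>. ennreal (1 / m) * ennreal (c0 + ?J t' \<omega> + I t' \<omega>) \<partial>M)"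
      by (intro nn_integral_mono) (rule order_trans)
    then show "(\<integral>\<^sup>+\<omega>. ennreal (Y t \<omega>) \<partial>M) < \<infinity>" using fin' by (rule le_less_trans)
    have "adjustment_count Y t \<omega> \<le> adjustment_count Y t' \<omega>" for \<omega>
      unfolding adjustment_count_def using t' by (intro emeasure_mono) auto
    moreover have "adjustment_count Y t' \<omega> \<le> ennreal (1 / m) * ennreal (c0 + ?J t' \<omega> + I t' \<omega>)" if "\<omega> \<in> space M" for \<omega>
      using Y scale[OF parts(1)[OF that] m(2) that] scale[OF parts(2)[OF that] m(3) that] by auto
    ultimately have "(\<integral>\<^sup>+\<omega>. adjustment_count Y t \<omega> \<partial>M) \<le> (\<integral>\<^sup>+\<omega>. ennreal (1 / m) * ennreal (c0 + ?J t' \<omega> + I t' \<omega>) \<partial>M)"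
      by (intro nn_integral_mono) (rule order_trans)
    then show "(\<integral>\<^sup>+\<omega>. adjustment_count Y t \<omega> \<partial>M) < \<infinity>" using fin' by (rule le_less_trans)
  qed
  have cost_le: "expected_cost x Y1 Y2 t \<le> ennreal (max 0 \<gamma> * t + (c0 + 2 * b))" if t: "0 < t" for t
  proof -
    have "expected_cost x Y1 Y2 t \<le> (\<integral>\<^sup>+\<omega>. ennreal (c0 + ?J t \<omega> + I t \<omega>) \<partial>M)"
      unfolding expected_cost_def X_def[symmetric]
    proof (rule nn_integral_mono)
      fix \<omega> assume \<omega>: "\<omega> \<in> space M"
      have "(\<integral>\<^sup>+s\<in>{0..t}. ennreal (h (inventory X Y1 Y2 s \<omega>)) \<partial>lborel)
          = (\<integral>\<^sup>+s. ennreal (indicator {0<..t} s *\<^sub>R \<eta> (Z s \<omega>)) \<partial>lborel)"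
      proof (rule nn_integral_cong_AE)
        \<comment> \<open>the cost integral is taken over \<open>[0, t]\<close>, the time integral over \<open>(0, t]\<close>\<close>
        have "AE s in lborel. s \<noteq> (0::real)" by (rule AE_lborel_singleton)
        then show "AE s in lborel. ennreal (h (inventory X Y1 Y2 s \<omega>)) * indicator {0..t} s
            = ennreal (indicator {0<..t} s *\<^sub>R \<eta> (Z s \<omega>))"
        proof eventually_elim
          case (elim s)
          show ?case
          proof (cases "s \<in> {0<..t}")
            case True
            then show ?thesis using Z_inside[of s \<omega>] \<omega> \<eta>_h[of "Z s \<omega>"] by (simp add: inv)
          next
            case False
            then have "s \<notin> {0..t}" using elim by auto
            then show ?thesis using False by simp
          qed
        qed
      qed
      also have "\<dots> = ennreal (I t \<omega>)"
        unfolding I_def set_lebesgue_integral_def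
      proof (rule nn_integral_eq_integral)
        show "integrable lborel (\<lambda>s. indicator {0<..t} s *\<^sub>R \<eta> (Z s \<omega>))"
          unfolding set_integrable_def[symmetric] by (rule bound(4)[OF t _ _ \<omega>])
        show "AE s in lborel. 0 \<le> indicator {0<..t} s *\<^sub>R \<eta> (Z s \<omega>)"
        proof (rule AE_I2)
          fix s
          show "0 \<le> indicator {0<..t} s *\<^sub>R \<eta> (Z s \<omega>)"
            using \<eta>0[of "Z s \<omega>"] Z_inside[of s \<omega>] \<omega> by (cases "s \<in> {0<..t}") simp_all
        qed
      qed
      finally have hold: "(\<integral>\<^sup>+s\<in>{0..t}. ennreal (h (inventory X Y1 Y2 s \<omega>)) \<partial>lborel) = ennreal (I t \<omega>)" .
      have "ennreal (I t \<omega>) + (ennreal K * adjustment_count Y1 t \<omega> + ennreal L * adjustment_count Y2 t \<omega>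
          + ennreal k * ennreal (Y1 t \<omega>) + ennreal l * ennreal (Y2 t \<omega>)) \<le> ennreal (I t \<omega>) + ennreal (c0 + ?J t \<omega>)"
        using adj[OF less_imp_le[OF t] \<omega>] by (rule add_left_mono)
      also have "\<dots> = ennreal (c0 + ?J t \<omega> + I t \<omega>)"
        using I0[OF t \<omega>] c0 J0[of t \<omega>] by (simp add: add.commute flip: ennreal_plus)
      finally show "(\<integral>\<^sup>+s\<in>{0..t}. ennreal (h (inventory X Y1 Y2 s \<omega>)) \<partial>lborel)
          + ennreal K * adjustment_count Y1 t \<omega> + ennreal L * adjustment_count Y2 t \<omega>
          + ennreal k * ennreal (Y1 t \<omega>) + ennreal l * ennreal (Y2 t \<omega>) \<le> ennreal (c0 + ?J t \<omega> + I t \<omega>)"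
        unfolding hold by (simp only: add.assoc)
    qed
    also have "\<dots> \<le> ennreal c0 + ennreal (2 * b + \<gamma> * t)" by (rule total[OF t])
    also have "\<dots> \<le> ennreal c0 + ennreal (2 * b + max 0 \<gamma> * t)"
      using t by (intro add_left_mono ennreal_leI mult_right_mono) simp_all
    also have "\<dots> = ennreal (max 0 \<gamma> * t + (c0 + 2 * b))"
    proof -
      have "0 \<le> b" using bd(1)[of 0] by linarith
      then show ?thesis using c0 t by (subst ennreal_plus[symmetric]) (simp_all add: algebra_simps)
    qed
    finally show ?thesis .
  qed
  have "average_cost M h K L k l X Y1 Y2 \<le> Limsup at_top (\<lambda>t. ennreal ((max 0 \<gamma> * t + (c0 + 2 * b)) / t))"
    unfolding X_def average_cost_eq
  proof (rule Limsup_mono)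
    show "eventually (\<lambda>t. expected_cost x Y1 Y2 t / ennreal t \<le> ennreal ((max 0 \<gamma> * t + (c0 + 2 * b)) / t)) at_top"
      using eventually_gt_at_top[of 0]
    proof eventually_elim
      case (elim t)
      show ?case
        unfolding ennreal_divide_real[OF elim, symmetric]
        by (rule divide_right_mono_ennreal[OF cost_le[OF elim]])
    qed
  qed
  also have "\<dots> = ennreal (max 0 \<gamma>)"
    by (rule lim_imp_Limsup[OF trivial_limit_at_top_linorder averaged_affine_tendsto])
  also have "\<dots> = ennreal \<gamma>" by (cases "0 \<le> \<gamma>") (simp_all add: max_def ennreal_neg)
  finally show "average_cost M h K L k l X Y1 Y2 \<le> ennreal \<gamma>" .
qed

end

theorem theorem7p3:
  fixes M :: "'a measure" and F :: "real \<Rightarrow> 'a measure" and W :: "real \<Rightarrow> 'a \<Rightarrow> real"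
    and \<mu> \<sigma> K L k l a :: real and h :: "real \<Rightarrow> real"
    and d D U u A B :: real
  assumes "brownian_motion M F W"
    and "0 < \<mu>" and "0 < \<sigma>" and "0 < K" and "0 < L" and "0 < k" and "0 < l"
    and "holding_cost h a"
    and "band_conditions (g_fun \<mu> \<sigma> h a A B) a K L k l d D U u"
  shows "\<forall>x\<ge>0.
    (let X = brownian_netput \<mu> \<sigma> W x; Y1 = band_up d D U u X; Y2 = band_down d D U u X in
       feasible_policy M F X Y1 Y2 \<and>
       (\<forall>V1 V2. feasible_policy M F X V1 V2 \<longrightarrow>
          average_cost M h K L k l X Y1 Y2 \<le> average_cost M h K L k l X V1 V2))"
proof -
  interpret brownian_motion M F W by (rule assms(1))
  interpret inventory_model M F W \<mu> \<sigma> K L k l a h d D U u A B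
    by unfold_locales (use assms in auto)
  show ?thesis
    unfolding Let_def
    using band_policy_cost average_cost_lower_bound order_trans by blast
qed

end
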